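(* Let $\diamondsuit\in\{\emptyset,h,s\}$ and let $p=(p_i)_{i\in\mathcal{A}^{\diamondsuit}}$ be a probability vector with all $p_i\in\,]0,1[$. Then the stochastic process $\mathcal{H}^{\diamondsuit}=(\mathcal{H}^{\diamondsuit}_\ell)_{\ell\ge0}$ is a Markov chain on $\mathcal{P}^{\diamondsuit}$ with transition probabilities $$\Pi_{\mathcal{H}^{\diamondsuit}}(\mu,\lambda)=\frac{s^{\diamondsuit}_\lambda(p)}{s^{\diamondsuit}_\mu(p)}\,\delta^{\diamondsuit}_{\mu\rightsquigarrow\lambda},\qquad \lambda,\mu\in\mathcal{P}^{\diamondsuit},$$ where $\delta^{\diamondsuit}_{\mu\rightsquigarrow\lambda}=1$ if the diagram of $\lambda\in\mathcal{P}^{\diamondsuit}$ is obtained from that of $\mu$ by adding one box, and $\delta^{\diamondsuit}_{\mu\rightsquigarrow\lambda}=0$ otherwise.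
   Context: **Cases and partitions.** Fix positive integers $n$ (and $m$ when $\diamondsuit=h$). The cases $\diamondsuit=\emptyset,h,s$ correspond to $\mathfrak{gl}(n),\mathfrak{gl}(m,n),\mathfrak{q}(n)$. Alphabets: $\mathcal{A}^{\emptyset}=\mathcal{A}^{s}=\{1<\cdots<n\}$, $\mathcal{A}^{h}=\{\overline m<\overline{m-1}<\cdots<\overline 1<1<\cdots<n\}$. - $\mathcal{P}^{\emptyset}=\{\lambda\in\mathbb{Z}^n:\lambda_1\ge\cdots\ge\lambda_n\ge 0\}$, with the usual Young diagram. - $\mathcal{P}^{s}=\{\lambda\in\mathcal{P}^{\emptyset}:\lambda_{i+1}>0\Rightarrow\lambda_i>\lambda_{i+1}\}$ (strict partitions), with the shifted Young diagram (row $i$ has $\lambda_i$ boxes and is shifted $i-1$ units to the right). - $\mathcal{P}^{h}$ is the set of hook partitions: partitions $\lambda$ of arbitrary length with $i$-th part at most $n$ for every $i>m$, with the usual Young diagram. **Tableaux and Schur functions.** A $\diamondsuit$-tableau of shape $\lambda\in\mathcal{P}^{\diamondsuit}$ is a filling of the diagram of $\lambda$ by letters of $\mathcal{A}^{\diamondsuit}$ such that: - $\diamondsuit=\emptyset$: rows weakly increase from left to right and columns strictly increase from top to bottom; - $\diamondsuit=h$: rows weakly increase from left to right with no repetition of unbarred letters in a row, and columns weakly increase from top to bottom with no repetition of barred letters in a column; - $\diamondsuit=s$: for each $i$, the word $w_i$ of row $i$ read from left to right is a hook word, and $w_i$ is a hook subword (subsequence) of maximal length in the concatenation $w_{i+1}w_i$.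 Here a nonempty word $x_1\cdots x_\ell$ is a hook word if $x_1\ge\cdots\ge x_k<x_{k+1}<\cdots<x_\ell$ for some $1\le k\le\ell$; its decreasing part is $w_\downarrow=x_1\cdots x_k$ and its increasing part is $w_\uparrow=x_{k+1}\cdots x_\ell$ (possibly empty). Set $s^{\diamondsuit}_\lambda(x)=\sum_T\prod_{i\in\mathcal{A}^{\diamondsuit}}x_i^{\#\{\text{letters } i \text{ in } T\}}$, the sum being over all $\diamondsuit$-tableaux $T$ of shape $\lambda$; $s^{\diamondsuit}_\lambda(p)$ is its value at $x=p$. **Insertion.** For a tableau $T$ and a letter $x$, the tableau $x\to T$ is defined recursively; $x\to\emptyset$ is the one-box tableau containing $x$. - $\diamondsuit=\emptyset$: let $T=C_1C_2\cdots C_r$ (columns, left to right). If all letters of $C_1$ are $<x$, add a box containing $x$ at the bottom of $C_1$. Otherwise let $y=\min\{t\in C_1: t\ge x\}$, let $C_1'$ be $C_1$ with $y$ replaced by $x$, and set $x\to T=C_1'(y\to C_2\cdots C_r)$. - $\diamondsuit=h$: let $T=C_1\cdots C_r$ (columns). If $x$ is barred: if all letters of $C_1$ are $<x$, add $x$ at the bottom of $C_1$; otherwise $y=\min\{t\in C_1:t\ge x\}$. If $x$ is unbarred: if all letters of $C_1$ are $\le x$, add $x$ at the bottom of $C_1$; otherwise $y=\min\{t\in C_1:t>x\}$. In the "otherwise" cases, replace the highest occurrence of $y$ in $C_1$ by $x$ to get $C_1'$ and set $x\to T=C_1'(y\to C_2\cdots C_r)$. - $\diamondsuit=s$: let $T=L_1\cdots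 L_r$ (rows, top to bottom) and let $w=w_\downarrow w_\uparrow$ be the word of $L_1$ read from left to right. If $wx$ is a hook word, add a box containing $x$ at the right end of $L_1$. Otherwise let $y=\min\{t\in w_\uparrow:t\ge x\}$, replace $y$ by $x$ in $w_\uparrow$; let $z=\max\{t\in w_\downarrow:t<y\}$, replace (the leftmost) $z$ by $y$ in $w_\downarrow$; with $L_1'$ the resulting row, $x\to T=L_1'(z\to L_2\cdots L_r)$. For a word $w=x_1\cdots x_\ell$, $P^{\diamondsuit}(w)=x_\ell\to(\cdots(x_2\to(x_1\to\emptyset)))$; it is a $\diamondsuit$-tableau. **Process.** On $(\mathcal{A}^{\diamondsuit})^{\mathbb{N}}$ with the product probability $\mathbb{P}=p^{\otimes\mathbb{N}}$, let $x_1,x_2,\ldots$ be the coordinate letters. $\mathcal{H}^{\diamondsuit}_\ell\in\mathcal{P}^{\diamondsuit}$ is the shape of $P^{\diamondsuit}(x_1\cdots x_\ell)$, with $\mathcal{H}^{\diamondsuit}_0$ the empty partition. *)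

theory Defs
  imports "HOL-Probability.Probability" "HOL-Library.Sublist"
begin

text \<open>
  The cases \<open>\<emptyset>\<close>, \<open>h\<close>, \<open>s\<close>, i.e. \<open>gl(n)\<close>, \<open>gl(m,n)\<close>, \<open>q(n)\<close>, together with their size
  parameters: \<open>Gl n\<close>, \<open>GlSuper m n\<close>, \<open>Queer n\<close>.
\<close>

datatype diamond = Gl nat | GlSuper nat nat | Queer nat

fun positive_params :: "diamond \<Rightarrow> bool" where
  "positive_params (Gl n) \<longleftrightarrow> 0 < n"
| "positive_params (GlSuper m n) \<longleftrightarrow> 0 < m \<and> 0 < n"
| "positive_params (Queer n) \<longleftrightarrow> 0 < n"

text \<open>
  Letters are nonzero integers: the unbarred letter \<open>i\<close> is \<open>i\<close> and the barred letter
  \<open>i\<close> is \<open>- i\<close>, so the order of the alphabet is the order of the integers.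
\<close>

type_synonym letter = int

abbreviation barred :: "letter \<Rightarrow> bool" where
  "barred x \<equiv> x < 0"

fun alphabet :: "diamond \<Rightarrow> letter set" where
  "alphabet (Gl n) = {1..int n}"
| "alphabet (GlSuper m n) = {- int m..-1} \<union> {1..int n}"
| "alphabet (Queer n) = {1..int n}"


section \<open>Partitions and diagrams\<close>

text \<open>
  A partition is the sequence of its parts, extended by zeros. Indices start at 0, so
  \<open>la i\<close> is the part number \<open>i + 1\<close>. Boxes are pairs (row, column), also counted from 0.
\<close>

type_synonym partition = "nat \<Rightarrow> nat"

fun partitions :: "diamond \<Rightarrow> partition set" where
  "partitions (Gl n) = {la. antimono la \<and> (\<forall>i\<ge>n. la i = 0)}"
| "partitions (GlSuper m n) =
     {la. antimono la \<and> finite {i. la i \<noteq> 0} \<and> (\<forall>i\<ge>m. la i \<le> n)}"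
| "partitions (Queer n) =
     {la. antimono la \<and> (\<forall>i\<ge>n. la i = 0) \<and> (\<forall>i. 0 < la (Suc i) \<longrightarrow> la (Suc i) < la i)}"

fun diagram :: "diamond \<Rightarrow> partition \<Rightarrow> (nat \<times> nat) set" where
  "diagram (Queer n) la = {(i, j). i \<le> j \<and> j < i + la i}"
| "diagram _ la = {(i, j). j < la i}"

definition adds_box :: "diamond \<Rightarrow> partition \<Rightarrow> partition \<Rightarrow> bool" where
  "adds_box d mu la \<longleftrightarrow>
     (\<exists>b. b \<notin> diagram d mu \<and> diagram d la = insert b (diagram d mu))"


section \<open>Hook words\<close>

text \<open>
  \<open>hook_at k w\<close> says \<open>x\<^sub>1 \<ge> \<dots> \<ge> x\<^sub>k < x\<^sub>k\<^sub>+\<^sub>1 < \<dots> < x\<^sub>l\<close> for \<open>w = x\<^sub>1 \<dots> x\<^sub>l\<close>; the second list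
  starts at \<open>x\<^sub>k\<close>. The index \<open>k\<close> is unique when it exists.
\<close>

definition hook_at :: "nat \<Rightarrow> letter list \<Rightarrow> bool" where
  "hook_at k w \<longleftrightarrow> 1 \<le> k \<and> k \<le> length w \<and>
     sorted_wrt (\<ge>) (take k w) \<and> sorted_wrt (<) (drop (k - 1) w)"

definition hook_word :: "letter list \<Rightarrow> bool" where
  "hook_word w \<longleftrightarrow> (\<exists>k. hook_at k w)"

definition down_part :: "letter list \<Rightarrow> letter list" where
  "down_part w = take (THE k. hook_at k w) w"

definition up_part :: "letter list \<Rightarrow> letter list" where
  "up_part w = drop (THE k. hook_at k w) w"


section \<open>Tableaux and Schur functions\<close>

text \<open>
  A filling is the list of its columns (left to right, each read from top to bottom) for
  \<open>Gl\<close> and \<open>GlSuper\<close>, and the list of its rows (top to bottom, each read from left to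
  right) for \<open>Queer\<close>. \<open>cells\<close> is the set of boxes filled.
\<close>

type_synonym filling = "letter list list"

fun cells :: "diamond \<Rightarrow> filling \<Rightarrow> (nat \<times> nat) set" where
  "cells (Queer n) T = {(i, j). i < length T \<and> i \<le> j \<and> j < i + length (T ! i)}"
| "cells _ T = {(i, j). j < length T \<and> i < length (T ! j)}"

text \<open>The conditions on the letters of a filling, for fillings of a diagram.\<close>

fun tableau_cond :: "diamond \<Rightarrow> filling \<Rightarrow> bool" where
  "tableau_cond (Gl n) T \<longleftrightarrow>
     (\<forall>i j j'. (i, j) \<in> cells (Gl n) T \<and> (i, j') \<in> cells (Gl n) T \<and> j < j' \<longrightarrow>
        T ! j ! i \<le> T ! j' ! i) \<and>
     (\<forall>i i' j. (i, j) \<in> cells (Gl n) T \<and> (i', j) \<in> cells (Gl n) T \<and> i < i' \<longrightarrow>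
        T ! j ! i < T ! j ! i')"
| "tableau_cond (GlSuper m n) T \<longleftrightarrow>
     (\<forall>i j j'. (i, j) \<in> cells (GlSuper m n) T \<and> (i, j') \<in> cells (GlSuper m n) T \<and> j < j' \<longrightarrow>
        T ! j ! i \<le> T ! j' ! i \<and> (T ! j ! i = T ! j' ! i \<longrightarrow> barred (T ! j ! i))) \<and>
     (\<forall>i i' j. (i, j) \<in> cells (GlSuper m n) T \<and> (i', j) \<in> cells (GlSuper m n) T \<and> i < i' \<longrightarrow>
        T ! j ! i \<le> T ! j ! i' \<and> (T ! j ! i = T ! j ! i' \<longrightarrow> \<not> barred (T ! j ! i)))"
| "tableau_cond (Queer n) T \<longleftrightarrow>
     (\<forall>w\<in>set T. hook_word w) \<and>
     (\<forall>i. Suc i < length T \<longrightarrow>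
        (\<forall>u. subseq u (T ! Suc i @ T ! i) \<and> hook_word u \<longrightarrow> length u \<le> length (T ! i)))"

text \<open>Empty columns (rows) are excluded so that a filling has only one representation.\<close>

definition tableaux :: "diamond \<Rightarrow> partition \<Rightarrow> filling set" where
  "tableaux d la = {T. [] \<notin> set T \<and> cells d T = diagram d la \<and>
     set (concat T) \<subseteq> alphabet d \<and> tableau_cond d T}"

definition schur :: "diamond \<Rightarrow> partition \<Rightarrow> (letter \<Rightarrow> real) \<Rightarrow> real" where
  "schur d la x = (\<Sum>T\<in>tableaux d la. \<Prod>i\<in>alphabet d. x i ^ count_list (concat T) i)"

definition shape :: "diamond \<Rightarrow> filling \<Rightarrow> partition" where
  "shape d T i = card {j. (i, j) \<in> cells d T}"


section \<open>Insertion\<close>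

fun replace_first :: "letter \<Rightarrow> letter \<Rightarrow> letter list \<Rightarrow> letter list" where
  "replace_first y x [] = []"
| "replace_first y x (t # w) = (if t = y then x # w else t # replace_first y x w)"

fun insert_Gl :: "letter \<Rightarrow> filling \<Rightarrow> filling" where
  "insert_Gl x [] = [[x]]"
| "insert_Gl x (C # Cs) =
     (if \<forall>t\<in>set C. t < x then (C @ [x]) # Cs
      else let y = Min {t \<in> set C. x \<le> t}
           in replace_first y x C # insert_Gl y Cs)"

fun insert_GlSuper :: "letter \<Rightarrow> filling \<Rightarrow> filling" where
  "insert_GlSuper x [] = [[x]]"
| "insert_GlSuper x (C # Cs) =
     (if barred x then
        if \<forall>t\<in>set C. t < x then (C @ [x]) # Cs
        else let y = Min {t \<in> set C. x \<le> t}
             in replace_first y x C # insert_GlSuper y Cs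
      else
        if \<forall>t\<in>set C. t \<le> x then (C @ [x]) # Cs
        else let y = Min {t \<in> set C. x < t}
             in replace_first y x C # insert_GlSuper y Cs)"

fun insert_Queer :: "letter \<Rightarrow> filling \<Rightarrow> filling" where
  "insert_Queer x [] = [[x]]"
| "insert_Queer x (L # Ls) =
     (if hook_word (L @ [x]) then (L @ [x]) # Ls
      else let y = Min {t \<in> set (up_part L). x \<le> t};
               z = Max {t \<in> set (down_part L). t < y}
           in (replace_first z y (down_part L) @ replace_first y x (up_part L))
              # insert_Queer z Ls)"

fun insert_letter :: "diamond \<Rightarrow> letter \<Rightarrow> filling \<Rightarrow> filling" where
  "insert_letter (Gl n) = insert_Gl"
| "insert_letter (GlSuper m n) = insert_GlSuper"
| "insert_letter (Queer n) = insert_Queer"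

definition P_tableau :: "diamond \<Rightarrow> letter list \<Rightarrow> filling" where
  "P_tableau d w = fold (insert_letter d) w []"


section \<open>The process\<close>

definition letter_space :: "diamond \<Rightarrow> (letter \<Rightarrow> real) \<Rightarrow> (nat \<Rightarrow> letter) measure" where
  "letter_space d p = PiM UNIV (\<lambda>_. point_measure (alphabet d) (\<lambda>i. ennreal (p i)))"

definition shape_process :: "diamond \<Rightarrow> nat \<Rightarrow> (nat \<Rightarrow> letter) \<Rightarrow> partition" where
  "shape_process d l \<omega> = shape d (P_tableau d (map \<omega> [0..<l]))"

definition shape_kernel :: "diamond \<Rightarrow> (letter \<Rightarrow> real) \<Rightarrow> partition \<Rightarrow> partition \<Rightarrow> real" where
  "shape_kernel d p mu la =
     schur d la p / schur d mu p * (if adds_box d mu la then 1 else 0)"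

text \<open>
  Time-homogeneous Markov chains on a countable state space \<open>S\<close> with transition matrix \<open>K\<close>.
  Measurability into \<open>count_space S\<close> includes that \<open>X\<close> takes its values in \<open>S\<close>.
\<close>

definition markov_chain ::
  "'w measure \<Rightarrow> (nat \<Rightarrow> 'w \<Rightarrow> 's) \<Rightarrow> 's set \<Rightarrow> ('s \<Rightarrow> 's \<Rightarrow> real) \<Rightarrow> bool" where
  "markov_chain M X S K \<longleftrightarrow>
     prob_space M \<and> countable S \<and>
     (\<forall>l. X l \<in> measurable M (count_space S)) \<and>
     (\<forall>x\<in>S. (\<forall>y\<in>S. 0 \<le> K x y) \<and> (K x has_sum 1) S) \<and>
     (\<forall>l x y. (\<forall>k\<le>l. x k \<in> S) \<and> y \<in> S \<and>
        \<P>(\<omega> in M. \<forall>k\<le>l. X k \<omega> = x k) \<noteq> 0 \<longrightarrow>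
        \<P>(\<omega> in M. X (Suc l) \<omega> = y \<bar> \<forall>k\<le>l. X k \<omega> = x k) = K (x l) y)"

end

theory Submission
  imports Defs
begin

text \<open>
  Why the shapes form a Markov chain. Insertion keeps the letters and adds one box, and the
  point is that it loses nothing: if \<open>\<lambda>\<close> is obtained from \<open>\<mu>\<close> by adding a box, then every
  tableau of shape \<open>\<lambda>\<close> is \<open>x \<rightarrow> T\<close> for exactly one letter \<open>x\<close> and one tableau \<open>T\<close> of shape \<open>\<mu>\<close>
  (\<open>insert_tableau_surj\<close>, \<open>insert_tableau_inj\<close>). By induction on the length, the words whose
  shapes follow a given sequence of partitions growing by one box and ending in \<open>\<lambda>\<close> are in
  bijection with the tableaux of shape \<open>\<lambda>\<close>, with the same letters (\<open>path_words_bij\<close>). So the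
  probability of such a sequence is \<open>s\<^sub>\<lambda>(p)\<close>: it depends on the last shape only, and the
  quotient of two such probabilities is the transition probability. The same bijection,
  summed over all \<open>\<lambda>\<close> above \<open>\<mu>\<close>, gives \<open>\<Sum>\<^sub>\<lambda> s\<^sub>\<lambda>(p) = s\<^sub>\<mu>(p)\<close> (\<open>pieri\<close>), so the rows of the
  transition matrix sum to 1.

  Why insertion is reversible. The three cases are treated by one argument. A tableau is a list
  of \<open>lines\<close>, its columns for \<open>gl(n)\<close> and \<open>gl(m,n)\<close> and its rows for \<open>q(n)\<close>. A letter \<open>x\<close>
  is appended to the first line \<open>C\<close> if \<open>C x\<close> is again a line; otherwise it changes \<open>C\<close> into a line
  \<open>C'\<close> of the same length and sends a letter \<open>y\<close> to the next line. Two facts make this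
  reversible. The step from \<open>(C, x)\<close> to \<open>(C', y)\<close> is a bijection between the pairs for which
  \<open>C x\<close> is not a line and the pairs for which \<open>y C'\<close> is not a line. And replacing the factor
  \<open>C x\<close> of a word by \<open>y C'\<close> does not change the length of the longest line among its
  subsequences. Since two successive lines \<open>C\<^sub>1, C\<^sub>2\<close> of a tableau are characterised by \<open>C\<^sub>1\<close>
  being such a longest line in \<open>C\<^sub>2 C\<^sub>1\<close> (the definition for \<open>q(n)\<close>, and an equivalent
  form of the row condition for columns, \<open>column_adjacent_iff\<close>), the tableau conditions pass
  from one side of the step to the other, in both directions. The locale \<open>insertion\<close> collects
  these facts and proves that the whole insertion is injective and surjective.

  Why the two facts hold. Columns and hook words are both described by a relation \<open>G\<close> such that
  \<open>G\<close> and its complement are transitive: a column is a \<open>G\<close>-chain, a hook word is a \<open>G\<close>-chain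
  followed by a chain for the complement. A step only moves two or three letters, and a chain
  that used them in their old places is repaired by letting them stand in for each other
  (\<open>column_bump_lines_le\<close>, \<open>hook_dominated_swap\<close>). Reading all words backwards exchanges
  the step and its inverse, with \<open>G\<close> replaced by its converse for columns and by the converse of
  its complement for hook words. These relations satisfy the same hypothesis, so that every
  statement about the inverse step is the mirror image of one about the step.
\<close>

section \<open>Tableaux as lists of lines\<close>

text \<open>
  The quantity carried through an insertion: a bound for the longest line among the subsequences of
  a word.
\<close>

definition lines_le :: "('a list \<Rightarrow> bool) \<Rightarrow> nat \<Rightarrow> 'a list \<Rightarrow> bool" where
  "lines_le line n w \<longleftrightarrow> (\<forall>s. subseq s w \<and> line s \<longrightarrow> length s \<le> n)"

lemma lines_leD: "lines_le line n w \<Longrightarrow> subseq s w \<Longrightarrow> line s \<Longrightarrow> length s \<le> n"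
  by (simp add: lines_le_def)

lemma lines_le_subseq: "lines_le line n w \<Longrightarrow> subseq v w \<Longrightarrow> lines_le line n v"
  by (meson lines_le_def subseq_order.order_trans)

text \<open>
  \<open>C1\<close> is written after \<open>C2\<close> since the reading word of a filling goes from its last line to its first.
\<close>

definition adjacent_ok :: "('a list \<Rightarrow> bool) \<Rightarrow> 'a list \<Rightarrow> 'a list \<Rightarrow> bool" where
  "adjacent_ok line C1 C2 \<longleftrightarrow> lines_le line (length C1) (C2 @ C1)"

definition line_tableau :: "('a list \<Rightarrow> bool) \<Rightarrow> 'a list list \<Rightarrow> bool" where
  "line_tableau line T \<longleftrightarrow> [] \<notin> set T \<and> (\<forall>C\<in>set T. line C) \<and> successively (adjacent_ok line) T"

lemma line_tableau_Nil [simp]: "line_tableau line []"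
  by (simp add: line_tableau_def)

lemma line_tableau_Cons:
  "line_tableau line (C # T) \<longleftrightarrow>
     C \<noteq> [] \<and> line C \<and> (T \<noteq> [] \<longrightarrow> adjacent_ok line C (hd T)) \<and> line_tableau line T"
  by (auto simp: line_tableau_def successively_Cons)

text \<open>
  The effect of an insertion on the list of line lengths.
\<close>

definition grow :: "nat list \<Rightarrow> nat \<Rightarrow> nat list" where
  "grow ks k = (if k < length ks then ks[k := Suc (ks ! k)] else ks @ [1])"

lemma grow_simps [simp]:
  "grow [] k = [1]" "grow (a # ks) 0 = Suc a # ks" "grow (a # ks) (Suc k) = a # grow ks k"
  by (auto simp: grow_def)

definition lengths_ok :: "(nat \<Rightarrow> nat \<Rightarrow> bool) \<Rightarrow> nat list \<Rightarrow> bool" where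
  "lengths_ok bound ks \<longleftrightarrow> 0 \<notin> set ks \<and> successively bound ks"

text \<open>
  A class of lines closed under subsequences, with the bijection \<open>bump\<close> between the pairs \<open>(C, x)\<close>
  for which \<open>C x\<close> is not a line and the pairs \<open>(C', y)\<close> for which \<open>y C'\<close> is not a line.
  The relation \<open>bound\<close> is the condition on the lengths of successive lines in a diagram. It is
  needed for \<open>lines_le_butlast\<close>: removing a box keeps a tableau only if what remains is still
  a diagram.
\<close>

locale insertion =
  fixes line :: "'a list \<Rightarrow> bool"
    and bump :: "'a list \<Rightarrow> 'a \<Rightarrow> 'a list \<Rightarrow> 'a \<Rightarrow> bool"
    and bound :: "nat \<Rightarrow> nat \<Rightarrow> bool"
    and ins :: "'a \<Rightarrow> 'a list list \<Rightarrow> 'a list list"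
  assumes line_subseq: "\<And>v w. line w \<Longrightarrow> subseq v w \<Longrightarrow> line v"
    and line_single: "\<And>x. line [x]"
    and bump_line:
      "\<And>C x C' y. bump C x C' y \<Longrightarrow> line C \<and> \<not> line (C @ [x]) \<and> line C' \<and> \<not> line (y # C')"
    and bump_mset: "\<And>C x C' y. bump C x C' y \<Longrightarrow> mset (C @ [x]) = mset (y # C')"
    and unbump_ex: "\<And>C' y. line C' \<Longrightarrow> \<not> line (y # C') \<Longrightarrow> \<exists>C x. bump C x C' y"
    and bump_ex: "\<And>C x. line C \<Longrightarrow> \<not> line (C @ [x]) \<Longrightarrow> \<exists>C' y. bump C x C' y"
    and unbump_fun: "\<And>C x D z C' y. bump C x C' y \<Longrightarrow> bump D z C' y \<Longrightarrow> C = D \<and> x = z"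
    and bump_lines_le: "\<And>C x C' y n p q. bump C x C' y \<Longrightarrow>
           lines_le line n (p @ C @ x # q) \<longleftrightarrow> lines_le line n (p @ y # C' @ q)"
    and lines_le_append: "\<And>C1 C2 x n. line C1 \<Longrightarrow> \<not> line (C1 @ [x]) \<Longrightarrow>
           lines_le line n (C2 @ C1) \<Longrightarrow> lines_le line n (C2 @ C1 @ [x])"
    and lines_le_Cons: "\<And>C1 C2 y n. line C2 \<Longrightarrow> \<not> line (y # C2) \<Longrightarrow>
           lines_le line n (C2 @ C1) \<Longrightarrow> lines_le line n (y # C2 @ C1)"
    and lines_le_butlast: "\<And>u v z. line (u @ [z]) \<Longrightarrow> line v \<Longrightarrow> u \<noteq> [] \<Longrightarrow> bound (length u) (length v) \<Longrightarrow>
           lines_le line (Suc (length u)) (v @ u @ [z]) \<Longrightarrow> lines_le line (length u) (v @ u)"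
    and bound_adjacent: "\<And>u v. line u \<Longrightarrow> line v \<Longrightarrow> u \<noteq> [] \<Longrightarrow> v \<noteq> [] \<Longrightarrow>
           lines_le line (length u) (v @ u) \<Longrightarrow> bound (length u) (length v)"
    and ins_Nil: "\<And>x. ins x [] = [[x]]"
    and ins_append: "\<And>C Cs x. C \<noteq> [] \<Longrightarrow> line (C @ [x]) \<Longrightarrow> ins x (C # Cs) = (C @ [x]) # Cs"
    and ins_bump: "\<And>C Cs x C' y. bump C x C' y \<Longrightarrow> ins x (C # Cs) = C' # ins y Cs"
begin

lemma bump_length: "bump C x C' y \<Longrightarrow> length C' = length C"
  using bump_mset[of C x C' y] by (metis add_left_cancel length_Cons length_append_singleton
      plus_1_eq_Suc size_mset)

lemma ins_cases:
  assumes "line_tableau line T"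
  obtains "T = []" "ins x T = [[x]]"
  | C Cs where "T = C # Cs" "line (C @ [x])" "ins x T = (C @ [x]) # Cs"
  | C Cs C' y where "T = C # Cs" "bump C x C' y" "ins x T = C' # ins y Cs"
proof (cases T)
  case Nil
  with that(1) show ?thesis by (simp add: ins_Nil)
next
  case (Cons C Cs)
  with assms have "C \<noteq> []" "line C" by (auto simp: line_tableau_Cons)
  with Cons that(2,3) show ?thesis
    by (metis bump_ex ins_append ins_bump)
qed

text \<open>
  The second part strengthens the induction: it says under which condition on the letter \<open>x\<close>
  sent by a line \<open>C\<close> the new first line of the rest of the tableau fits to \<open>C\<close>. When the rest
  sends on a letter of its own, that condition is inherited by \<open>bump_lines_le\<close> and \<open>lines_le_append\<close>.
\<close>

lemma line_tableau_ins_aux: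
  assumes "line_tableau line T"
  shows "line_tableau line (ins x T) \<and>
    (\<forall>C. line C \<and> \<not> line (x # C) \<and> (T \<noteq> [] \<longrightarrow> lines_le line (length C) (hd T @ x # C))
       \<longrightarrow> adjacent_ok line C (hd (ins x T)))"
  using assms
proof (induction T arbitrary: x)
  case Nil
  have "lines_le line (length C) ([x] @ C)" if "line C" "\<not> line (x # C)" for C
    unfolding lines_le_def
  proof (intro allI impI, elim conjE)
    fix s assume s: "subseq s ([x] @ C)" "line s"
    then have "s \<noteq> x # C" using that by auto
    then show "length s \<le> length C"
      using s(1) subseq_same_length[of s "x # C"] list_emb_length[of "(=)" s "x # C"]
      by (auto simp: le_Suc_eq)
  qed
  then show ?case by (auto simp: ins_Nil line_tableau_Cons line_single adjacent_ok_def)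
next
  case (Cons C2 Cs)
  from Cons.prems have C2: "C2 \<noteq> []" "line C2" and tabCs: "line_tableau line Cs"
    and goodC2: "Cs \<noteq> [] \<Longrightarrow> lines_le line (length C2) (hd Cs @ C2)"
    by (auto simp: line_tableau_Cons adjacent_ok_def)
  show ?case
  proof (rule ins_cases[OF Cons.prems, of x])
    fix C Cs' assume T: "C2 # Cs = C # Cs'" and fits: "line (C @ [x])"
      and eq: "ins x (C2 # Cs) = (C @ [x]) # Cs'"
    have "adjacent_ok line (C2 @ [x]) (hd Cs)" if "Cs \<noteq> []"
      unfolding adjacent_ok_def lines_le_def
    proof (intro allI impI, elim conjE)
      fix s assume s: "subseq s (hd Cs @ C2 @ [x])" "line s"
      then obtain s1 s2 where s12: "s = s1 @ s2" "subseq s1 (hd Cs @ C2)" "subseq s2 [x]"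
        by (metis append.assoc subseq_append_iff)
      then have "line s1" using line_subseq s(2) by blast
      then have "length s1 \<le> length C2" using goodC2 that s12(2) by (meson lines_leD)
      then show "length s \<le> length (C2 @ [x])"
        using s12 list_emb_length[OF s12(3)] by auto
    qed
    with T fits eq tabCs show ?thesis by (auto simp: line_tableau_Cons adjacent_ok_def)
  next
    fix C Cs' C' z assume T: "C2 # Cs = C # Cs'" and b: "bump C x C' z"
      and eq: "ins x (C2 # Cs) = C' # ins z Cs'"
    from T have [simp]: "C = C2" "Cs' = Cs" by auto
    note len = bump_length[OF b]
    have C': "line C'" "\<not> line (z # C')" "C' \<noteq> []"
      using bump_line[OF b] len C2 by auto
    have "lines_le line (length C') (hd Cs @ z # C')" if "Cs \<noteq> []"
      using lines_le_append[of C2 x "length C2" "hd Cs"] bump_line[OF b] goodC2[OF that]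
        bump_lines_le[OF b, of "length C2" "hd Cs" "[]"] len by simp
    with Cons.IH[OF tabCs, of z] C' have 1: "line_tableau line (ins z Cs)" "adjacent_ok line C' (hd (ins z Cs))"
      by auto
    have 2: "adjacent_ok line D C'" if "lines_le line (length D) (C2 @ x # D)" for D
    proof -
      have "lines_le line (length D) (z # C' @ D)"
        using bump_lines_le[OF b, of _ "[]" D] that by simp
      then show ?thesis unfolding adjacent_ok_def by (rule lines_le_subseq) auto
    qed
    show ?thesis using 1 2 C' eq by (auto simp: line_tableau_Cons)
  qed (use Cons in auto)
qed

lemma line_tableau_ins: "line_tableau line T \<Longrightarrow> line_tableau line (ins x T)"
  using line_tableau_ins_aux by blast

lemma mset_ins: "line_tableau line T \<Longrightarrow> mset (concat (ins x T)) = add_mset x (mset (concat T))"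
proof (induction T arbitrary: x)
  case (Cons D Ds)
  show ?case
  proof (rule ins_cases[OF Cons.prems, of x])
    fix C Cs C' y assume "D # Ds = C # Cs" and b: "bump C x C' y" "ins x (D # Ds) = C' # ins y Cs"
    then show ?thesis using Cons bump_mset[OF b(1)] by (auto simp: line_tableau_Cons)
  qed auto
qed (auto simp: ins_Nil)

lemma lengths_ins:
  "line_tableau line T \<Longrightarrow> \<exists>k \<le> length T. map length (ins x T) = grow (map length T) k"
proof (induction T arbitrary: x)
  case (Cons D Ds)
  show ?case
  proof (rule ins_cases[OF Cons.prems, of x])
    fix C Cs C' y assume T: "D # Ds = C # Cs" and b: "bump C x C' y" "ins x (D # Ds) = C' # ins y Cs"
    then obtain k where "k \<le> length Ds" "map length (ins y Ds) = grow (map length Ds) k"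
      using Cons by (auto simp: line_tableau_Cons)
    then show ?thesis using T b bump_length[OF b(1)] by (intro exI[of _ "Suc k"]) auto
  qed (auto intro!: exI[of _ 0])
qed (auto simp: ins_Nil)

text \<open>
  The lengths tell whether the first line was extended or changed by a bump; in the second case the
  letter sent on is known by induction and the bump can be undone.
\<close>

lemma ins_inj:
  assumes "line_tableau line T" "line_tableau line U" "map length T = map length U" "ins x T = ins y U"
  shows "T = U \<and> x = y"
  using assms
proof (induction T arbitrary: x y U)
  case Nil
  then show ?case by (auto simp: ins_Nil)
next
  case (Cons D Ds)
  from Cons.prems obtain E Es where U: "U = E # Es" "length E = length D"
    "map length Ds = map length Es" by (cases U) auto
  have letter_tableaux: "line_tableau line Ds" "line_tableau line Es" using Cons.prems U by (auto simp: line_tableau_Cons)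
  show ?case
  proof (rule ins_cases[OF Cons.prems(1), of x]; rule ins_cases[OF Cons.prems(2), of y])
    fix C Cs C' z B Bs B' v
    assume *: "D # Ds = C # Cs" "bump C x C' z" "ins x (D # Ds) = C' # ins z Cs"
      "U = B # Bs" "bump B y B' v" "ins y U = B' # ins v Bs"
    then have "C' = B'" "ins z Ds = ins v Es" using Cons.prems U by auto
    then have "Ds = Es \<and> z = v" using Cons.IH letter_tableaux U by blast
    then show ?thesis using * \<open>C' = B'\<close> U unbump_fun by auto
  qed (use Cons.prems U in \<open>auto dest: bump_length\<close>)
qed

text \<open>
  The added box is removed at the end of line \<open>k\<close>, and its letter is sent back through the lines
  above. The last part strengthens the induction: it says that a line \<open>C\<close> fitting above the
  tableau can take back the letter \<open>x\<close>, because \<open>x C\<close> is not a line, and that undoing the bump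
  there gives a line fitting to the new tableau.
\<close>

lemma ins_surj_aux:
  assumes "line_tableau line T'" "lengths_ok bound ks" "k \<le> length ks" "map length T' = grow ks k"
  shows "\<exists>T x. line_tableau line T \<and> map length T = ks \<and> ins x T = T' \<and>
    (\<forall>C. adjacent_ok line C (hd T') \<longrightarrow>
       \<not> line (x # C) \<and> (T \<noteq> [] \<longrightarrow> lines_le line (length C) (hd T @ x # C)))"
  using assms
proof (induction T' arbitrary: ks k)
  case Nil
  then show ?case by (cases ks; cases k) auto
next
  case (Cons D Ds)
  have D: "D \<noteq> []" "line D" "line_tableau line Ds" "Ds \<noteq> [] \<Longrightarrow> adjacent_ok line D (hd Ds)"
    using Cons.prems by (auto simp: line_tableau_Cons)
  show ?case
  proof (cases ks)
    case Nil
    then obtain x where x: "Ds = []" "D = [x]"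
      using Cons.prems by (auto simp: length_Suc_conv)
    have "\<not> line (x # C)" if "adjacent_ok line C [x]" for C
      using that lines_leD[of line "length C" "x # C" "x # C"] by (auto simp: adjacent_ok_def)
    then show ?thesis using Nil x
      by (intro exI[of _ "[]"] exI[of _ x]) (auto simp: ins_Nil)
  next
    case ks: (Cons a ks')
    show ?thesis
    proof (cases k)
      \<comment> \<open>The added box ends the first line, so its letter is the one that was inserted.\<close>
      case 0
      with Cons.prems ks have "length D = Suc a" and Ds: "map length Ds = ks'" by auto
      then obtain C x where Cx: "D = C @ [x]" "length C = a"
        by (metis length_Suc_conv_rev)
      have a: "a > 0" "C \<noteq> []" using Cons.prems ks Cx by (auto simp: lengths_ok_def)
      have "adjacent_ok line C (hd Ds)" if ne: "Ds \<noteq> []"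
      proof -
        obtain E Es where E: "Ds = E # Es" using ne by (cases Ds) auto
        then have "bound (length C) (length E)" "line E"
          using Cons.prems(2) ks Ds Cx D(3) by (auto simp: lengths_ok_def line_tableau_Cons)
        then show ?thesis
          using lines_le_butlast[of C x E] D E Cx a by (auto simp: adjacent_ok_def)
      qed
      moreover have "line C" using D Cx line_subseq by (metis subseq_rev_drop_many subseq_order.refl)
      moreover have "\<not> line (x # B)" "lines_le line (length B) (C @ x # B)" if "adjacent_ok line B D" for B
      proof -
        show s: "lines_le line (length B) (C @ x # B)" using that Cx by (simp add: adjacent_ok_def)
        show "\<not> line (x # B)" using lines_leD[OF s, of "x # B"] by auto
      qed
      ultimately show ?thesis using D Cx a Ds ks
        by (intro exI[of _ "C # Ds"] exI[of _ x]) (auto simp: ins_append line_tableau_Cons)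
    next
      case (Suc k')
      with Cons.prems ks have len: "length D = a" "map length Ds = grow ks' k'" "k' \<le> length ks'"
        by auto
      have ok: "lengths_ok bound ks'"
        using Cons.prems(2) ks by (auto simp: lengths_ok_def successively_Cons)
      have ne: "Ds \<noteq> []" using len(2)[symmetric] by (auto simp: grow_def split: if_splits)
      obtain Cs y where Cs: "line_tableau line Cs" "map length Cs = ks'" "ins y Cs = Ds"
        and y: "\<not> line (y # D)" "Cs \<noteq> [] \<longrightarrow> lines_le line (length D) (hd Cs @ y # D)"
        using Cons.IH[OF D(3) ok len(3,2)] D(4)[OF ne] by blast
      obtain C x where b: "bump C x D y" using unbump_ex[OF D(2) y(1)] by blast
      note bl = bump_length[OF b]
      have "adjacent_ok line C (hd Cs)" if "Cs \<noteq> []"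
      proof -
        have "lines_le line (length C) (hd Cs @ C @ [x])"
          using bump_lines_le[OF b, of "length C" "hd Cs" "[]"] y that bl by simp
        then show ?thesis unfolding adjacent_ok_def by (rule lines_le_subseq) auto
      qed
      moreover have "\<not> line (x # B)" "lines_le line (length B) (C @ x # B)" if "adjacent_ok line B D" for B
      proof -
        have "lines_le line (length B) (y # D @ B)"
          using lines_le_Cons[OF D(2) y(1)] that by (simp add: adjacent_ok_def)
        then show s: "lines_le line (length B) (C @ x # B)"
          using bump_lines_le[OF b, of _ "[]"] by simp
        show "\<not> line (x # B)" using lines_leD[OF s, of "x # B"] by auto
      qed
      ultimately show ?thesis using Cs b bump_line[OF b] bl D len ks
        by (intro exI[of _ "C # Cs"] exI[of _ x]) (auto simp: ins_bump line_tableau_Cons)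
    qed
  qed
qed

lemma ins_surj:
  assumes "line_tableau line T'" "lengths_ok bound ks" "k \<le> length ks" "map length T' = grow ks k"
  obtains T x where "line_tableau line T" "map length T = ks" "ins x T = T'"
  using ins_surj_aux[OF assms] by blast

lemma line_tableau_lengths: "line_tableau line T \<Longrightarrow> lengths_ok bound (map length T)"
proof (induction T)
  case (Cons C T)
  then show ?case using bound_adjacent[of C "hd T"]
    by (cases T) (auto simp: line_tableau_Cons lengths_ok_def adjacent_ok_def)
qed (auto simp: lengths_ok_def)

end

section \<open>Subsequences and reversal\<close>

lemma subseq_rev: "subseq v w \<Longrightarrow> subseq (rev v) (rev w)"
  by (induction rule: list_emb.induct) (auto intro: subseq_rev_drop_many list_emb_append_mono)

lemma subseq_rev_iff [simp]: "subseq (rev v) (rev w) \<longleftrightarrow> subseq v w"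
  using subseq_rev[of v w] subseq_rev[of "rev v" "rev w"] by auto

lemma lines_le_rev:
  assumes "\<And>w. line' (rev w) \<longleftrightarrow> line w"
  shows "lines_le line' n (rev w) \<longleftrightarrow> lines_le line n w"
  using assms subseq_rev_iff unfolding lines_le_def by (metis length_rev rev_rev_ident)

lemma subseq_singleton_right: "subseq s [x] \<longleftrightarrow> s = [] \<or> s = [x]"
  by (cases s) auto

lemma subseq_set: "subseq v w \<Longrightarrow> set v \<subseteq> set w"
  by (induction rule: list_emb.induct) auto

lemma sorted_wrt_subseq: "subseq v w \<Longrightarrow> sorted_wrt R w \<Longrightarrow> sorted_wrt R v"
  by (induction rule: list_emb.induct) (auto dest: subseq_set)

section \<open>Columns\<close>

text \<open>
  The common hypothesis on the order of the letters. The relations are strict or weak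
  comparisons, where each letter decides for itself whether it may be repeated: any such relation
  and its complement are transitive.
\<close>

locale tie =
  fixes G :: "'a \<Rightarrow> 'a \<Rightarrow> bool"
  assumes trans_pos: "G a b \<Longrightarrow> G b c \<Longrightarrow> G a c"
    and trans_neg: "\<not> G a b \<Longrightarrow> \<not> G b c \<Longrightarrow> \<not> G a c"

lemma tie_converse: "tie G \<Longrightarrow> tie (\<lambda>a b. G b a)"
  unfolding tie_def by blast

lemma tie_dual: "tie G \<Longrightarrow> tie (\<lambda>a b. \<not> G b a)"
  unfolding tie_def by blast

text \<open>
  In column \<open>C\<close> the letter \<open>x\<close> takes the place of \<open>y\<close>. Requiring both columns to be chains,
  instead of describing \<open>y\<close> as the first letter that \<open>x\<close> can replace, makes the definition
  invariant under reversal.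
\<close>

definition column_bump :: "('a \<Rightarrow> 'a \<Rightarrow> bool) \<Rightarrow> 'a list \<Rightarrow> 'a \<Rightarrow> 'a list \<Rightarrow> 'a \<Rightarrow> bool" where
  "column_bump G C x C' y \<longleftrightarrow> (\<exists>P Q. C = P @ y # Q \<and> C' = P @ x # Q \<and>
     sorted_wrt G C \<and> sorted_wrt G C' \<and> \<not> G y x)"

lemma column_bump_rev:
  "column_bump (\<lambda>a b. G b a) (rev C') y (rev C) x \<longleftrightarrow> column_bump G C x C' y"
proof -
  have "column_bump (\<lambda>a b. G b a) (rev C') y (rev C) x"
    if bump: "column_bump G C x C' y" for G :: "'a \<Rightarrow> 'a \<Rightarrow> bool" and C x C' y
  proof -
    obtain P Q where *: "C = P @ y # Q" "C' = P @ x # Q" "sorted_wrt G C" "sorted_wrt G C'"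
      "\<not> G y x" using bump by (auto simp: column_bump_def)
    have "rev C' = rev Q @ x # rev P" "rev C = rev Q @ y # rev P" using * by auto
    moreover have "sorted_wrt (\<lambda>a b. G b a) (rev C)" "sorted_wrt (\<lambda>a b. G b a) (rev C')"
      using *(3,4) by (simp_all add: sorted_wrt_rev)
    ultimately show ?thesis using *(5) unfolding column_bump_def by blast
  qed
  from this[of G C x C' y] this[of "\<lambda>a b. G b a" "rev C'" y "rev C" x] show ?thesis by auto
qed

context tie
begin

lemma column_snoc:
  assumes "sorted_wrt G (C @ [c])" "G c x"
  shows "sorted_wrt G (C @ [c, x])"
  using assms trans_pos by (auto simp: sorted_wrt_append)

lemma column_bump_ex:
  assumes "sorted_wrt G C" "\<not> sorted_wrt G (C @ [x])"
  shows "\<exists>C' y. column_bump G C x C' y"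
proof -
  from assms have "\<exists>t\<in>set C. \<not> G t x" by (auto simp: sorted_wrt_append)
  then obtain P y Q where C: "C = P @ y # Q" "\<not> G y x" "\<forall>t\<in>set P. G t x"
    using split_list_first_prop[of C "\<lambda>t. \<not> G t x"] by auto
  then have "G x q" if "q \<in> set Q" for q
    using that assms(1) trans_neg[of y x q] by (auto simp: sorted_wrt_append)
  then have "sorted_wrt G (P @ x # Q)" using C assms by (auto simp: sorted_wrt_append)
  then show ?thesis using C assms by (auto simp: column_bump_def)
qed

lemma column_bump_fun:
  assumes "column_bump G C x C' y" "column_bump G C x D' z"
  shows "C' = D' \<and> y = z"
proof -
  obtain P Q where 1: "C = P @ y # Q" "C' = P @ x # Q" "sorted_wrt G C'" "\<not> G y x"
    using assms(1) by (auto simp: column_bump_def)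
  obtain A B where 2: "C = A @ z # B" "D' = A @ x # B" "sorted_wrt G D'" "\<not> G z x"
    using assms(2) by (auto simp: column_bump_def)
  have 3: "\<forall>t\<in>set P. G t x" "\<forall>t\<in>set A. G t x" using 1 2 by (auto simp: sorted_wrt_append)
  have "P @ y # Q = A @ z # B" using 1 2 by simp
  then have "P = A \<and> y = z \<and> Q = B"
    using 3 1(4) 2(4) by (auto simp: append_eq_append_conv2 Cons_eq_append_conv append_eq_Cons_conv)
  then show ?thesis using 1 2 by simp
qed

lemma column_bump_not_line: "column_bump G C x C' y \<Longrightarrow> \<not> sorted_wrt G (C @ [x])"
  by (auto simp: column_bump_def sorted_wrt_append)

text \<open>
  A chain in \<open>p C x q\<close> is turned into a chain of the same length in \<open>p y C' q\<close>. The letter \<open>y\<close> has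
  moved to the front of the column and \<open>x\<close> has taken its place. A chain containing \<open>x\<close> contains
  nothing of \<open>C\<close> from \<open>y\<close> on, so it survives; a chain containing \<open>y\<close> survives if it starts there
  within \<open>C\<close>, and otherwise \<open>y\<close> can be replaced by \<open>x\<close>.
\<close>

lemma column_bump_lines_le:
  assumes bump: "column_bump G C x C' y" and sh: "lines_le (sorted_wrt G) n (p @ y # C' @ q)"
  shows "lines_le (sorted_wrt G) n (p @ C @ x # q)"
  unfolding lines_le_def
proof (intro allI impI, elim conjE)
  fix s assume s: "subseq s (p @ C @ x # q)" "sorted_wrt G s"
  obtain P Q where C: "C = P @ y # Q" "C' = P @ x # Q" "sorted_wrt G C" "sorted_wrt G C'"
    "\<not> G y x" using bump by (auto simp: column_bump_def)
  have "subseq s (p @ P @ [y] @ Q @ [x] @ q)" using s C by simp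
  then obtain sp sP sy sQ sx sq where s_eq: "s = sp @ sP @ sy @ sQ @ sx @ sq"
    and sub: "subseq sp p" "subseq sP P" "subseq sy [y]" "subseq sQ Q" "subseq sx [x]" "subseq sq q"
    unfolding subseq_append_iff by blast
  have in_sets: "set sP \<subseteq> set P" "set sQ \<subseteq> set Q"
    using sub subseq_set by auto
  have sx: "sx = [] \<or> sx = [x]" and sy: "sy = [] \<or> sy = [y]"
    using sub by (auto simp: subseq_singleton_right)
  have mem: "subseq t (p @ [y] @ P @ [x] @ Q @ q) \<Longrightarrow> sorted_wrt G t \<Longrightarrow> length t \<le> n" for t
    using sh C by (auto simp: lines_le_def)
  show "length s \<le> n"
  proof (cases "sx = []")
    case False
    then have [simp]: "sx = [x]" using sx by simp
    have "sy = []" using sy s(2) C(5) s_eq by (auto simp: sorted_wrt_append)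
    moreover have "sQ = []"
    proof (rule ccontr)
      assume "sQ \<noteq> []"
      then obtain t where "t \<in> set sQ" by (cases sQ) auto
      then have "G t x" "G y t" using s(2) s_eq in_sets C(1,3) by (auto simp: sorted_wrt_append)
      then show False using C(5) trans_pos by blast
    qed
    ultimately have "subseq s (p @ [y] @ P @ [x] @ Q @ q)"
      using list_emb_append_mono[OF sub(1) list_emb_append_mono[of "(=)" "[]" "[y]",
          OF _ list_emb_append_mono[OF sub(2) list_emb_append_mono[of "(=)" "[x]" "[x]",
          OF _ list_emb_append_mono[of "(=)" "[]" Q, OF _ sub(6)]]]]] s_eq by simp
    then show ?thesis using mem s by blast
  next
    case sx: True
    consider "sy = []" | "sy = [y]" "sP = []" | "sy = [y]" "sP \<noteq> []" using sy by blast
    then show ?thesis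
    proof cases
      case 1
      have "subseq (sp @ [] @ sP @ [] @ sQ @ sq) (p @ [y] @ P @ [x] @ Q @ q)"
        by (intro list_emb_append_mono sub) auto
      then show ?thesis using mem[of s] s s_eq 1 sx by auto
    next
      case 2
      have "subseq (sp @ [y] @ [] @ [] @ sQ @ sq) (p @ [y] @ P @ [x] @ Q @ q)"
        by (intro list_emb_append_mono sub) auto
      then show ?thesis using mem[of s] s s_eq 2 sx by auto
    next
      case 3
      then obtain t where t: "t \<in> set sP" by (cases sP) auto
      have tx: "G t x" using t in_sets C(2,4) by (auto simp: sorted_wrt_append)
      have sub': "subseq (sp @ [] @ sP @ [x] @ sQ @ sq) (p @ [y] @ P @ [x] @ Q @ q)"
        by (intro list_emb_append_mono sub) auto
      have "G a x" if "a \<in> set sp \<union> set sP" for a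
        using that t tx s(2) s_eq in_sets C(2,4) trans_pos[of a t x] by (auto simp: sorted_wrt_append)
      moreover have "G x a" if "a \<in> set sQ \<union> set sq" for a
        using that s(2) s_eq 3 C(5) trans_neg[of y x a] by (auto simp: sorted_wrt_append)
      ultimately have "sorted_wrt G (sp @ sP @ [x] @ sQ @ sq)"
        using s(2) s_eq by (auto simp: sorted_wrt_append)
      then show ?thesis using mem[OF sub'] s_eq 3 sx by simp
    qed
  qed
qed

text \<open>
  A chain of length \<open>n + 1\<close> would end in \<open>x\<close>. It cannot contain the last letter \<open>c\<close> of \<open>C1\<close>, because
  \<open>c x\<close> is not a chain; but then \<open>x\<close> can be replaced by \<open>c\<close>, which gives a chain in \<open>C2 C1\<close>.
\<close>

lemma column_lines_le_append:
  assumes "\<not> sorted_wrt G (C1 @ [x])" "sorted_wrt G C1"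
    "lines_le (sorted_wrt G) n (C2 @ C1)"
  shows "lines_le (sorted_wrt G) n (C2 @ C1 @ [x])"
  unfolding lines_le_def
proof (intro allI impI, elim conjE)
  fix s assume s: "subseq s (C2 @ C1 @ [x])" "sorted_wrt G s"
  show "length s \<le> n"
  proof (rule ccontr)
    assume long: "\<not> ?thesis"
    from s(1) obtain g sx where g: "s = g @ sx" "subseq g (C2 @ C1)" "subseq sx [x]"
      by (metis append.assoc subseq_append_iff)
    have sg: "sorted_wrt G g" using s(2) g by (auto simp: sorted_wrt_append)
    have "length g \<le> n" using assms(3) g sg by (auto simp: lines_le_def)
    with g long have sx: "sx = [x]" "length g = n"
      by (auto simp: subseq_singleton_right)
    obtain P c where C1: "C1 = P @ [c]"
      using assms(1) by (cases C1 rule: rev_cases) auto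
    have ncx: "\<not> G c x"
    proof
      assume "G c x"
      then have "sorted_wrt G (C1 @ [x])" using column_snoc assms(2) C1 by auto
      then show False using assms by simp
    qed
    obtain h hc where h: "g = h @ hc" "subseq h (C2 @ P)" "subseq hc [c]"
      using g(2) C1 by (metis append.assoc subseq_append_iff)
    have "hc = []"
    proof -
      have "hc \<noteq> [c]" using ncx s(2) g h sx by (auto simp: sorted_wrt_append)
      then show ?thesis using h(3) by (auto simp: subseq_singleton_right)
    qed
    then have "subseq (g @ [c]) (C2 @ C1)"
      using h C1 list_emb_append_mono[of "(=)" h "C2 @ P" "[c]" "[c]"] by auto
    moreover have "G t c" if "t \<in> set g" for t
      using that s(2) g sx ncx trans_neg[of t c x] by (auto simp: sorted_wrt_append)
    then have "sorted_wrt G (g @ [c])" using sg by (auto simp: sorted_wrt_append)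
    ultimately show False using assms(3) sx by (auto simp: lines_le_def)
  qed
qed

text \<open>
  A chain longer than \<open>u\<close> does not fit into \<open>v\<close>, so it ends in \<open>u\<close> and can be continued by \<open>z\<close>.
\<close>

lemma column_lines_le_butlast:
  assumes "sorted_wrt G (u @ [z])" "length v \<le> length u"
    "lines_le (sorted_wrt G) (Suc (length u)) (v @ u @ [z])"
  shows "lines_le (sorted_wrt G) (length u) (v @ u)"
  unfolding lines_le_def
proof (intro allI impI, elim conjE)
  fix s assume s: "subseq s (v @ u)" "sorted_wrt G s"
  show "length s \<le> length u"
  proof (rule ccontr)
    assume long: "\<not> ?thesis"
    from s(1) obtain sv su where sv: "s = sv @ su" "subseq sv v" "subseq su u"
      by (auto simp: subseq_append_iff)
    have "su \<noteq> []" using long list_emb_length[OF sv(2)] assms(2) sv(1) by auto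
    then obtain h c where c: "su = h @ [c]" by (metis rev_exhaust)
    then have "c \<in> set u" using subseq_set[OF sv(3)] by auto
    then have "G c z" using assms(1) by (auto simp: sorted_wrt_append)
    then have "sorted_wrt G (s @ [z])" using s(2) sv c column_snoc[of "sv @ h" c z] by auto
    moreover have "subseq (s @ [z]) (v @ u @ [z])"
      using s(1) list_emb_append_mono[of "(=)" s "v @ u" "[z]" "[z]"] by auto
    ultimately show False using assms(3) long by (auto simp: lines_le_def)
  qed
qed

end

lemma column_unbump_ex:
  assumes "tie G" "sorted_wrt G C'" "\<not> sorted_wrt G (y # C')"
  shows "\<exists>C x. column_bump G C x C' y"
proof -
  interpret conv: tie "\<lambda>a b. G b a" using tie_converse assms(1) .
  obtain C x where "column_bump (\<lambda>a b. G b a) (rev C') y C x"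
    using conv.column_bump_ex[of "rev C'" y] assms sorted_wrt_rev[of "\<lambda>a b. G b a" "y # C'"]
      sorted_wrt_rev[of "\<lambda>a b. G b a" C'] by auto
  then show ?thesis using column_bump_rev[of G C' y "rev C" x] by auto
qed

lemma column_unbump_fun:
  assumes "tie G" "column_bump G C x C' y" "column_bump G D z C' y"
  shows "C = D \<and> x = z"
  using tie.column_bump_fun[OF tie_converse[OF assms(1)], of "rev C'" y "rev C" x "rev D" z]
    assms(2,3) by (simp add: column_bump_rev)

lemma lines_le_column_rev:
  "lines_le (sorted_wrt (\<lambda>a b. G b a)) n (rev w) \<longleftrightarrow> lines_le (sorted_wrt G) n w"
  by (rule lines_le_rev) (simp add: sorted_wrt_rev)

lemma column_bump_lines_le_iff:
  assumes "tie G" "column_bump G C x C' y"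
  shows "lines_le (sorted_wrt G) n (p @ C @ x # q) \<longleftrightarrow> lines_le (sorted_wrt G) n (p @ y # C' @ q)"
  using tie.column_bump_lines_le[OF assms, of n p q]
    tie.column_bump_lines_le[OF tie_converse[OF assms(1)], of "rev C'" y "rev C" x n "rev q" "rev p"]
    lines_le_column_rev[of G n "p @ C @ x # q"] lines_le_column_rev[of G n "p @ y # C' @ q"] assms(2)
  by (auto simp: column_bump_rev)

lemma column_lines_le_Cons:
  assumes "tie G" "\<not> sorted_wrt G (y # C2)" "sorted_wrt G C2"
    and "lines_le (sorted_wrt G) n (C2 @ C1)"
  shows "lines_le (sorted_wrt G) n (y # C2 @ C1)"
  using tie.column_lines_le_append[OF tie_converse[OF assms(1)], of "rev C2" y n "rev C1"]
    lines_le_column_rev[of G n "C2 @ C1"] lines_le_column_rev[of G n "y # C2 @ C1"] assms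
    sorted_wrt_rev[of "\<lambda>a b. G b a" "y # C2"] sorted_wrt_rev[of "\<lambda>a b. G b a" C2]
  by auto

section \<open>Hook words\<close>

text \<open>
  For \<open>G = (\<ge>)\<close> these are the hook words together with the empty word. The letter at the turning
  point may belong to either part, so that no condition between \<open>A\<close> and \<open>B\<close> is needed.
\<close>

definition hook :: "('a \<Rightarrow> 'a \<Rightarrow> bool) \<Rightarrow> 'a list \<Rightarrow> bool" where
  "hook G w \<longleftrightarrow> (\<exists>A B. w = A @ B \<and> sorted_wrt G A \<and> sorted_wrt (\<lambda>a b. \<not> G a b) B)"

lemma hookI: "sorted_wrt G A \<Longrightarrow> sorted_wrt (\<lambda>a b. \<not> G a b) B \<Longrightarrow> hook G (A @ B)"
  by (auto simp: hook_def)

lemma hook_subseq: "hook G w \<Longrightarrow> subseq v w \<Longrightarrow> hook G v"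
  unfolding hook_def by (metis sorted_wrt_subseq subseq_append_iff)

lemma hook_rev: "hook (\<lambda>a b. \<not> G b a) (rev w) \<longleftrightarrow> hook G w"
proof -
  have "hook (\<lambda>a b. \<not> G b a) (rev w)" if hook: "hook G w" for G :: "'a \<Rightarrow> 'a \<Rightarrow> bool" and w
  proof -
    obtain A B where *: "w = A @ B" "sorted_wrt G A" "sorted_wrt (\<lambda>a b. \<not> G a b) B"
      using hook by (auto simp: hook_def)
    then have "hook (\<lambda>a b. \<not> G b a) (rev B @ rev A)"
      by (intro hookI) (simp_all add: sorted_wrt_rev)
    then show ?thesis using * by simp
  qed
  from this[of G w] this[of "\<lambda>a b. \<not> G b a" "rev w"] show ?thesis by auto
qed

lemma lines_le_hook_rev: "lines_le (hook (\<lambda>a b. \<not> G b a)) n (rev w) \<longleftrightarrow> lines_le (hook G) n w"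
  by (rule lines_le_rev) (rule hook_rev)

text \<open>
  The letter \<open>x\<close> replaces \<open>y\<close> in the increasing part and \<open>y\<close> replaces \<open>z\<close> in the decreasing part. As for
  columns, the definition is symmetric in \<open>L\<close> and \<open>L'\<close>: reversal exchanges the roles of \<open>x\<close> and \<open>z\<close>.
  The split of \<open>L\<close> into two chains is any split, not only the one at the turning point, since the
  turning points of \<open>L\<close> and \<open>L'\<close> need not agree.
\<close>

definition hook_bump :: "('a \<Rightarrow> 'a \<Rightarrow> bool) \<Rightarrow> 'a list \<Rightarrow> 'a \<Rightarrow> 'a list \<Rightarrow> 'a \<Rightarrow> bool" where
  "hook_bump G L x L' z \<longleftrightarrow> (\<exists>D1 D2 U1 U2 y.
     L = D1 @ z # D2 @ U1 @ y # U2 \<and> L' = D1 @ y # D2 @ U1 @ x # U2 \<and>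
     sorted_wrt G (D1 @ z # D2) \<and> sorted_wrt G (D1 @ y # D2) \<and>
     sorted_wrt (\<lambda>a b. \<not> G a b) (U1 @ y # U2) \<and> sorted_wrt (\<lambda>a b. \<not> G a b) (U1 @ x # U2) \<and>
     \<not> G z y \<and> G y x)"

lemma hook_bump_rev:
  "hook_bump (\<lambda>a b. \<not> G b a) (rev L') z (rev L) x \<longleftrightarrow> hook_bump G L x L' z"
proof -
  have "hook_bump (\<lambda>a b. \<not> G b a) (rev L') z (rev L) x" if bump: "hook_bump G L x L' z"
    for G :: "'a \<Rightarrow> 'a \<Rightarrow> bool" and L x L' z
  proof -
    obtain D1 D2 U1 U2 y where *:
      "L = D1 @ z # D2 @ U1 @ y # U2" "L' = D1 @ y # D2 @ U1 @ x # U2"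
      "sorted_wrt G (D1 @ z # D2)" "sorted_wrt G (D1 @ y # D2)"
      "sorted_wrt (\<lambda>a b. \<not> G a b) (U1 @ y # U2)" "sorted_wrt (\<lambda>a b. \<not> G a b) (U1 @ x # U2)"
      "\<not> G z y" "G y x"
      using bump unfolding hook_bump_def by blast
    have "sorted_wrt (\<lambda>a b. \<not> G b a) (rev (U1 @ x # U2))"
      "sorted_wrt (\<lambda>a b. \<not> G b a) (rev (U1 @ y # U2))"
      "sorted_wrt (\<lambda>a b. \<not> \<not> G b a) (rev (D1 @ y # D2))"
      "sorted_wrt (\<lambda>a b. \<not> \<not> G b a) (rev (D1 @ z # D2))"
      using * unfolding sorted_wrt_rev by simp_all
    then show ?thesis unfolding hook_bump_def
      by (intro exI[of _ "rev U2"] exI[of _ "rev U1"] exI[of _ "rev D2"] exI[of _ "rev D1"]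
          exI[of _ y]) (use * in auto)
  qed
  from this[of G L x L' z] this[of "\<lambda>a b. \<not> G b a" "rev L'" z "rev L" x] show ?thesis by auto
qed

text \<open>
  Used to exchange a piece of a chain for another piece without looking at the rest of the chain.
\<close>

definition left_bounds :: "('a \<Rightarrow> 'a \<Rightarrow> bool) \<Rightarrow> 'a list \<Rightarrow> 'a list \<Rightarrow> bool" where
  "left_bounds R a a' \<longleftrightarrow> (\<forall>c. (\<forall>t\<in>set a. R c t) \<longrightarrow> (\<forall>t\<in>set a'. R c t))"

definition right_bounds :: "('a \<Rightarrow> 'a \<Rightarrow> bool) \<Rightarrow> 'a list \<Rightarrow> 'a list \<Rightarrow> bool" where
  "right_bounds R a a' \<longleftrightarrow> (\<forall>c. (\<forall>t\<in>set a. R t c) \<longrightarrow> (\<forall>t\<in>set a'. R t c))"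

definition squeezed :: "('a \<Rightarrow> 'a \<Rightarrow> bool) \<Rightarrow> 'a list \<Rightarrow> 'a list \<Rightarrow> bool" where
  "squeezed R a a' \<longleftrightarrow> length a' = length a \<and> left_bounds R a a' \<and> right_bounds R a a'"

lemma left_boundsI:
  "(\<And>t c. t \<in> set a' \<Longrightarrow> (\<And>u. u \<in> set a \<Longrightarrow> R c u) \<Longrightarrow> R c t) \<Longrightarrow> left_bounds R a a'"
  by (simp add: left_bounds_def)

lemma right_boundsI:
  "(\<And>t c. t \<in> set a' \<Longrightarrow> (\<And>u. u \<in> set a \<Longrightarrow> R u c) \<Longrightarrow> R t c) \<Longrightarrow> right_bounds R a a'"
  by (simp add: right_bounds_def)

lemma squeezedI:
  assumes "length a' = length a"
    and "\<And>t c. t \<in> set a' \<Longrightarrow> (\<And>u. u \<in> set a \<Longrightarrow> R c u) \<Longrightarrow> R c t"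
    and "\<And>t c. t \<in> set a' \<Longrightarrow> (\<And>u. u \<in> set a \<Longrightarrow> R u c) \<Longrightarrow> R t c"
  shows "squeezed R a a'"
  using assms by (simp add: squeezed_def left_boundsI right_boundsI)

lemma left_boundsD: "left_bounds R a a' \<Longrightarrow> t \<in> set a' \<Longrightarrow> \<forall>u\<in>set a. R c u \<Longrightarrow> R c t"
  by (simp add: left_bounds_def)

lemma right_boundsD: "right_bounds R a a' \<Longrightarrow> t \<in> set a' \<Longrightarrow> \<forall>u\<in>set a. R u c \<Longrightarrow> R t c"
  by (simp add: right_bounds_def)

lemma bounds_refl [simp]: "left_bounds R a a" "right_bounds R a a"
  by (simp_all add: left_bounds_def right_bounds_def)

lemma squeezed_refl [simp]: "squeezed R a a"
  by (auto intro: squeezedI)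

lemma squeezed_append:
  assumes "squeezed R a a'" "squeezed R b b'"
  shows "squeezed R (a @ b) (a' @ b')"
proof (rule squeezedI)
  show "length (a' @ b') = length (a @ b)" using assms by (simp add: squeezed_def)
  show "R c t" if "t \<in> set (a' @ b')" "\<And>u. u \<in> set (a @ b) \<Longrightarrow> R c u" for t c
    using that assms left_boundsD[of R a a' t c] left_boundsD[of R b b' t c]
    by (auto simp: squeezed_def)
  show "R t c" if "t \<in> set (a' @ b')" "\<And>u. u \<in> set (a @ b) \<Longrightarrow> R u c" for t c
    using that assms right_boundsD[of R a a' t c] right_boundsD[of R b b' t c]
    by (auto simp: squeezed_def)
qed

lemma sorted_left_bounds:
  assumes "left_bounds R a a'" "sorted_wrt R (p @ a)" "sorted_wrt R a'"
  shows "sorted_wrt R (p @ a')"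
  using assms left_boundsD[OF assms(1)] by (auto simp: sorted_wrt_append)

lemma sorted_right_bounds:
  assumes "right_bounds R a a'" "sorted_wrt R (a @ q)" "sorted_wrt R a'"
  shows "sorted_wrt R (a' @ q)"
  using assms right_boundsD[OF assms(1)] by (auto simp: sorted_wrt_append)

lemma sorted_squeezed:
  assumes "squeezed R a a'" "sorted_wrt R (p @ a @ q)" "sorted_wrt R a'"
  shows "sorted_wrt R (p @ a' @ q)"
proof -
  have "sorted_wrt R (p @ a')" "sorted_wrt R (a' @ q)"
    using assms sorted_left_bounds[of R a a' p] sorted_right_bounds[of R a a' q]
    by (simp_all add: squeezed_def sorted_wrt_append)
  moreover have "\<forall>u\<in>set p. \<forall>v\<in>set q. R u v" using assms(2) by (simp add: sorted_wrt_append)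
  ultimately show ?thesis by (auto simp: sorted_wrt_append)
qed

text \<open>
  Every hook subsequence \<open>a b\<close> of \<open>X\<close> can be exchanged for one of \<open>Y\<close> of the same length inside any
  longer hook subsequence. If both chains meet inside \<open>X\<close>, only the outer bounds matter, since any
  decreasing chain followed by any increasing chain is a hook. If one chain is empty, the piece
  lies inside the other chain and both bounds matter.
\<close>

definition hook_dominated :: "('a \<Rightarrow> 'a \<Rightarrow> bool) \<Rightarrow> 'a list \<Rightarrow> 'a list \<Rightarrow> bool" where
  "hook_dominated G X Y \<longleftrightarrow>
    (\<forall>a b. sorted_wrt G a \<and> sorted_wrt (\<lambda>a b. \<not> G a b) b \<and> subseq (a @ b) X \<longrightarrow>
      (\<exists>a' b'. sorted_wrt G a' \<and> sorted_wrt (\<lambda>a b. \<not> G a b) b' \<and> subseq (a' @ b') Y \<and>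
         length (a' @ b') = length (a @ b) \<and>
         left_bounds G a a' \<and>
         right_bounds (\<lambda>a b. \<not> G a b) b b' \<and>
         (b = [] \<longrightarrow> b' = [] \<and> squeezed G a a') \<and>
         (a = [] \<longrightarrow> a' = [] \<and> squeezed (\<lambda>a b. \<not> G a b) b b')))"

text \<open>
  The three cases are the positions of the split of the hook relative to \<open>X\<close>.
\<close>

lemma hook_dominated_lines_le:
  assumes dom: "hook_dominated G X Y" and sh: "lines_le (hook G) n (p @ Y @ q)"
  shows "lines_le (hook G) n (p @ X @ q)"
  unfolding lines_le_def
proof (intro allI impI, elim conjE)
  fix s assume s: "subseq s (p @ X @ q)" "hook G s"
  obtain A B where AB: "s = A @ B" "sorted_wrt G A" "sorted_wrt (\<lambda>a b. \<not> G a b) B"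
    using s(2) by (auto simp: hook_def)
  obtain s1 s2 s3 where s123: "s = s1 @ s2 @ s3" "subseq s1 p" "subseq s2 X" "subseq s3 q"
    using s(1) unfolding subseq_append_iff by blast
  have len: "length (s1 @ t @ s3) \<le> n" if "subseq t Y" "hook G (s1 @ t @ s3)" for t
    using sh that list_emb_append_mono[OF s123(2) list_emb_append_mono[OF that(1) s123(4)]]
    by (auto simp: lines_le_def)
  have "(\<exists>us. A = s1 @ us \<and> us @ B = s2 @ s3) \<or> (\<exists>us. A @ us = s1 \<and> B = us @ s2 @ s3)"
    using AB(1) s123(1) by (auto simp: append_eq_append_conv2)
  then consider vs where "A = s1 @ s2 @ vs" "s3 = vs @ B"
    | us vs where "A = s1 @ us" "s2 = us @ vs" "B = vs @ s3"
    | us where "s1 = A @ us" "B = us @ s2 @ s3"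
    by (auto simp: append_eq_append_conv2)
  then show "length s \<le> n"
  proof cases
    case (1 vs)
    obtain a' where a': "sorted_wrt G a'" "subseq a' Y" "squeezed G s2 a'"
      using dom[unfolded hook_dominated_def, rule_format, of s2 "[]"] 1 AB s123
      by (auto simp: sorted_wrt_append)
    have "hook G ((s1 @ a' @ vs) @ B)"
      using sorted_squeezed[OF a'(3), of s1 vs] a'(1) AB 1 by (intro hookI) auto
    then show ?thesis using len[of a'] a' 1 s123 by (auto simp: squeezed_def)
  next
    case (2 us vs)
    obtain a' b' where *: "sorted_wrt G a'" "sorted_wrt (\<lambda>a b. \<not> G a b) b'" "subseq (a' @ b') Y"
         "length (a' @ b') = length (us @ vs)"
         "left_bounds G us a'"
         "right_bounds (\<lambda>a b. \<not> G a b) vs b'"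
      using dom[unfolded hook_dominated_def, rule_format, of us vs] 2 AB s123
      by (auto simp: sorted_wrt_append)
    have "hook G ((s1 @ a') @ (b' @ s3))"
      using * AB 2 by (intro hookI sorted_left_bounds[OF *(5)] sorted_right_bounds[OF *(6)]) auto
    then show ?thesis using len[of "a' @ b'"] * 2 s123 by auto
  next
    case (3 us)
    obtain b' where b': "sorted_wrt (\<lambda>a b. \<not> G a b) b'" "subseq b' Y" "squeezed (\<lambda>a b. \<not> G a b) s2 b'"
      using dom[unfolded hook_dominated_def, rule_format, of "[]" s2] 3 AB s123
      by (auto simp: sorted_wrt_append)
    have "hook G (A @ (us @ b' @ s3))"
      using sorted_squeezed[OF b'(3), of us s3] b'(1) AB 3 by (intro hookI) auto
    then show ?thesis using len[of b'] b' 3 s123 by (auto simp: squeezed_def)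
  qed
qed

lemma sorted_both: "sorted_wrt R w \<Longrightarrow> sorted_wrt (\<lambda>a b. \<not> R a b) w \<Longrightarrow> w = [] \<or> (\<exists>t. w = [t])"
  by (cases w; cases "tl w") auto

lemma subseq_append2E:
  assumes "subseq s (a @ b)"
  obtains s1 s2 where "s = s1 @ s2" "subseq s1 a" "subseq s2 b"
  using assms unfolding subseq_append_iff by blast

lemma subseq_append3E:
  assumes "subseq s (a @ b @ c)"
  obtains s1 s2 s3 where "s = s1 @ s2 @ s3" "subseq s1 a" "subseq s2 b" "subseq s3 c"
  using assms unfolding subseq_append_iff by blast

lemma append_eq_append_Cons_cases:
  assumes "X @ Y = F @ y # M"
  shows "(\<exists>us. X = F @ y # us) \<or> y \<in> set Y"
proof -
  obtain us where "X = F @ us \<and> us @ Y = y # M \<or> X @ us = F \<and> Y = us @ y # M"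
    using assms by (auto simp: append_eq_append_conv2)
  then show ?thesis by (cases us) auto
qed

lemma append_Cons_eq_append_Cons_cases:
  assumes "F @ y # M = H @ v # N"
  shows "F = H \<and> y = v \<and> M = N \<or> (\<exists>us. H = F @ y # us) \<or> (\<exists>us. F = H @ v # us)"
  using assms by (auto simp: append_eq_append_conv2 Cons_eq_append_conv append_eq_Cons_conv)

text \<open>
  The words \<open>L x\<close> and \<open>z L'\<close> of a bump are \<open>D1 z D2 U1 y U2 x\<close> and \<open>z D1 y D2 U1 x U2\<close>.
\<close>

locale hook_swap = tie G for G :: "'a \<Rightarrow> 'a \<Rightarrow> bool" +
  fixes D1 D2 U1 U2 :: "'a list" and x y z :: 'a
  assumes Dz: "sorted_wrt G (D1 @ z # D2)" and Dy: "sorted_wrt G (D1 @ y # D2)"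
    and Uy: "sorted_wrt (\<lambda>a b. \<not> G a b) (U1 @ y # U2)"
    and Ux: "sorted_wrt (\<lambda>a b. \<not> G a b) (U1 @ x # U2)"
    and zy: "\<not> G z y" and yx: "G y x"
begin

lemma swap_order:
  "d \<in> set D1 \<Longrightarrow> G d y" "d \<in> set D1 \<Longrightarrow> G d z" "d \<in> set D1 \<Longrightarrow> G d x"
  "d \<in> set D2 \<Longrightarrow> G z d" "d \<in> set D2 \<Longrightarrow> G y d"
  "u \<in> set U1 \<Longrightarrow> \<not> G u y" "u \<in> set U1 \<Longrightarrow> \<not> G u x"
  "u \<in> set U2 \<Longrightarrow> \<not> G y u" "u \<in> set U2 \<Longrightarrow> \<not> G x u" "u \<in> set U2 \<Longrightarrow> G u x"
  using Dz Dy Uy Ux yx trans_pos[of d y x] trans_neg[of y u x] by (auto simp: sorted_wrt_append)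

text \<open>
  In the second word \<open>z\<close> stands before \<open>D1\<close>, so a chain using letters of \<open>D1\<close> before \<open>z\<close> takes \<open>y\<close>
  instead. Upper bounds are kept because of the letters of \<open>D1\<close>, lower bounds because \<open>y\<close> lies
  above \<open>z\<close>.
\<close>

lemma down_block:
  assumes "subseq d (D1 @ [z] @ D2)"
  shows "\<exists>d'. sorted_wrt G d' \<and> subseq d' ([z] @ D1 @ [y] @ D2) \<and> squeezed G d d'"
proof -
  obtain e1 ez e2 where d: "d = e1 @ ez @ e2" "subseq e1 D1" "subseq ez [z]" "subseq e2 D2"
    using assms unfolding subseq_append_iff by blast
  note sets = subseq_set[OF d(2)] subseq_set[OF d(4)]
  have dec: "sorted_wrt G d" using assms Dz sorted_wrt_subseq by fastforce
  show ?thesis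
  proof (cases "ez = [] \<or> e1 = []")
    case True
    then have "subseq d ([z] @ D1 @ [y] @ D2)"
    proof
      assume "ez = []"
      moreover have "subseq ([] @ e1 @ [] @ e2) ([z] @ D1 @ [y] @ D2)"
        by (intro list_emb_append_mono d) auto
      ultimately show ?thesis using d by simp
    next
      assume "e1 = []"
      moreover have "subseq (ez @ [] @ [] @ e2) ([z] @ D1 @ [y] @ D2)"
        by (intro list_emb_append_mono d) auto
      ultimately show ?thesis using d by simp
    qed
    with dec show ?thesis by (intro exI[of _ d]) auto
  next
    case False
    then have ez: "ez = [z]" and "e1 \<noteq> []" using d by (auto simp: subseq_singleton_right)
    then obtain t where t: "t \<in> set e1" by (cases e1) auto
    have "subseq ([] @ e1 @ [y] @ e2) ([z] @ D1 @ [y] @ D2)"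
      by (intro list_emb_append_mono d) auto
    moreover have "sorted_wrt G (e1 @ [y] @ e2)"
      using sorted_wrt_subseq[OF _ Dy] list_emb_append_mono[OF d(2), of "y # e2" "y # D2"] d(4) by auto
    moreover have Gzy: "G y c" if "G z c" for c using that zy trans_neg by blast
    have Gey: "G c y" if "\<forall>t\<in>set e1. G c t" for c
      using that t sets swap_order(1) trans_pos by blast
    have "squeezed G (e1 @ [z] @ e2) (e1 @ [y] @ e2)"
      by (rule squeezedI) (use Gzy Gey in auto)
    ultimately show ?thesis using ez d by (intro exI[of _ "e1 @ [y] @ e2"]) auto
  qed
qed

text \<open>
  The increasing part contributes at most one letter \<open>t\<close> to a decreasing chain. If \<open>t\<close> comes before
  \<open>y\<close>, it stays, and \<open>x\<close> does not follow. Otherwise the letters before \<open>t\<close> all come from \<open>D1\<close>, and \<open>y\<close>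
  can serve for \<open>t\<close>, which is needed when \<open>x\<close> follows.
\<close>

lemma dec_block:
  assumes "sorted_wrt G a" "subseq a ((D1 @ [z] @ D2) @ (U1 @ [y] @ U2) @ [x])"
  shows "\<exists>a'. sorted_wrt G a' \<and> subseq a' (([z] @ D1 @ [y] @ D2) @ U1 @ [x] @ U2) \<and> squeezed G a a'"
proof -
  obtain d u s where a: "a = d @ u @ s" "subseq d (D1 @ [z] @ D2)" "subseq u (U1 @ [y] @ U2)"
    "subseq s [x]"
    using assms(2) by (rule subseq_append3E)
  obtain d' where d': "sorted_wrt G d'" "subseq d' ([z] @ D1 @ [y] @ D2)" "squeezed G d d'"
    using down_block[OF a(2)] by blast
  have s: "s = [] \<or> s = [x]" using a by (simp add: subseq_singleton_right)
  have "sorted_wrt (\<lambda>a b. \<not> G a b) u" using sorted_wrt_subseq[OF a(3)] Uy by simp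
  then consider "u = []" | t where "u = [t]"
    using sorted_both[of G u] assms(1) a(1) by (auto simp: sorted_wrt_append)
  then show ?thesis
  proof cases
    case 1
    have "subseq (d' @ [] @ s @ []) (([z] @ D1 @ [y] @ D2) @ U1 @ [x] @ U2)"
      by (intro list_emb_append_mono d' a) auto
    moreover have "sorted_wrt G (d' @ s)"
      using sorted_right_bounds[of G d d' s] d' assms(1) a(1) 1 by (simp add: squeezed_def)
    ultimately show ?thesis
      using 1 a d' by (intro exI[of _ "d' @ s"]) (auto intro!: squeezed_append)
  next
    case (2 t)
    show ?thesis
    proof (cases "t \<in> set U1")
      case True
      then have "s = []" using s assms(1) a(1) 2 swap_order by (auto simp: sorted_wrt_append)
      have "subseq (d' @ [t] @ [] @ []) (([z] @ D1 @ [y] @ D2) @ U1 @ [x] @ U2)"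
        by (intro list_emb_append_mono d' a) (auto simp: subseq_singleton_left True)
      moreover have "sorted_wrt G (d' @ [t])"
        using sorted_right_bounds[of G d d' "[t]"] d' assms(1) a(1) 2 \<open>s = []\<close>
        by (simp add: squeezed_def)
      ultimately show ?thesis
        using 2 a d' \<open>s = []\<close> by (intro exI[of _ "d' @ [t]"]) (auto intro!: squeezed_append)
    next
      case False
      then have t: "t = y \<or> t \<in> set U2"
        using a(3) 2 subseq_set[of u "U1 @ [y] @ U2"] by auto
      then have Gy: "G c y" if "G c t" for c
        using that swap_order trans_neg[of c y t] by blast
      obtain e1 ez e2 where d: "d = e1 @ ez @ e2" "subseq e1 D1" "subseq ez [z]" "subseq e2 D2"
        using a(2) unfolding subseq_append_iff by blast
      have Gd: "G e t" if "e \<in> set d" for e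
        using that assms(1) a(1) 2 by (auto simp: sorted_wrt_append)
      have "ez = []" using d(1,3) Gd Gy zy by (auto simp: subseq_singleton_right)
      moreover have "e2 = []"
      proof (rule ccontr)
        assume "e2 \<noteq> []"
        then obtain e where "e \<in> set e2" by (cases e2) auto
        then have "G z e" "G e t" using subseq_set[OF d(4)] swap_order Gd d by auto
        then show False using Gy zy trans_pos by blast
      qed
      ultimately have d1: "d = e1" using d by simp
      show ?thesis
      proof (cases "s = []")
        case True
        have "subseq (([] @ e1 @ [] @ []) @ [] @ [] @ [t]) (([z] @ D1 @ [y] @ D2) @ U1 @ [x] @ U2)"
          if "t \<in> set U2"
          by (intro list_emb_append_mono d) (auto simp: subseq_singleton_left that)
        moreover have "subseq (([] @ e1 @ [y] @ []) @ [] @ [] @ [])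
            (([z] @ D1 @ [y] @ D2) @ U1 @ [x] @ U2)"
          by (intro list_emb_append_mono d) auto
        ultimately show ?thesis using t assms(1) a 2 d1 True by (intro exI[of _ a]) auto
      next
        case False
        then have [simp]: "s = [x]" using s by simp
        have sub: "subseq (([] @ e1 @ [y] @ []) @ [] @ [x] @ [])
            (([z] @ D1 @ [y] @ D2) @ U1 @ [x] @ U2)"
          by (intro list_emb_append_mono d) auto
        have "sorted_wrt G (e1 @ [y, x])"
          using assms(1) a(1) d1 2 yx Gd Gy by (auto simp: sorted_wrt_append)
        moreover have "squeezed G (e1 @ [t, x]) (e1 @ [y, x])"
          by (rule squeezedI) (use Gy yx trans_pos[of y x] in auto)
        ultimately show ?thesis using sub a 2 d1 by (intro exI[of _ "e1 @ [y, x]"]) auto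
      qed
    qed
  qed
qed

text \<open>
  A chain through \<open>y\<close> takes \<open>x\<close> instead; a chain ending in \<open>x\<close> uses only letters of \<open>U1\<close> before it.
  Lower bounds may be lost, as \<open>x\<close> lies below \<open>y\<close>.
\<close>

lemma up_block:
  assumes "sorted_wrt (\<lambda>a b. \<not> G a b) b" "subseq b ((U1 @ [y] @ U2) @ [x])"
  shows "\<exists>b'. sorted_wrt (\<lambda>a b. \<not> G a b) b' \<and> subseq b' (U1 @ [x] @ U2) \<and> length b' = length b \<and>
     right_bounds (\<lambda>a b. \<not> G a b) b b'"
proof -
  obtain u1 uy u2 s where b: "b = (u1 @ uy @ u2) @ s" "subseq u1 U1" "subseq uy [y]" "subseq u2 U2"
    "subseq s [x]"
    using assms(2) unfolding subseq_append_iff by blast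
  note sets = subseq_set[OF b(2)] subseq_set[OF b(4)]
  have s: "s = [] \<or> s = [x]" and uy: "uy = [] \<or> uy = [y]"
    using b by (simp_all add: subseq_singleton_right)
  have inc: "sorted_wrt (\<lambda>a b. \<not> G a b) (u1 @ [x] @ u2)"
    using sorted_wrt_subseq[OF list_emb_append_mono[OF b(2) list_emb_append_mono[OF _ b(4)]], of "[x]" "[x]"]
      Ux by auto
  have sub: "subseq (u1 @ [x] @ u2) (U1 @ [x] @ U2)" "subseq (u1 @ [] @ u2) (U1 @ [x] @ U2)"
    by (intro list_emb_append_mono b; simp)+
  show ?thesis
  proof (cases "s = []")
    case False
    with s have [simp]: "s = [x]" by simp
    have "uy = []" using uy assms(1) b(1) yx by (auto simp: sorted_wrt_append)
    moreover have "u2 = []"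
    proof (rule ccontr)
      assume "u2 \<noteq> []"
      then obtain t where "t \<in> set u2" by (cases u2) auto
      then have "G t x" "\<not> G t x"
        using sets swap_order(10)[of t] assms(1) b(1) by (auto simp: sorted_wrt_append)
      then show False by simp
    qed
    ultimately show ?thesis using sub inc b(1) by (intro exI[of _ b]) auto
  next
    case True
    show ?thesis
    proof (cases "uy = []")
      case True
      with \<open>s = []\<close> sub assms(1) b(1) show ?thesis by (intro exI[of _ b]) auto
    next
      case False
      with uy have [simp]: "uy = [y]" by simp
      have "\<not> G x c" if "\<not> G y c" for c using that yx trans_pos by blast
      then have "right_bounds (\<lambda>a b. \<not> G a b) (u1 @ [y] @ u2) (u1 @ [x] @ u2)"
        by (intro right_boundsI) auto
      then show ?thesis using \<open>s = []\<close> sub inc b(1) by (intro exI[of _ "u1 @ [x] @ u2"]) auto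
    qed
  qed
qed

text \<open>
  The decreasing part contributes at most one letter. The chain through \<open>y\<close> takes \<open>x\<close> instead if some
  earlier letter lies below \<open>x\<close>, which then provides the lower bounds. If there is no earlier letter,
  \<open>y\<close> is kept, as nothing of \<open>U1\<close> is used. If the only earlier letter \<open>e\<close> does not lie below \<open>x\<close>,
  then \<open>e\<close> lies in \<open>z D2\<close>, and \<open>z y\<close> replaces \<open>e y\<close>.
\<close>

lemma inc_block:
  assumes "sorted_wrt (\<lambda>a b. \<not> G a b) b" "subseq b ((D1 @ [z] @ D2) @ (U1 @ [y] @ U2) @ [x])"
  shows "\<exists>b'. sorted_wrt (\<lambda>a b. \<not> G a b) b' \<and>
     subseq b' (([z] @ D1 @ [y] @ D2) @ U1 @ [x] @ U2) \<and> squeezed (\<lambda>a b. \<not> G a b) b b'"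
proof -
  obtain d u s where dus: "b = d @ u @ s" "subseq d (D1 @ [z] @ D2)" "subseq u (U1 @ [y] @ U2)"
    "subseq s [x]"
    using assms(2) by (rule subseq_append3E)
  obtain u1 uy u2 where "u = u1 @ uy @ u2" "subseq u1 U1" "subseq uy [y]" "subseq u2 U2"
    using dus(3) by (rule subseq_append3E)
  with dus have b: "b = d @ (u1 @ uy @ u2) @ s" "subseq d (D1 @ [z] @ D2)"
    "subseq u1 U1" "subseq uy [y]" "subseq u2 U2" "subseq s [x]" by simp_all
  note sets = subseq_set[OF b(3)] subseq_set[OF b(5)]
  have s: "s = [] \<or> s = [x]" and uy: "uy = [] \<or> uy = [y]"
    using b by (simp_all add: subseq_singleton_right)
  have "sorted_wrt G d" using sorted_wrt_subseq[OF b(2)] Dz by simp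
  then have d: "d = [] \<or> (\<exists>e. d = [e])"
    using sorted_both[of G d] assms(1) b(1) by (auto simp: sorted_wrt_append)
  have sub_d: "subseq d ([z] @ D1 @ [y] @ D2)"
  proof -
    have "set d \<subseteq> set ([z] @ D1 @ [y] @ D2)" using subseq_set[OF b(2)] by auto
    with d show ?thesis by (auto simp: subseq_singleton_left)
  qed
  have inc: "sorted_wrt (\<lambda>a b. \<not> G a b) (u1 @ [x] @ u2)"
    using sorted_wrt_subseq[OF list_emb_append_mono[OF b(3) list_emb_append_mono[OF _ b(5)]], of "[x]" "[x]"]
      Ux by auto
  have sub: "subseq (d @ u1 @ [x] @ u2) (([z] @ D1 @ [y] @ D2) @ U1 @ [x] @ U2)"
    "subseq (d @ u1 @ [] @ u2) (([z] @ D1 @ [y] @ D2) @ U1 @ [x] @ U2)"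
    by (intro list_emb_append_mono b sub_d; simp)+
  show ?thesis
  proof (cases "s = []")
    case False
    with s have [simp]: "s = [x]" by simp
    have "uy = []" using uy assms(1) b(1) yx by (auto simp: sorted_wrt_append)
    moreover have "u2 = []"
    proof (rule ccontr)
      assume "u2 \<noteq> []"
      then obtain t where "t \<in> set u2" by (cases u2) auto
      then have "G t x" "\<not> G t x"
        using sets swap_order(10)[of t] assms(1) b(1) by (auto simp: sorted_wrt_append)
      then show False by simp
    qed
    ultimately show ?thesis using sub assms(1) b(1) by (intro exI[of _ b]) auto
  next
    case s_Nil: True
    show ?thesis
    proof (cases "uy = []")
      case True
      with s_Nil sub assms(1) b(1) show ?thesis by (intro exI[of _ b]) auto
    next
      case False
      with uy have [simp]: "uy = [y]" by simp
      have xc: "\<not> G x c" if "\<not> G y c" for c using that yx trans_pos by blast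
      have before_y: "\<not> G t y" if "t \<in> set d \<union> set u1" for t
        using that assms(1) b(1) by (auto simp: sorted_wrt_append)
      consider t where "t \<in> set d \<union> set u1" "\<not> G t x" | "d = []" "u1 = []"
        | e where "d = [e]" "G e x" "u1 = []"
      proof (cases "u1 = []")
        case True
        then show ?thesis using d that by fastforce
      next
        case False
        then obtain u where "u \<in> set u1" by (cases u1) auto
        then show ?thesis using that(1)[of u] sets swap_order(7)[of u] by auto
      qed
      then show ?thesis
      proof cases
        case (1 t)
        have u1x: "\<not> G u x" if "u \<in> set u1" for u using that sets swap_order by auto
        have dx: "\<not> G e x" if "e \<in> set d" for e
        proof (cases "t \<in> set d")
          case True
          then show ?thesis using 1 d that by auto
        next
          case False
          then have "\<not> G e t" using 1 that assms(1) b(1) by (auto simp: sorted_wrt_append)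
          then show ?thesis using 1 trans_neg by blast
        qed
        have "sorted_wrt (\<lambda>a b. \<not> G a b) (d @ u1 @ [x] @ u2)"
          using inc assms(1) b(1) dx by (auto simp: sorted_wrt_append)
        moreover have "squeezed (\<lambda>a b. \<not> G a b) b (d @ u1 @ [x] @ u2)"
          by (rule squeezedI) (use b(1) s_Nil 1 xc trans_neg[of _ t x] in auto)
        ultimately show ?thesis using sub(1) by blast
      next
        case 2
        have "subseq (([] @ [] @ [y] @ []) @ [] @ [] @ u2) (([z] @ D1 @ [y] @ D2) @ U1 @ [x] @ U2)"
          by (intro list_emb_append_mono b) auto
        then show ?thesis using 2 s_Nil b(1) assms(1) by (intro exI[of _ b]) auto
      next
        case (3 e)
        have "\<not> G e y" using before_y 3 by auto
        then have ze: "e = z \<or> G z e"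
          using swap_order subseq_set[OF b(2)] 3 by auto
        have zc: "\<not> G c z" if "\<not> G c e" for c
          using that ze trans_pos by blast
        have "\<not> G z t" if "t \<in> set u2" for t
          using that sets swap_order(8) zy trans_neg[of z y t] by blast
        then have "sorted_wrt (\<lambda>a b. \<not> G a b) (z # y # u2)"
          using assms(1) b(1) s_Nil 3 zy by (auto simp: sorted_wrt_append)
        moreover have "subseq (([z] @ [] @ [y] @ []) @ [] @ [] @ u2)
            (([z] @ D1 @ [y] @ D2) @ U1 @ [x] @ U2)"
          by (intro list_emb_append_mono b) auto
        moreover have "\<not> G z c" if "\<not> G y c" for c
          using that zy trans_neg by blast
        then have "squeezed (\<lambda>a b. \<not> G a b) b (z # y # u2)"
          by (intro squeezedI) (use b(1) s_Nil 3 zc in auto)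
        ultimately show ?thesis by (intro exI[of _ "z # y # u2"]) auto
      qed
    qed
  qed
qed

text \<open>
  The two halves are exchanged independently when the hook turns exactly between \<open>D\<close> and \<open>U\<close>.
\<close>

lemma split_block:
  assumes "subseq d (D1 @ [z] @ D2)" "sorted_wrt (\<lambda>a b. \<not> G a b) b" "subseq b ((U1 @ [y] @ U2) @ [x])"
  shows "\<exists>a' b'. sorted_wrt G a' \<and> sorted_wrt (\<lambda>a b. \<not> G a b) b' \<and>
      subseq (a' @ b') (([z] @ D1 @ [y] @ D2) @ U1 @ [x] @ U2) \<and> length (a' @ b') = length (d @ b) \<and>
      left_bounds G d a' \<and>
      right_bounds (\<lambda>a b. \<not> G a b) b b'"
proof -
  obtain a' where a': "sorted_wrt G a'" "subseq a' ([z] @ D1 @ [y] @ D2)" "squeezed G d a'"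
    using down_block assms by blast
  obtain b' where b': "sorted_wrt (\<lambda>a b. \<not> G a b) b'" "subseq b' (U1 @ [x] @ U2)" "length b' = length b"
     "right_bounds (\<lambda>a b. \<not> G a b) b b'"
    using up_block[OF assms(2,3)] by blast
  show ?thesis
    using a' b' list_emb_append_mono[OF a'(2) b'(2)]
    by (intro exI[of _ a'] exI[of _ b']) (auto simp: squeezed_def)
qed

text \<open>
  With both chains nonempty, the turning point can be moved to the border between the decreasing and
  the increasing part: letters of the decreasing part may join the decreasing chain, and
  a letter \<open>t\<close> of the increasing part joins the increasing chain. The exception is a hook ending in
  \<open>t x\<close> with \<open>G t x\<close>, which is one decreasing chain.
\<close>

lemma hook_dominated_swap:
  "hook_dominated G (D1 @ z # D2 @ U1 @ y # U2 @ [x]) (z # D1 @ y # D2 @ U1 @ x # U2)"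
  unfolding hook_dominated_def
proof (intro allI impI, elim conjE)
  fix a b assume a: "sorted_wrt G a" and b: "sorted_wrt (\<lambda>a b. \<not> G a b) b"
    and "subseq (a @ b) (D1 @ z # D2 @ U1 @ y # U2 @ [x])"
  then have sub: "subseq (a @ b) ((D1 @ [z] @ D2) @ (U1 @ [y] @ U2) @ [x])" by simp
  have "\<exists>a' b'. sorted_wrt G a' \<and> sorted_wrt (\<lambda>a b. \<not> G a b) b' \<and>
         subseq (a' @ b') (([z] @ D1 @ [y] @ D2) @ U1 @ [x] @ U2) \<and>
         length (a' @ b') = length (a @ b) \<and>
         left_bounds G a a' \<and>
         right_bounds (\<lambda>a b. \<not> G a b) b b' \<and>
         (b = [] \<longrightarrow> b' = [] \<and> squeezed G a a') \<and>
         (a = [] \<longrightarrow> a' = [] \<and> squeezed (\<lambda>a b. \<not> G a b) b b')"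
  proof (cases "b = []")
    case True
    then obtain a' where "sorted_wrt G a'" "subseq a' (([z] @ D1 @ [y] @ D2) @ U1 @ [x] @ U2)"
      "squeezed G a a'" using dec_block[OF a] sub by auto
    moreover from this have "left_bounds G a a'" "length a' = length a"
      by (simp_all add: squeezed_def)
    ultimately show ?thesis using True by - (rule exI[of _ a'], rule exI[of _ "[]"], auto)
  next
    case b_ne: False
    show ?thesis
    proof (cases "a = []")
      case True
      then obtain b' where "sorted_wrt (\<lambda>a b. \<not> G a b) b'"
        "subseq b' (([z] @ D1 @ [y] @ D2) @ U1 @ [x] @ U2)" "squeezed (\<lambda>a b. \<not> G a b) b b'"
        using inc_block[OF b] sub by auto
      moreover from this have "right_bounds (\<lambda>a b. \<not> G a b) b b'" "length b' = length b"
        by (simp_all add: squeezed_def)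
      ultimately show ?thesis using True b_ne by - (rule exI[of _ "[]"], rule exI[of _ b'], auto)
    next
      case a_ne: False
      obtain d v where dv: "a @ b = d @ v" "subseq d (D1 @ [z] @ D2)" "subseq v ((U1 @ [y] @ U2) @ [x])"
        using sub by (rule subseq_append2E)
      have dec_d: "sorted_wrt G d" using sorted_wrt_subseq[OF dv(2)] Dz by simp
      obtain t0 where t0: "t0 \<in> set a" using a_ne by (cases a) auto
      \<comment> \<open>It suffices to split the hook at the border, keeping the outer bounds.\<close>
      have moved: ?thesis
        if m: "sorted_wrt (\<lambda>a b. \<not> G a b) v'" "left_bounds G a d'" "right_bounds (\<lambda>a b. \<not> G a b) b v'"
          "subseq d' (D1 @ [z] @ D2)" "subseq v' ((U1 @ [y] @ U2) @ [x])" "a @ b = d' @ v'" for d' v'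
      proof -
        obtain a' b' where *: "sorted_wrt G a'" "sorted_wrt (\<lambda>a b. \<not> G a b) b'"
          "subseq (a' @ b') (([z] @ D1 @ [y] @ D2) @ U1 @ [x] @ U2)"
          "length (a' @ b') = length (d' @ v')" "left_bounds G d' a'"
          "right_bounds (\<lambda>a b. \<not> G a b) v' b'"
          using split_block[OF m(4) m(1) m(5)] by blast
        have "left_bounds G a a'" "right_bounds (\<lambda>a b. \<not> G a b) b b'"
          using *(5,6) m(2,3) unfolding left_bounds_def right_bounds_def by blast+
        then show ?thesis using * m(6) a_ne b_ne by metis
      qed
      from dv(1) consider db where "d = a @ db" "b = db @ v"
        | ua where "a = d @ ua" "v = ua @ b" "ua \<noteq> []"
        by (auto simp: append_eq_append_conv2) blast
      then show ?thesis
      proof cases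
        case (1 db)
        have "left_bounds G a d"
        proof (rule left_boundsI)
          fix t c assume "t \<in> set d" "\<And>u. u \<in> set a \<Longrightarrow> G c u"
          then show "G c t" using 1 dec_d t0 trans_pos[of c t0 t] by (auto simp: sorted_wrt_append)
        qed
        moreover have "right_bounds (\<lambda>a b. \<not> G a b) b v"
          using 1 by (auto intro: right_boundsI)
        moreover have "sorted_wrt (\<lambda>a b. \<not> G a b) v" using b 1 by (auto simp: sorted_wrt_append)
        ultimately show ?thesis using moved dv by blast
      next
        case (2 ua)
        obtain u s where us: "v = u @ s" "subseq u (U1 @ [y] @ U2)" "subseq s [x]"
          using dv(3) by (rule subseq_append2E)
        then obtain r where r: "u = ua @ r" "b = r @ s"
          using 2 b_ne by (auto simp: subseq_singleton_right append_eq_append_conv2 Cons_eq_append_conv append_eq_Cons_conv)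
        have inc_u: "sorted_wrt (\<lambda>a b. \<not> G a b) u" using sorted_wrt_subseq[OF us(2)] Uy by simp
        then obtain t where t: "ua = [t]"
          using sorted_both[of G ua] a 2 r by (auto simp: sorted_wrt_append)
        obtain b0 b1 where b01: "b = b0 # b1" using b_ne by (cases b) auto
        show ?thesis
        proof (cases "G t b0")
          case False
          then have t_b: "\<not> G t e" if "e \<in> set b" for e
            using that b b01 trans_neg[of t b0 e] by auto
          then have "sorted_wrt (\<lambda>a b. \<not> G a b) (t # b)" using b by simp
          moreover have "left_bounds G a d" using 2 by (auto intro: left_boundsI)
          moreover have "right_bounds (\<lambda>a b. \<not> G a b) b (t # b)"
            by (rule right_boundsI) (use b01 False trans_neg[of t b0] in auto)
          ultimately show ?thesis using moved[of "t # b" d] dv 2 t by simp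
        next
          case True
          have "r = []"
            using True inc_u r t b01 by (cases r) auto
          then have b_x: "b = [x]" using r us(3) b_ne by (simp add: subseq_singleton_right)
          then have tx: "G t x" using True b01 by simp
          have "sorted_wrt G (a @ [x])"
            using a 2 t tx trans_pos[of _ t x] by (auto simp: sorted_wrt_append)
          then obtain a' where a': "sorted_wrt G a'" "squeezed G (a @ [x]) a'"
            "subseq a' (([z] @ D1 @ [y] @ D2) @ U1 @ [x] @ U2)"
            using dec_block sub b_x by blast
          have "left_bounds G a a'"
          proof (rule left_boundsI)
            fix e c assume e: "e \<in> set a'" and c: "\<And>u. u \<in> set a \<Longrightarrow> G c u"
            have "G c x" using c[of t] 2 t tx trans_pos by simp
            then show "G c e"
              using left_boundsD[of G "a @ [x]" a' e c] a' e c by (auto simp: squeezed_def)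
          qed
          moreover have "length a' = length (a @ b)" using a' b_x by (simp add: squeezed_def)
          ultimately show ?thesis
            using a' a_ne b_ne by - (rule exI[of _ a'], rule exI[of _ "[]"], simp add: right_bounds_def)
        qed
      qed
    qed
  qed
  then show "\<exists>a' b'. sorted_wrt G a' \<and> sorted_wrt (\<lambda>a b. \<not> G a b) b' \<and>
         subseq (a' @ b') (z # D1 @ y # D2 @ U1 @ x # U2) \<and>
         length (a' @ b') = length (a @ b) \<and>
         left_bounds G a a' \<and>
         right_bounds (\<lambda>a b. \<not> G a b) b b' \<and>
         (b = [] \<longrightarrow> b' = [] \<and> squeezed G a a') \<and>
         (a = [] \<longrightarrow> a' = [] \<and> squeezed (\<lambda>a b. \<not> G a b) b b')"
    by simp
qed

end

context tie
begin

lemma hook_bump_lines_le: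
  assumes bump: "hook_bump G L x L' z" and "lines_le (hook G) n (p @ z # L' @ q)"
  shows "lines_le (hook G) n (p @ L @ x # q)"
proof -
  obtain D1 D2 U1 U2 y where *:
    "L = D1 @ z # D2 @ U1 @ y # U2" "L' = D1 @ y # D2 @ U1 @ x # U2"
    "sorted_wrt G (D1 @ z # D2)" "sorted_wrt G (D1 @ y # D2)"
    "sorted_wrt (\<lambda>a b. \<not> G a b) (U1 @ y # U2)" "sorted_wrt (\<lambda>a b. \<not> G a b) (U1 @ x # U2)"
    "\<not> G z y" "G y x"
    using bump unfolding hook_bump_def by blast
  interpret hook_swap G D1 D2 U1 U2 x y z
    using * by unfold_locales
  show ?thesis using hook_dominated_lines_le[OF hook_dominated_swap, of n p q] assms(2) * by simp
qed

lemma dec_snoc: "sorted_wrt G A \<Longrightarrow> A \<noteq> [] \<Longrightarrow> G (last A) x \<Longrightarrow> sorted_wrt G (A @ [x])"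
  by (cases A rule: rev_cases) (auto simp: sorted_wrt_append intro: trans_pos)

lemma inc_snoc:
  "sorted_wrt (\<lambda>a b. \<not> G a b) A \<Longrightarrow> A \<noteq> [] \<Longrightarrow> \<not> G (last A) x \<Longrightarrow> sorted_wrt (\<lambda>a b. \<not> G a b) (A @ [x])"
  by (cases A rule: rev_cases) (auto simp: sorted_wrt_append dest: trans_neg)

text \<open>
  The decreasing chain is extended by the first letter of the increasing one where possible.
\<close>

lemma hook_canonical:
  assumes "hook G w" "w \<noteq> []"
  obtains A B where "w = A @ B" "sorted_wrt G A" "sorted_wrt (\<lambda>a b. \<not> G a b) B" "A \<noteq> []"
    "B \<noteq> [] \<Longrightarrow> \<not> G (last A) (hd B)"
proof -
  obtain A B where AB: "w = A @ B" "sorted_wrt G A" "sorted_wrt (\<lambda>a b. \<not> G a b) B"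
    using assms(1) by (auto simp: hook_def)
  show thesis
  proof (cases "A = [] \<or> B \<noteq> [] \<and> G (last A) (hd B)")
    case True
    then obtain b B' where B: "B = b # B'" using AB assms(2) by (cases B) auto
    have "sorted_wrt G (A @ [b])" using True AB B dec_snoc by (cases "A = []") auto
    moreover have "B' \<noteq> [] \<Longrightarrow> \<not> G b (hd B')" using AB B by auto
    ultimately show thesis using that[of "A @ [b]" B'] AB B by auto
  next
    case False
    then show thesis using that[of A B] AB by auto
  qed
qed

text \<open>
  \<open>y\<close> is the first letter of the increasing part that \<open>x\<close> may replace, and \<open>z\<close> the first letter of the
  decreasing part that \<open>y\<close> may replace. The second exists because the decreasing part ends below
  \<open>hd B\<close>, hence below \<open>y\<close>.
\<close>

lemma hook_bump_of_split:
  assumes A: "sorted_wrt G A" "A \<noteq> []" and B: "sorted_wrt (\<lambda>a b. \<not> G a b) B" "B \<noteq> []"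
    and AB: "\<not> G (last A) (hd B)" and x: "G (last B) x"
  obtains D1 z D2 U1 y U2 where "A = D1 @ z # D2" "B = U1 @ y # U2"
    "\<forall>u\<in>set U1. \<not> G u x" "G y x" "\<forall>d\<in>set D1. G d y" "\<not> G z y"
    "hook_bump G (A @ B) x (D1 @ y # D2 @ U1 @ x # U2) z"
proof -
  have "\<exists>u\<in>set B. G u x" using x B by auto
  then obtain U1 y U2 where U: "B = U1 @ y # U2" "G y x" "\<forall>u\<in>set U1. \<not> G u x"
    using split_list_first_prop[of B "\<lambda>u. G u x"] by auto
  have "\<not> G (last A) y"
    using AB B U trans_neg[of "last A" "hd B" y] by (cases U1) auto
  then have "\<exists>d\<in>set A. \<not> G d y" using A by auto
  then obtain D1 z D2 where D: "A = D1 @ z # D2" "\<not> G z y" "\<forall>d\<in>set D1. G d y"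
    using split_list_first_prop[of A "\<lambda>d. \<not> G d y"] by auto
  have "G y d" if "d \<in> set D2" for d
    using that A(1) D trans_neg[of z y d] by (auto simp: sorted_wrt_append)
  then have dec: "sorted_wrt G (D1 @ y # D2)" using A(1) D by (auto simp: sorted_wrt_append)
  have "\<not> G x u" if "u \<in> set U2" for u
    using that B(1) U trans_pos[of y x u] by (auto simp: sorted_wrt_append)
  then have inc: "sorted_wrt (\<lambda>a b. \<not> G a b) (U1 @ x # U2)"
    using B(1) U by (auto simp: sorted_wrt_append)
  have "hook_bump G (A @ B) x (D1 @ y # D2 @ U1 @ x # U2) z"
    unfolding hook_bump_def
    by (intro exI[of _ D1] exI[of _ D2] exI[of _ U1] exI[of _ U2] exI[of _ y])
      (use A(1) B(1) D U dec inc in auto)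
  then show thesis using that D U by blast
qed

lemma hook_no_snoc:
  assumes "sorted_wrt G A" "sorted_wrt (\<lambda>a b. \<not> G a b) B" "\<not> hook G (A @ B @ [x])"
  shows "B \<noteq> [] \<and> G (last B) x"
proof -
  have "sorted_wrt (\<lambda>a b. \<not> G a b) (B @ [x])" if "B = [] \<or> \<not> G (last B) x"
    using that inc_snoc assms(2) by (cases "B = []") auto
  then show ?thesis using assms hookI[of G A "B @ [x]"] by auto
qed

lemma hook_bump_ex:
  assumes "hook G C" "\<not> hook G (C @ [x])"
  shows "\<exists>C' y. hook_bump G C x C' y"
proof -
  have "C \<noteq> []" using assms hookI[of G "[x]" "[]"] by auto
  then obtain A B where AB: "C = A @ B" "sorted_wrt G A" "sorted_wrt (\<lambda>a b. \<not> G a b) B" "A \<noteq> []"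
    "B \<noteq> [] \<Longrightarrow> \<not> G (last A) (hd B)"
    using hook_canonical[OF assms(1)] by metis
  moreover have "B \<noteq> [] \<and> G (last B) x" using hook_no_snoc AB assms by auto
  ultimately show ?thesis using hook_bump_of_split[of A B x] by metis
qed

text \<open>
  The local obstruction to being a hook: an ascent followed by a descent.
\<close>

lemma not_hook3: "\<not> G a b \<Longrightarrow> G b c \<Longrightarrow> \<not> hook G [a, b, c]"
  by (auto simp: hook_def Cons_eq_append_conv)

lemma hook_bump_hooks:
  assumes "hook_bump G C x C' y"
  shows "hook G C \<and> \<not> hook G (C @ [x]) \<and> hook G C'"
proof -
  obtain D1 D2 U1 U2 v where *:
    "C = D1 @ y # D2 @ U1 @ v # U2" "C' = D1 @ v # D2 @ U1 @ x # U2"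
    "sorted_wrt G (D1 @ y # D2)" "sorted_wrt G (D1 @ v # D2)"
    "sorted_wrt (\<lambda>a b. \<not> G a b) (U1 @ v # U2)" "sorted_wrt (\<lambda>a b. \<not> G a b) (U1 @ x # U2)"
    "\<not> G y v" "G v x"
    using assms unfolding hook_bump_def by blast
  have "subseq ([] @ [y] @ [] @ [] @ [v] @ [] @ [x]) (D1 @ [y] @ D2 @ U1 @ [v] @ U2 @ [x])"
    by (intro list_emb_append_mono) auto
  then have "\<not> hook G (C @ [x])"
    using hook_subseq[of G "C @ [x]" "[y, v, x]"] not_hook3 * by auto
  then show ?thesis using hookI[OF *(3,5)] hookI[OF *(4,6)] * by simp
qed

text \<open>
  The place of \<open>y\<close> is determined by the word and \<open>x\<close>: an earlier candidate would lie in the decreasing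
  part of the later split, after its own \<open>z\<close>.
\<close>

lemma hook_bump_fun_aux:
  assumes "E1 @ w # E2 @ V1 = D1 @ z # D2 @ U1 @ y # M" "sorted_wrt G (E1 @ w # E2)"
    "\<forall>u\<in>set V1. \<not> G u x" "G y x" "\<not> G z y"
  shows False
proof -
  have yV1: "y \<notin> set V1" using assms by auto
  have eq: "(E1 @ w # E2) @ V1 = (D1 @ z # D2 @ U1) @ y # M" using assms(1) by simp
  obtain us where "E1 @ w # E2 = (D1 @ z # D2 @ U1) @ y # us"
    using yV1 append_eq_append_Cons_cases[OF eq] by blast
  then show False using assms(2,5) by (simp add: sorted_wrt_append)
qed

lemma hook_bump_fun:
  assumes "hook_bump G L x L' z" "hook_bump G L x M' w"
  shows "L' = M' \<and> z = w"
proof -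
  obtain D1 D2 U1 U2 y where D:
    "L = D1 @ z # D2 @ U1 @ y # U2" "L' = D1 @ y # D2 @ U1 @ x # U2"
    "sorted_wrt G (D1 @ z # D2)" "sorted_wrt G (D1 @ y # D2)"
    "sorted_wrt (\<lambda>a b. \<not> G a b) (U1 @ x # U2)" "\<not> G z y" "G y x"
    using assms(1) unfolding hook_bump_def by blast
  obtain E1 E2 V1 V2 v where E:
    "L = E1 @ w # E2 @ V1 @ v # V2" "M' = E1 @ v # E2 @ V1 @ x # V2"
    "sorted_wrt G (E1 @ w # E2)" "sorted_wrt G (E1 @ v # E2)"
    "sorted_wrt (\<lambda>a b. \<not> G a b) (V1 @ x # V2)" "\<not> G w v" "G v x"
    using assms(2) unfolding hook_bump_def by blast
  have U1: "\<forall>u\<in>set U1. \<not> G u x" and V1: "\<forall>u\<in>set V1. \<not> G u x"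
    using D E by (auto simp: sorted_wrt_append)
  have eq: "(D1 @ z # D2 @ U1) @ y # U2 = (E1 @ w # E2 @ V1) @ v # V2" using D E by simp
  consider "D1 @ z # D2 @ U1 = E1 @ w # E2 @ V1" "y = v" "U2 = V2"
    | M where "E1 @ w # E2 @ V1 = D1 @ z # D2 @ U1 @ y # M"
    | M where "D1 @ z # D2 @ U1 = E1 @ w # E2 @ V1 @ v # M"
    using append_Cons_eq_append_Cons_cases[OF eq] unfolding append.assoc append_Cons by blast
  then show ?thesis
  proof cases
    case 1
    then have "D1 = E1 \<and> z = w \<and> D2 @ U1 = E2 @ V1"
      using D(4,6) E(4,6) append_Cons_eq_append_Cons_cases[of D1 z "D2 @ U1" E1 w "E2 @ V1"]
      by (auto simp: sorted_wrt_append)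
    moreover from this have "D1 @ y # (D2 @ U1) @ x # U2 = E1 @ v # (E2 @ V1) @ x # V2"
      using 1 by metis
    ultimately show ?thesis using D(2) E(2) by simp
  next
    case 2
    then show ?thesis using hook_bump_fun_aux[OF 2 E(3) V1 D(7,6)] by simp
  next
    case 3
    then show ?thesis using hook_bump_fun_aux[OF 3 D(3) U1 E(7,6)] by simp
  qed
qed

text \<open>
  If \<open>x\<close> cannot be appended to a hook, the hook ends in an ascent, and \<open>x\<close> is a descent after it.
\<close>

lemma hook_descent:
  assumes "hook G C" "\<not> hook G (C @ [x])"
  shows "\<exists>P c' c. C = P @ [c', c] \<and> \<not> G c' c \<and> G c x"
proof -
  have "C \<noteq> []" using assms hookI[of G "[x]" "[]"] by auto
  then obtain A B where AB: "C = A @ B" "sorted_wrt G A" "sorted_wrt (\<lambda>a b. \<not> G a b) B" "A \<noteq> []"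
    "B \<noteq> [] \<Longrightarrow> \<not> G (last A) (hd B)"
    using hook_canonical[OF assms(1)] by metis
  have B: "B \<noteq> []" "G (last B) x" using hook_no_snoc[of A B x] AB assms by auto
  then obtain B' c where c: "B = B' @ [c]" by (metis rev_exhaust)
  show ?thesis
  proof (cases B' rule: rev_cases)
    case Nil
    then have "C = butlast A @ [last A, c] \<and> \<not> G (last A) c \<and> G c x" using AB B c by auto
    then show ?thesis by blast
  next
    case (snoc B'' b)
    then have "C = (A @ B'') @ [b, c] \<and> \<not> G b c \<and> G c x" using AB B c by (auto simp: sorted_wrt_append)
    then show ?thesis by blast
  qed
qed

text \<open>
  A hook of length \<open>n + 1\<close> would end in \<open>x\<close>. Let \<open>c' c\<close> be the final ascent of \<open>C1\<close>. If the hook does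
  not use \<open>c\<close>, then \<open>c\<close> can replace \<open>x\<close>. If it uses \<open>c\<close>, then it is decreasing up to \<open>c\<close>, so it
  does not use \<open>c'\<close>, and \<open>c' c\<close> can replace \<open>c x\<close>. Both give a hook of the same length in \<open>C2 C1\<close>.
\<close>

lemma hook_lines_le_append:
  assumes C1: "hook G C1" "\<not> hook G (C1 @ [x])" and sh: "lines_le (hook G) n (C2 @ C1)"
  shows "lines_le (hook G) n (C2 @ C1 @ [x])"
  unfolding lines_le_def
proof (intro allI impI, elim conjE)
  fix s assume s: "subseq s (C2 @ C1 @ [x])" "hook G s"
  obtain P c' c where P: "C1 = P @ [c', c]" "\<not> G c' c" "G c x"
    using hook_descent[OF C1] by blast
  show "length s \<le> n"
  proof (rule ccontr)
    assume long: "\<not> ?thesis"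
    obtain g sx where g: "s = g @ sx" "subseq g (C2 @ C1)" "subseq sx [x]"
      using s(1) subseq_append2E[of s "C2 @ C1" "[x]"] by auto
    have hook_g: "hook G g" using s(2) g hook_subseq by (metis subseq_rev_drop_many subseq_order.refl)
    have "length g \<le> n" using sh g hook_g by (auto simp: lines_le_def)
    with g long have sx: "sx = [x]" and len: "length g = n"
      by (auto simp: subseq_singleton_right)
    obtain X Y where XY: "g @ [x] = X @ Y" "sorted_wrt G X" "sorted_wrt (\<lambda>a b. \<not> G a b) Y"
      using s(2) g sx by (auto simp: hook_def)
    then have last_step: "sorted_wrt G (g @ [x]) \<or>
        (\<exists>Y'. g = X @ Y' \<and> sorted_wrt (\<lambda>a b. \<not> G a b) (Y' @ [x]))"
      by (cases Y rule: rev_cases) auto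
    obtain h hc where h: "g = h @ hc" "subseq h (C2 @ P @ [c'])" "subseq hc [c]"
      using g(2) P(1) subseq_append2E[of g "C2 @ P @ [c']" "[c]"] by auto
    show False
    proof (cases "hc = []")
      case True
      then have "subseq (g @ [c]) (C2 @ C1)"
        using h P list_emb_append_mono[of "(=)" h "C2 @ P @ [c']" "[c]" "[c]"] by auto
      moreover have "hook G (g @ [c])"
        using last_step
      proof
        assume "sorted_wrt G (g @ [x])"
        then show ?thesis using hookI[of G g "[c]"] by (simp add: sorted_wrt_append)
      next
        assume "\<exists>Y'. g = X @ Y' \<and> sorted_wrt (\<lambda>a b. \<not> G a b) (Y' @ [x])"
        then obtain Y' where Y': "g = X @ Y'" "sorted_wrt (\<lambda>a b. \<not> G a b) (Y' @ [x])" by blast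
        have "\<not> G e c" if "e \<in> set Y'" for e
          using that Y'(2) P(3) trans_pos[of e c x] by (auto simp: sorted_wrt_append)
        then show ?thesis using hookI[of G X "Y' @ [c]"] Y' XY by (auto simp: sorted_wrt_append)
      qed
      ultimately show False using sh len by (auto simp: lines_le_def)
    next
      case False
      then have hc: "hc = [c]" using h(3) by (simp add: subseq_singleton_right)
      have dec: "sorted_wrt G (h @ [c])"
        using last_step
      proof
        assume "\<exists>Y'. g = X @ Y' \<and> sorted_wrt (\<lambda>a b. \<not> G a b) (Y' @ [x])"
        then obtain Y' where Y': "g = X @ Y'" "sorted_wrt (\<lambda>a b. \<not> G a b) (Y' @ [x])" by blast
        then have "Y' = []" using h hc P(3) by (cases Y' rule: rev_cases) (auto simp: sorted_wrt_append)
        then show ?thesis using Y' XY h hc by simp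
      qed (use h hc in \<open>auto simp: sorted_wrt_append\<close>)
      obtain k kc where k: "h = k @ kc" "subseq k (C2 @ P)" "subseq kc [c']"
        using h(2) subseq_append2E[of h "C2 @ P" "[c']"] by auto
      have "kc = []" using dec k P(2) by (auto simp: subseq_singleton_right sorted_wrt_append)
      then have "subseq (h @ [c', c]) (C2 @ C1)"
        using k P list_emb_append_mono[of "(=)" h "C2 @ P" "[c', c]" "[c', c]"] by auto
      moreover have "hook G (h @ [c', c])"
        using hookI[of G h "[c', c]"] dec P(2) by (auto simp: sorted_wrt_append)
      ultimately show False using sh len h hc by (auto simp: lines_le_def)
    qed
  qed
qed

text \<open>
  Because of the bound for \<open>v u z\<close>, the letter \<open>z\<close> cannot be appended to a hook in \<open>v u\<close> longer
  than \<open>u\<close>. So this hook ends in an ascent \<open>c' c\<close> with \<open>G c z\<close>. As \<open>v\<close> is shorter than \<open>u\<close>, at least two letters of the hook lie in \<open>u\<close>, so \<open>c' c\<close> and \<open>z\<close> would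
  occur in the hook \<open>u z\<close>.
\<close>

lemma hook_lines_le_butlast:
  assumes uz: "hook G (u @ [z])" and v: "length v < length u"
    and sh: "lines_le (hook G) (Suc (length u)) (v @ u @ [z])"
  shows "lines_le (hook G) (length u) (v @ u)"
  unfolding lines_le_def
proof (intro allI impI, elim conjE)
  fix s assume s: "subseq s (v @ u)" "hook G s"
  show "length s \<le> length u"
  proof (rule ccontr)
    assume long: "\<not> ?thesis"
    have no_snoc: "\<not> hook G (s @ [z])"
    proof
      assume "hook G (s @ [z])"
      moreover have "subseq (s @ [z]) (v @ u @ [z])"
        using s(1) list_emb_append_mono[of "(=)" s "v @ u" "[z]" "[z]"] by auto
      ultimately show False using sh long by (auto simp: lines_le_def)
    qed
    obtain R c' c where R: "s = R @ [c', c]" "\<not> G c' c" "G c z"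
      using hook_descent[OF s(2) no_snoc] by blast
    obtain sv su where sv: "s = sv @ su" "subseq sv v" "subseq su u"
      using s(1) by (rule subseq_append2E)
    have "length su \<ge> 2" using long list_emb_length[OF sv(2)] v sv(1) by auto
    then have "su = drop (length sv) R @ [c', c]"
      using sv(1) R(1) by (auto simp: append_eq_append_conv2 append_eq_Cons_conv Cons_eq_append_conv)
    then have "subseq [c', c] u" using sv(3) by (metis subseq_drop_many subseq_order.order_trans subseq_order.refl)
    then have "subseq ([c', c] @ [z]) (u @ [z])" by (intro list_emb_append_mono) auto
    then show False using hook_subseq[OF uz] not_hook3[OF R(2,3)] by auto
  qed
qed

text \<open>
  A letter \<open>t\<close> of \<open>v\<close> with \<open>G t (hd u)\<close> could be put before \<open>u\<close>. So all letters of \<open>v\<close> lie below \<open>hd u\<close>,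
  and \<open>v\<close> followed by \<open>hd u\<close> is a hook.
\<close>

lemma hook_adjacent_length:
  assumes u: "hook G u" "u \<noteq> []" and v: "hook G v" and sh: "lines_le (hook G) (length u) (v @ u)"
  shows "length v < length u" "\<forall>t\<in>set v. \<not> G t (hd u)"
proof -
  have not_G: "\<not> G t (hd u)" if t: "t \<in> set v" for t
  proof
    assume G: "G t (hd u)"
    obtain A B where AB: "u = A @ B" "sorted_wrt G A" "sorted_wrt (\<lambda>a b. \<not> G a b) B" "A \<noteq> []"
      using hook_canonical[OF u] by metis
    then have "sorted_wrt G (t # A)" using G trans_pos[of t "hd u"] by (cases A) auto
    then have "hook G (t # u)" using hookI[of G "t # A" B] AB by simp
    moreover have "subseq ([t] @ u) (v @ u)"
      using t by (intro list_emb_append_mono) (auto simp: subseq_singleton_left)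
    ultimately show False using sh by (auto simp: lines_le_def)
  qed
  then show "\<forall>t\<in>set v. \<not> G t (hd u)" by blast
  obtain A B where AB: "v = A @ B" "sorted_wrt G A" "sorted_wrt (\<lambda>a b. \<not> G a b) B"
    using v by (auto simp: hook_def)
  then have "hook G (A @ B @ [hd u])" using not_G by (intro hookI) (auto simp: sorted_wrt_append)
  moreover have "subseq (v @ [hd u]) (v @ u)"
    using u(2) by (intro list_emb_append_mono) (auto simp: subseq_singleton_left)
  ultimately show "length v < length u" using sh AB by (force simp: lines_le_def)
qed

end

lemma hook_unbump_ex:
  assumes "tie G" "hook G C'" "\<not> hook G (y # C')"
  shows "\<exists>C x. hook_bump G C x C' y"
proof -
  obtain C x where "hook_bump (\<lambda>a b. \<not> G b a) (rev C') y C x"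
    using tie.hook_bump_ex[OF tie_dual[OF assms(1)], of "rev C'" y] assms(2,3)
      hook_rev[of G C'] hook_rev[of G "y # C'"] by auto
  then show ?thesis using hook_bump_rev[of G C' y "rev C" x] by auto
qed

lemma hook_unbump_fun:
  assumes "tie G" "hook_bump G C x C' y" "hook_bump G D z C' y"
  shows "C = D \<and> x = z"
  using tie.hook_bump_fun[OF tie_dual[OF assms(1)], of "rev C'" y "rev C" x "rev D" z]
    assms(2,3) by (simp add: hook_bump_rev)

lemma hook_bump_not_Cons:
  assumes "tie G" "hook_bump G C x C' y"
  shows "\<not> hook G (y # C')"
  using tie.hook_bump_hooks[OF tie_dual[OF assms(1)], of "rev C'" y "rev C" x] assms(2)
    hook_rev[of G "y # C'"] by (simp add: hook_bump_rev)

lemma hook_bump_lines_le_iff: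
  assumes "tie G" "hook_bump G C x C' y"
  shows "lines_le (hook G) n (p @ C @ x # q) \<longleftrightarrow> lines_le (hook G) n (p @ y # C' @ q)"
  using tie.hook_bump_lines_le[OF assms, of n p q]
    tie.hook_bump_lines_le[OF tie_dual[OF assms(1)], of "rev C'" y "rev C" x n "rev q" "rev p"]
    lines_le_hook_rev[of G n "p @ C @ x # q"] lines_le_hook_rev[of G n "p @ y # C' @ q"] assms(2)
  by (auto simp: hook_bump_rev)

lemma hook_lines_le_Cons:
  assumes "tie G" "hook G C2" "\<not> hook G (y # C2)" "lines_le (hook G) n (C2 @ C1)"
  shows "lines_le (hook G) n (y # C2 @ C1)"
  using tie.hook_lines_le_append[OF tie_dual[OF assms(1)], of "rev C2" y n "rev C1"]
    lines_le_hook_rev[of G n "C2 @ C1"] lines_le_hook_rev[of G n "y # C2 @ C1"] assms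
    hook_rev[of G "y # C2"] hook_rev[of G C2]
  by auto

section \<open>The insertions of the three cases\<close>

text \<open>
  The order of two letters in a column, where \<open>b\<close> says which letters may not be repeated. With all
  letters barred, this is the strict order of the columns in the case \<open>gl(n)\<close>.
\<close>

definition column_rel :: "(letter \<Rightarrow> bool) \<Rightarrow> letter \<Rightarrow> letter \<Rightarrow> bool" where
  "column_rel b x y \<longleftrightarrow> x < y \<or> x = y \<and> \<not> b x"

lemma tie_column_rel: "tie (column_rel b)"
  by unfold_locales (auto simp: column_rel_def)

lemma tie_ge: "tie ((\<ge>) :: letter \<Rightarrow> letter \<Rightarrow> bool)"
  by unfold_locales auto

lemma column_insertion:
  assumes G: "tie G"
    and ins_Nil: "\<And>x. ins x [] = [[x]]"
    and ins_append: "\<And>C Cs x. C \<noteq> [] \<Longrightarrow> sorted_wrt G (C @ [x]) \<Longrightarrow> ins x (C # Cs) = (C @ [x]) # Cs"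
    and ins_bump: "\<And>C Cs x C' y. column_bump G C x C' y \<Longrightarrow> ins x (C # Cs) = C' # ins y Cs"
  shows "insertion (sorted_wrt G) (column_bump G) (\<lambda>a b. b \<le> a) ins"
proof unfold_locales
  fix C x C' y assume bump: "column_bump G C x C' y"
  have "\<not> sorted_wrt G (y # C')" using bump by (auto simp: column_bump_def)
  then show "sorted_wrt G C \<and> \<not> sorted_wrt G (C @ [x]) \<and> sorted_wrt G C' \<and> \<not> sorted_wrt G (y # C')"
    using bump tie.column_bump_not_line[OF G bump] by (auto simp: column_bump_def)
next
  fix u v assume "sorted_wrt G v" "lines_le (sorted_wrt G) (length u) (v @ u)"
  then show "length v \<le> length u" by (auto simp: lines_le_def)
next
  fix C x C' y assume "column_bump G C x C' y"
  then show "mset (C @ [x]) = mset (y # C')" by (auto simp: column_bump_def)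
next
  fix x show "sorted_wrt G [x]" by simp
qed (rule sorted_wrt_subseq column_unbump_ex[OF G] tie.column_bump_ex[OF G]
    column_bump_lines_le_iff[OF G] tie.column_lines_le_append[OF G] column_lines_le_Cons[OF G]
    tie.column_lines_le_butlast[OF G] column_unbump_fun[OF G] ins_Nil ins_append ins_bump; assumption)+

lemma hook_insertion:
  assumes G: "tie G"
    and ins_Nil: "\<And>x. ins x [] = [[x]]"
    and ins_append: "\<And>C Cs x. C \<noteq> [] \<Longrightarrow> hook G (C @ [x]) \<Longrightarrow> ins x (C # Cs) = (C @ [x]) # Cs"
    and ins_bump: "\<And>C Cs x C' y. hook_bump G C x C' y \<Longrightarrow> ins x (C # Cs) = C' # ins y Cs"
  shows "insertion (hook G) (hook_bump G) (\<lambda>a b. b < a) ins"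
proof unfold_locales
  fix C x C' y assume bump: "hook_bump G C x C' y"
  show "hook G C \<and> \<not> hook G (C @ [x]) \<and> hook G C' \<and> \<not> hook G (y # C')"
    using tie.hook_bump_hooks[OF G bump] hook_bump_not_Cons[OF G bump] by blast
  show "mset (C @ [x]) = mset (y # C')" using bump by (auto simp: hook_bump_def)
next
  fix x show "hook G [x]" using hookI[of G "[x]" "[]"] by simp
qed (rule hook_subseq hook_unbump_ex[OF G] tie.hook_bump_ex[OF G]
    hook_bump_lines_le_iff[OF G] tie.hook_lines_le_append[OF G] hook_lines_le_Cons[OF G]
    tie.hook_lines_le_butlast[OF G] tie.hook_adjacent_length(1)[OF G] hook_unbump_fun[OF G]
    ins_Nil ins_append ins_bump; assumption)+

lemma replace_first_append: "y \<notin> set P \<Longrightarrow> replace_first y x (P @ y # Q) = P @ x # Q"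
  by (induction P) auto

text \<open>
  The letters of the column that \<open>x\<close> cannot follow form its end segment from \<open>y\<close> on, and \<open>y\<close> is the smallest
  of them.
\<close>

lemma column_bump_eq:
  assumes "column_bump (column_rel b) C x C' y"
  shows "y \<in> set C" "\<not> column_rel b y x" "y = Min {t \<in> set C. \<not> column_rel b t x}"
    "replace_first y x C = C'"
proof -
  obtain P Q where *: "C = P @ y # Q" "C' = P @ x # Q" "sorted_wrt (column_rel b) C"
    "sorted_wrt (column_rel b) C'" "\<not> column_rel b y x"
    using assms by (auto simp: column_bump_def)
  have P: "column_rel b t x" if "t \<in> set P" for t using that * by (auto simp: sorted_wrt_append)
  have Q: "column_rel b y t" if "t \<in> set Q" for t using that * by (auto simp: sorted_wrt_append)
  have Q': "y \<le> t" if "t \<in> set Q" for t using Q[OF that] by (auto simp: column_rel_def)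
  show "y \<in> set C" "\<not> column_rel b y x" using * by auto
  show "y = Min {t \<in> set C. \<not> column_rel b t x}"
    by (rule Min_eqI[symmetric]) (use * P Q' in auto)
  show "replace_first y x C = C'"
    using * P by (auto intro!: replace_first_append)
qed

lemma insertion_Gl:
  "insertion (sorted_wrt (column_rel (\<lambda>_. True))) (column_bump (column_rel (\<lambda>_. True)))
     (\<lambda>a b. b \<le> a) insert_Gl"
proof (rule column_insertion[OF tie_column_rel])
  fix C :: "letter list" and Cs x
  assume "sorted_wrt (column_rel (\<lambda>_. True)) (C @ [x])"
  then show "insert_Gl x (C # Cs) = (C @ [x]) # Cs"
    by (simp add: sorted_wrt_append column_rel_def)
next
  fix C Cs x C' y
  assume "column_bump (column_rel (\<lambda>_. True)) C x C' y"
  from column_bump_eq[OF this] show "insert_Gl x (C # Cs) = C' # insert_Gl y Cs"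
    by (auto simp: column_rel_def not_less Let_def)
qed simp

lemma insertion_GlSuper:
  "insertion (sorted_wrt (column_rel barred)) (column_bump (column_rel barred))
     (\<lambda>a b. b \<le> a) insert_GlSuper"
proof (rule column_insertion[OF tie_column_rel])
  fix C :: "letter list" and Cs x
  assume "sorted_wrt (column_rel barred) (C @ [x])"
  then show "insert_GlSuper x (C # Cs) = (C @ [x]) # Cs"
    by (auto simp: sorted_wrt_append column_rel_def)
next
  fix C Cs x C' y
  assume "column_bump (column_rel barred) C x C' y"
  note * = column_bump_eq[OF this]
  have "{t \<in> set C. \<not> column_rel barred t x} = (if barred x then {t \<in> set C. x \<le> t} else {t \<in> set C. x < t})"
    by (auto simp: column_rel_def)
  with * show "insert_GlSuper x (C # Cs) = C' # insert_GlSuper y Cs"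
    by (auto simp: column_rel_def not_less Let_def split: if_splits)
qed simp

abbreviation hook_int :: "letter list \<Rightarrow> bool" where
  "hook_int \<equiv> hook (\<ge>)"

lemma hook_at_unique:
  assumes "hook_at k w" "hook_at l w"
  shows "k = l"
proof -
  have "\<not> k < l" if k: "hook_at k w" and l: "hook_at l w" for k l
  proof
    assume "k < l"
    have "w ! (k - 1) \<ge> w ! k"
      using sorted_wrt_nth_less[of "(\<ge>)" "take l w" "k - 1" k] k l \<open>k < l\<close> by (auto simp: hook_at_def)
    moreover have "w ! (k - 1) < w ! k"
      using sorted_wrt_nth_less[of "(<)" "drop (k - 1) w" 0 1] k l \<open>k < l\<close> by (auto simp: hook_at_def)
    ultimately show False by simp
  qed
  from this[of k l] this[of l k] assms show ?thesis by auto
qed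

lemma hook_at_append:
  assumes "sorted_wrt (\<ge>) A" "sorted_wrt (<) B" "A \<noteq> []" "B \<noteq> [] \<Longrightarrow> last A < hd B"
  shows "hook_at (length A) (A @ B)"
proof -
  obtain A' a where A: "A = A' @ [a]" using assms(3) by (metis rev_exhaust)
  have "sorted_wrt (<) (a # B)" using assms(2,4) A by (cases B) auto
  then show ?thesis using assms A by (simp add: hook_at_def)
qed

lemma hook_parts:
  assumes "sorted_wrt (\<ge>) A" "sorted_wrt (<) B" "A \<noteq> []" "B \<noteq> [] \<Longrightarrow> last A < hd B"
  shows "down_part (A @ B) = A" "up_part (A @ B) = B"
proof -
  have "(THE k. hook_at k (A @ B)) = length A"
    using hook_at_append[OF assms] hook_at_unique by blast
  then show "down_part (A @ B) = A" "up_part (A @ B) = B"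
    by (simp_all add: down_part_def up_part_def)
qed

lemma hook_int_canonical:
  assumes "hook_int w" "w \<noteq> []"
  obtains A B where "w = A @ B" "sorted_wrt (\<ge>) A" "sorted_wrt (<) B" "A \<noteq> []"
    "B \<noteq> [] \<Longrightarrow> last A < hd B"
  using tie.hook_canonical[OF tie_ge assms] unfolding not_le by metis

lemma hook_word_iff: "hook_word w \<longleftrightarrow> w \<noteq> [] \<and> hook_int w"
proof
  assume "hook_word w"
  then obtain k where k: "hook_at k w" by (auto simp: hook_word_def)
  have "sorted_wrt (<) (drop 1 (drop (k - 1) w))"
    using k sorted_wrt_drop[of "(<)" "drop (k - 1) w" 1] by (simp add: hook_at_def)
  then have "hook_int (take k w @ drop k w)"
    using k by (intro hookI) (auto simp: hook_at_def not_le)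
  then show "w \<noteq> [] \<and> hook_int w" using k by (auto simp: hook_at_def)
next
  assume "w \<noteq> [] \<and> hook_int w"
  then show "hook_word w" using hook_int_canonical[of w] hook_at_append unfolding hook_word_def by metis
qed

text \<open>
  The rule splits the row at its turning point, and \<open>hook_bump_of_split\<close> finds a bump with this split.
  By \<open>hook_bump_fun\<close> it is the given one.
\<close>

lemma insert_Queer_bump:
  assumes "hook_bump (\<ge>) L x L' z"
  shows "insert_Queer x (L # Ls) = L' # insert_Queer z Ls"
proof -
  note hooks = tie.hook_bump_hooks[OF tie_ge assms]
  have "L \<noteq> []" using assms by (auto simp: hook_bump_def)
  then obtain A B where AB: "L = A @ B" "sorted_wrt (\<ge>) A" "sorted_wrt (<) B" "A \<noteq> []"
    "B \<noteq> [] \<Longrightarrow> last A < hd B"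
    using hook_int_canonical hooks by metis
  have B: "B \<noteq> []" "x \<le> last B"
    using tie.hook_no_snoc[OF tie_ge AB(2), of B x] hooks AB by (auto simp: not_le)
  obtain D1 v D2 U1 y U2 where *: "A = D1 @ v # D2" "B = U1 @ y # U2"
    "\<forall>u\<in>set U1. u < x" "x \<le> y" "\<forall>d\<in>set D1. y \<le> d" "v < y"
    "hook_bump (\<ge>) (A @ B) x (D1 @ y # D2 @ U1 @ x # U2) v"
    using tie.hook_bump_of_split[OF tie_ge AB(2,4), of B x] AB B unfolding not_le by metis
  have L': "L' = D1 @ y # D2 @ U1 @ x # U2" "z = v"
    using tie.hook_bump_fun[OF tie_ge assms] *(7) AB(1) by auto
  have y: "Min {t \<in> set B. x \<le> t} = y"
    by (rule Min_eqI) (use *(2,3,4) AB(3) in \<open>auto simp: sorted_wrt_append\<close>)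
  have z: "Max {t \<in> set A. t < y} = z"
    by (rule Max_eqI) (use *(1,5,6) L' AB(2) in \<open>auto simp: sorted_wrt_append\<close>)
  have "replace_first y x B = U1 @ x # U2" "replace_first z y A = D1 @ y # D2"
    using *(1-6) L' by (auto intro!: replace_first_append)
  moreover have "\<not> hook_word (L @ [x])" using hooks by (simp add: hook_word_iff)
  ultimately show ?thesis
    using hook_parts[OF AB(2,3,4,5)] y z L' AB(1) by (simp add: Let_def)
qed

lemma insertion_Queer: "insertion hook_int (hook_bump (\<ge>)) (\<lambda>a b. b < a) insert_Queer"
proof (rule hook_insertion[OF tie_ge])
  show "insert_Queer x (C # Cs) = C' # insert_Queer y Cs" if "hook_bump (\<ge>) C x C' y" for C Cs x C' y
    using insert_Queer_bump[OF that] .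
qed (simp_all add: hook_word_iff)

fun line_of :: "diamond \<Rightarrow> letter list \<Rightarrow> bool" where
  "line_of (Gl n) = sorted_wrt (column_rel (\<lambda>_. True))"
| "line_of (GlSuper m n) = sorted_wrt (column_rel barred)"
| "line_of (Queer n) = hook_int"

fun bump_of :: "diamond \<Rightarrow> letter list \<Rightarrow> letter \<Rightarrow> letter list \<Rightarrow> letter \<Rightarrow> bool" where
  "bump_of (Gl n) = column_bump (column_rel (\<lambda>_. True))"
| "bump_of (GlSuper m n) = column_bump (column_rel barred)"
| "bump_of (Queer n) = hook_bump (\<ge>)"

fun bound_of :: "diamond \<Rightarrow> nat \<Rightarrow> nat \<Rightarrow> bool" where
  "bound_of (Queer n) = (\<lambda>a b. b < a)"
| "bound_of _ = (\<lambda>a b. b \<le> a)"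

lemma insertion_diamond: "insertion (line_of d) (bump_of d) (bound_of d) (insert_letter d)"
  using insertion_Gl insertion_GlSuper insertion_Queer by (cases d) simp_all

section \<open>Boxes of a filling\<close>

text \<open>
  Extension by zeros, which turns lists of positive lengths injectively into functions.
\<close>

definition part_at :: "nat list \<Rightarrow> nat \<Rightarrow> nat" where
  "part_at ks l = (if l < length ks then ks ! l else 0)"

lemma part_at_eq_0_iff:
  assumes "0 \<notin> set ks"
  shows "part_at ks l = 0 \<longleftrightarrow> length ks \<le> l"
proof -
  have "ks ! l \<noteq> 0" if "l < length ks" using nth_mem[OF that] assms by metis
  then show ?thesis by (auto simp: part_at_def)
qed

lemma part_at_inj:
  assumes "0 \<notin> set ks" "0 \<notin> set ks'" "part_at ks = part_at ks'"
  shows "ks = ks'"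
proof -
  have len_eq: "length ks = length ks'"
    using part_at_eq_0_iff[OF assms(1)] part_at_eq_0_iff[OF assms(2)] assms(3) by (metis nle_le)
  show ?thesis
  proof (rule nth_equalityI[OF len_eq])
    show "ks ! i = ks' ! i" if "i < length ks" for i
      using fun_cong[OF assms(3), of i] that len_eq by (simp add: part_at_def)
  qed
qed

lemma part_at_grow: "k \<le> length ks \<Longrightarrow> part_at (grow ks k) = (part_at ks)(k := Suc (part_at ks k))"
  by (auto simp: part_at_def grow_def fun_eq_iff nth_append)

definition line_boxes :: "nat list \<Rightarrow> (nat \<times> nat) set" where
  "line_boxes ks = {(l, q). q < part_at ks l}"

lemma line_boxes_inj: "0 \<notin> set ks \<Longrightarrow> 0 \<notin> set ks' \<Longrightarrow> line_boxes ks = line_boxes ks' \<Longrightarrow> ks = ks'"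
proof (rule part_at_inj)
  assume "line_boxes ks = line_boxes ks'"
  then have "\<And>l q. q < part_at ks l \<longleftrightarrow> q < part_at ks' l" by (auto simp: line_boxes_def)
  then show "part_at ks = part_at ks'" by (metis linorder_neqE_nat less_irrefl ext)
qed

lemma line_boxes_grow:
  assumes "k \<le> length ks"
  shows "line_boxes (grow ks k) = insert (k, part_at ks k) (line_boxes ks)" "(k, part_at ks k) \<notin> line_boxes ks"
  using part_at_grow[OF assms] by (auto simp: line_boxes_def split: if_splits)

text \<open>
  One added box raises one length by one. It cannot open a line beyond the first
  empty one, because all lengths in \<open>ks'\<close> are positive.
\<close>

lemma line_boxes_insert_imp_grow:
  assumes pos: "0 \<notin> set ks" "0 \<notin> set ks'" and b: "b \<notin> line_boxes ks" "line_boxes ks' = insert b (line_boxes ks)"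
  obtains k where "k \<le> length ks" "ks' = grow ks k"
proof -
  obtain l q where lq: "b = (l, q)" by (cases b)
  have mem: "j < part_at ks' i \<longleftrightarrow> i = l \<and> j = q \<or> j < part_at ks i" for i j
    using b(2) lq by (auto simp: line_boxes_def set_eq_iff)
  have other: "part_at ks' i = part_at ks i" if "i \<noteq> l" for i
    using mem[of _ i] that by (metis linorder_neqE_nat less_irrefl)
  have "{..<part_at ks' l} = insert q {..<part_at ks l}" using mem[of _ l] by auto
  moreover have "q \<notin> {..<part_at ks l}" using b(1) lq by (auto simp: line_boxes_def)
  ultimately have "card {..<part_at ks' l} = Suc (card {..<part_at ks l})"
    by (metis card_insert_disjoint finite_lessThan)
  then have same: "part_at ks' l = Suc (part_at ks l)" by simp
  have "l \<le> length ks"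
  proof (rule ccontr)
    assume l: "\<not> ?thesis"
    then have "part_at ks' (length ks) = 0" using other[of "length ks"] by (simp add: part_at_def)
    then have "length ks' \<le> length ks" using part_at_eq_0_iff[OF pos(2)] by simp
    then show False using same l by (simp add: part_at_def split: if_splits)
  qed
  moreover from this have "part_at ks' = part_at (grow ks l)"
    using other same by (auto simp: part_at_grow)
  then have "ks' = grow ks l"
    by (intro part_at_inj[OF pos(2)]) (use pos(1) in \<open>auto simp: grow_def dest: set_update_subset_insert[THEN subsetD]\<close>)
  ultimately show thesis using that by blast
qed

text \<open>
  Coordinates (line, position in the line) turned into (row, column).
\<close>

fun box_map :: "diamond \<Rightarrow> nat \<times> nat \<Rightarrow> nat \<times> nat" where
  "box_map (Queer n) (l, q) = (l, l + q)"
| "box_map _ (l, q) = (q, l)"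

lemma inj_box_map: "inj (box_map d)"
  by (cases d) (auto intro!: injI)

lemma cells_eq: "cells d T = box_map d ` line_boxes (map length T)"
proof (cases d)
  case (Queer n)
  have "(i, j) \<in> box_map d ` line_boxes (map length T)" if "i < length T" "i \<le> j" "j < i + length (T ! i)" for i j
    using that Queer by (intro image_eqI[of _ _ "(i, j - i)"]) (auto simp: line_boxes_def part_at_def)
  then show ?thesis using Queer by (auto simp: line_boxes_def part_at_def split: if_splits)
qed (auto simp: line_boxes_def part_at_def image_iff split: if_splits)

lemma cells_inj:
  "[] \<notin> set T \<Longrightarrow> [] \<notin> set U \<Longrightarrow> cells d T = cells d U \<Longrightarrow> map length T = map length U"
  unfolding cells_eq inj_image_eq_iff[OF inj_box_map]
  by (rule line_boxes_inj) auto

section \<open>Insertion on fillings with given line_boxes\<close>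

definition letter_tableaux :: "diamond \<Rightarrow> filling set" where
  "letter_tableaux d = {T. line_tableau (line_of d) T \<and> set (concat T) \<subseteq> alphabet d}"

lemma shape_cells: "cells d T = diagram d la \<Longrightarrow> shape d T = la"
proof -
  assume "cells d T = diagram d la"
  moreover have "{j. i \<le> j \<and> j < i + la i} = {i..<i + la i}" for i by auto
  ultimately show "shape d T = la" by (cases d) (auto simp: shape_def fun_eq_iff)
qed

lemma insert_letter_tableaux:
  assumes "T \<in> letter_tableaux d" "x \<in> alphabet d"
  shows "insert_letter d x T \<in> letter_tableaux d"
    "\<exists>b. b \<notin> cells d T \<and> cells d (insert_letter d x T) = insert b (cells d T)"
    "mset (concat (insert_letter d x T)) = add_mset x (mset (concat T))"
proof -
  interpret insertion "line_of d" "bump_of d" "bound_of d" "insert_letter d" by (rule insertion_diamond)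
  have T: "line_tableau (line_of d) T" using assms by (simp add: letter_tableaux_def)
  show m: "mset (concat (insert_letter d x T)) = add_mset x (mset (concat T))" using mset_ins[OF T] .
  have "set (concat (insert_letter d x T)) = insert x (set (concat T))"
    using arg_cong[OF m, of set_mset] by simp
  then show "insert_letter d x T \<in> letter_tableaux d"
    using line_tableau_ins[OF T] assms by (auto simp: letter_tableaux_def)
  obtain k where k: "k \<le> length T" "map length (insert_letter d x T) = grow (map length T) k"
    using lengths_ins[OF T] by blast
  show "\<exists>b. b \<notin> cells d T \<and> cells d (insert_letter d x T) = insert b (cells d T)"
    unfolding cells_eq k(2)
    using line_boxes_grow[of k "map length T"] k(1) inj_box_map[of d]
    by (intro exI[of _ "box_map d (k, part_at (map length T) k)"]) (auto simp: inj_image_mem_iff)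
qed

lemma insert_letter_tableaux_inj:
  assumes "T \<in> letter_tableaux d" "U \<in> letter_tableaux d" "cells d T = cells d U"
    "insert_letter d x T = insert_letter d y U"
  shows "T = U \<and> x = y"
proof -
  interpret insertion "line_of d" "bump_of d" "bound_of d" "insert_letter d" by (rule insertion_diamond)
  have "map length T = map length U"
    using assms by (intro cells_inj[of _ _ d]) (auto simp: letter_tableaux_def line_tableau_def)
  then show ?thesis using assms ins_inj by (auto simp: letter_tableaux_def)
qed

lemma insert_letter_tableaux_surj:
  assumes T': "T' \<in> letter_tableaux d" and S: "S \<in> letter_tableaux d" and b: "b \<notin> cells d S" "cells d T' = insert b (cells d S)"
  obtains T x where "T \<in> letter_tableaux d" "x \<in> alphabet d" "cells d T = cells d S" "insert_letter d x T = T'"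
proof -
  interpret insertion "line_of d" "bump_of d" "bound_of d" "insert_letter d" by (rule insertion_diamond)
  have pos: "0 \<notin> set (map length S)" "0 \<notin> set (map length T')"
    using S T' by (auto simp: letter_tableaux_def line_tableau_def)
  have "b \<in> range (box_map d)" using b(2) unfolding cells_eq by auto
  then obtain c where c: "b = box_map d c" by blast
  have "c \<notin> line_boxes (map length S)" using b(1) c unfolding cells_eq by auto
  moreover have "line_boxes (map length T') = insert c (line_boxes (map length S))"
    using b(2) c inj_image_eq_iff[OF inj_box_map, of d "line_boxes (map length T')" "insert c (line_boxes (map length S))"]
    unfolding cells_eq by simp
  ultimately obtain k where k: "k \<le> length (map length S)" "map length T' = grow (map length S) k"
    using line_boxes_insert_imp_grow[OF pos] by blast
  obtain T x where T: "line_tableau (line_of d) T" "map length T = map length S" "insert_letter d x T = T'"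
    using ins_surj[OF _ _ k] T' S line_tableau_lengths by (auto simp: letter_tableaux_def)
  have "set (concat T') = insert x (set (concat T))"
    using arg_cong[OF mset_ins[OF T(1), of x], of set_mset] T(3) by simp
  then have "x \<in> alphabet d" "T \<in> letter_tableaux d" using T' T(1) by (auto simp: letter_tableaux_def)
  then show thesis using that T by (simp add: cells_eq)
qed

section \<open>Tableau conditions in terms of adjacent lines\<close>

text \<open>
  If the letters in row \<open>i\<close> are in the wrong order, then the first \<open>i + 1\<close> letters of \<open>v\<close> followed by \<open>u\<close>
  from row \<open>i\<close> on form a chain longer than \<open>u\<close>. Conversely, in a chain longer than \<open>u\<close> with \<open>a + 1\<close>
  letters from \<open>v\<close>, the last of these is in row \<open>a\<close> or below and the first letter from \<open>u\<close> is in
  row \<open>a\<close> or above, so the letters in row \<open>a\<close> are in the wrong order.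
\<close>

lemma column_adjacent_iff:
  assumes "tie G" "sorted_wrt G u" "sorted_wrt G v"
  shows "adjacent_ok (sorted_wrt G) u v \<longleftrightarrow>
     length v \<le> length u \<and> (\<forall>i<length v. \<not> G (v ! i) (u ! i))"
proof -
  interpret tie G by fact
  show ?thesis
  proof
    assume adjacent_ok: "adjacent_ok (sorted_wrt G) u v"
    have "length v \<le> length u" using adjacent_ok assms(3) by (auto simp: adjacent_ok_def lines_le_def)
    moreover have "\<not> G (v ! i) (u ! i)" if i: "i < length v" for i
    proof
      assume G: "G (v ! i) (u ! i)"
      have iu: "i < length u" using i calculation by simp
      have "sorted_wrt G ((v ! i) # drop i u)"
      proof -
        have "drop i u = u ! i # drop (Suc i) u" using iu by (simp add: Cons_nth_drop_Suc)
        moreover have "sorted_wrt G (drop i u)" using assms(2) by (simp add: sorted_wrt_drop)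
        ultimately show ?thesis using G trans_pos[of "v ! i" "u ! i"] by auto
      qed
      moreover have "sorted_wrt G (take i v @ [v ! i])"
        using assms(3) i by (metis sorted_wrt_take take_Suc_conv_app_nth)
      ultimately have "sorted_wrt G (take i v @ (v ! i) # drop i u)"
        using trans_pos[of _ "v ! i"] by (auto simp: sorted_wrt_append)
      moreover have "subseq ((take i v @ [v ! i]) @ drop i u) (v @ u)"
        using i by (intro list_emb_append_mono)
          (auto simp flip: take_Suc_conv_app_nth intro: prefix_imp_subseq suffix_imp_subseq
            take_is_prefix suffix_drop)
      ultimately have "length (take i v @ (v ! i) # drop i u) \<le> length u"
        using adjacent_ok by (auto simp: adjacent_ok_def lines_le_def)
      then show False using i iu by simp
    qed
    ultimately show "length v \<le> length u \<and> (\<forall>i<length v. \<not> G (v ! i) (u ! i))" by blast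
  next
    assume r: "length v \<le> length u \<and> (\<forall>i<length v. \<not> G (v ! i) (u ! i))"
    show "adjacent_ok (sorted_wrt G) u v"
      unfolding adjacent_ok_def lines_le_def
    proof (intro allI impI, elim conjE)
      fix s assume s: "subseq s (v @ u)" "sorted_wrt G s"
      obtain sv su where sv: "s = sv @ su" "subseq sv v" "subseq su u"
        using s(1) by (rule subseq_append2E)
      show "length s \<le> length u"
      proof (rule ccontr)
        assume long: "\<not> ?thesis"
        have len: "length sv \<le> length v" "length su \<le> length u"
          using sv list_emb_length by blast+
        have ne: "sv \<noteq> []" "su \<noteq> []" using long len r sv(1) by auto
        define a where "a = length sv - 1"
        have a: "a < length v" using ne len unfolding a_def by (cases sv) auto
        \<comment> \<open>The last letter of \<open>sv\<close> is in row \<open>a\<close> or below, the first one of \<open>su\<close> in row \<open>a\<close> or above.\<close>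
        have 1: "last sv \<in> set (drop a v)"
        proof (rule ccontr)
          assume no: "\<not> ?thesis"
          have "subseq sv (take a v @ drop a v)" using sv(2) by simp
          then obtain s1 s2 where s12: "sv = s1 @ s2" "subseq s1 (take a v)" "subseq s2 (drop a v)"
            by (rule subseq_append2E)
          have "s2 = []" using no s12 subseq_set[OF s12(3)] by (cases s2 rule: rev_cases) auto
          then have "length sv \<le> a" using list_emb_length[OF s12(2)] s12(1) by simp
          then show False using ne by (cases sv) (auto simp: a_def)
        qed
        have 2: "hd su \<in> set (take (Suc a) u)"
        proof (rule ccontr)
          assume no: "\<not> ?thesis"
          have "subseq su (take (Suc a) u @ drop (Suc a) u)" using sv(3) by simp
          then obtain s1 s2 where s12: "su = s1 @ s2" "subseq s1 (take (Suc a) u)" "subseq s2 (drop (Suc a) u)"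
            by (rule subseq_append2E)
          have "s1 = []" using no s12 subseq_set[OF s12(2)] by (cases s1) auto
          then have "length su \<le> length u - Suc a" using list_emb_length[OF s12(3)] s12(1) by simp
          then show False using ne a r long sv(1) by (cases sv) (auto simp: a_def)
        qed
        obtain i where i: "last sv = v ! i" "a \<le> i" "i < length v"
          using 1 by (auto simp: in_set_conv_nth)
            (metis add.commute le_add1 less_diff_conv)
        obtain j where j: "hd su = u ! j" "j \<le> a" "j < length u"
          using 2 that by (auto simp: in_set_conv_nth less_Suc_eq_le) metis
        have "G (last sv) (hd su)"
          using s(2) sv(1) ne by (simp add: sorted_wrt_append)
        then have "G (v ! i) (u ! j)" using i j by simp
        moreover have "a = i \<or> G (v ! a) (v ! i)"
          using assms(3) i by (cases "a = i") (auto intro: sorted_wrt_nth_less)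
        moreover have "j = a \<or> G (u ! j) (u ! a)"
          using assms(2) j a r by (cases "j = a") (auto intro: sorted_wrt_nth_less)
        ultimately have "G (v ! a) (u ! a)" using trans_pos by metis
        then show False using r a by blast
      qed
    qed
  qed
qed

definition row_le :: "('a \<Rightarrow> 'a \<Rightarrow> bool) \<Rightarrow> 'a list \<Rightarrow> 'a list \<Rightarrow> bool" where
  "row_le G u v \<longleftrightarrow> length v \<le> length u \<and> (\<forall>i<length v. \<not> G (v ! i) (u ! i))"

lemma transp_row_le: "tie G \<Longrightarrow> transp (row_le G)"
proof (rule transpI)
  fix u v w assume "tie G" and uv: "row_le G u v" "row_le G v w"
  interpret tie G by fact
  show "row_le G u w"
    unfolding row_le_def
  proof (intro conjI allI impI)
    show "length w \<le> length u" using uv by (simp add: row_le_def)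
    fix i assume "i < length w"
    then have "\<not> G (w ! i) (v ! i)" "\<not> G (v ! i) (u ! i)" using uv by (auto simp: row_le_def)
    then show "\<not> G (w ! i) (u ! i)" by (rule trans_neg)
  qed
qed

lemma column_line_tableau_iff:
  assumes "tie G"
  shows "line_tableau (sorted_wrt G) T \<longleftrightarrow>
    [] \<notin> set T \<and> (\<forall>C\<in>set T. sorted_wrt G C) \<and> sorted_wrt (row_le G) T"
proof -
  have "successively (adjacent_ok (sorted_wrt G)) T \<longleftrightarrow> successively (row_le G) T"
    if "\<forall>C\<in>set T. sorted_wrt G C"
    by (rule successively_cong) (use that column_adjacent_iff[OF assms] in \<open>auto simp: row_le_def\<close>)
  then show ?thesis
    unfolding line_tableau_def successively_conv_sorted_wrt[OF transp_row_le[OF assms], symmetric] by blast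
qed

text \<open>
  The diagram makes the lengths of the columns decrease, and transitivity reduces all pairs of columns to
  comparisons of columns as a whole.
\<close>

lemma column_filling_iff:
  assumes G: "tie G" and C: "C = {(i, j). j < length T \<and> i < length (T ! j)}" "C = {(i, j). j < la i}"
  shows "(\<forall>i j j'. (i, j) \<in> C \<and> (i, j') \<in> C \<and> j < j' \<longrightarrow> \<not> G (T ! j' ! i) (T ! j ! i)) \<and>
     (\<forall>i i' j. (i, j) \<in> C \<and> (i', j) \<in> C \<and> i < i' \<longrightarrow> G (T ! j ! i) (T ! j ! i')) \<longleftrightarrow>
     (\<forall>K\<in>set T. sorted_wrt G K) \<and> sorted_wrt (row_le G) T"
proof -
  have left: "(i, j) \<in> C" if "(i, j') \<in> C" "j < j'" for i j j'
    using that C(2) by auto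
  have len: "length (T ! j') \<le> length (T ! j)" if "j < j'" "j' < length T" for j j'
  proof (rule ccontr)
    assume "\<not> ?thesis"
    then have "(length (T ! j), j') \<in> C" using that C(1) by auto
    then have "(length (T ! j), j) \<in> C" using left that by blast
    then show False using C(1) by simp
  qed
  have "(\<forall>i j j'. (i, j) \<in> C \<and> (i, j') \<in> C \<and> j < j' \<longrightarrow> \<not> G (T ! j' ! i) (T ! j ! i)) \<longleftrightarrow>
      sorted_wrt (row_le G) T"
    unfolding sorted_wrt_iff_nth_less row_le_def
  proof (intro iffI allI impI conjI)
    fix j j' i
    assume *: "\<forall>i j j'. (i, j) \<in> C \<and> (i, j') \<in> C \<and> j < j' \<longrightarrow> \<not> G (T ! j' ! i) (T ! j ! i)"
      and j: "j < j'" "j' < length T"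
    show "length (T ! j') \<le> length (T ! j)" using len j .
    assume i: "i < length (T ! j')"
    then have "(i, j') \<in> C" using j C(1) by simp
    then show "\<not> G (T ! j' ! i) (T ! j ! i)" using * left j by blast
  next
    fix i j j'
    assume *: "\<forall>i j. i < j \<longrightarrow> j < length T \<longrightarrow>
        length (T ! j) \<le> length (T ! i) \<and> (\<forall>k<length (T ! j). \<not> G (T ! j ! k) (T ! i ! k))"
      and j: "(i, j) \<in> C \<and> (i, j') \<in> C \<and> j < j'"
    then have "j' < length T" "i < length (T ! j')" using C(1) by auto
    then show "\<not> G (T ! j' ! i) (T ! j ! i)" using * j by blast
  qed
  moreover have "(\<forall>i i' j. (i, j) \<in> C \<and> (i', j) \<in> C \<and> i < i' \<longrightarrow> G (T ! j ! i) (T ! j ! i')) \<longleftrightarrow>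
      (\<forall>K\<in>set T. sorted_wrt G K)"
    unfolding C(1) sorted_wrt_iff_nth_less all_set_conv_all_nth by auto
  ultimately show ?thesis by blast
qed

lemma tableaux_eq:
  assumes "la \<in> partitions d"
  shows "tableaux d la = {T \<in> letter_tableaux d. cells d T = diagram d la}"
proof -
  have "tableau_cond d T \<longleftrightarrow> line_tableau (line_of d) T" if ne: "[] \<notin> set T" and c: "cells d T = diagram d la" for T
  proof (cases d)
    case (Gl n)
    show ?thesis
      using column_filling_iff[OF tie_column_rel, of "cells d T" T la "\<lambda>_. True"] c ne Gl
      by (auto simp: column_line_tableau_iff[OF tie_column_rel] column_rel_def not_less)
  next
    case (GlSuper m n)
    have relN: "\<not> column_rel barred b a \<longleftrightarrow> a \<le> b \<and> (a = b \<longrightarrow> barred a)"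
      and relP: "column_rel barred a b \<longleftrightarrow> a \<le> b \<and> (a = b \<longrightarrow> \<not> barred a)" for a b
      by (auto simp: column_rel_def)
    let ?C = "cells (GlSuper m n) T"
    have "tableau_cond (GlSuper m n) T \<longleftrightarrow>
       (\<forall>i j j'. (i, j) \<in> ?C \<and> (i, j') \<in> ?C \<and> j < j' \<longrightarrow> \<not> column_rel barred (T ! j' ! i) (T ! j ! i)) \<and>
       (\<forall>i i' j. (i, j) \<in> ?C \<and> (i', j) \<in> ?C \<and> i < i' \<longrightarrow> column_rel barred (T ! j ! i) (T ! j ! i'))"
      unfolding tableau_cond.simps unfolding relN unfolding relP by (rule refl)
    also have "\<dots> \<longleftrightarrow> (\<forall>K\<in>set T. sorted_wrt (column_rel barred) K) \<and> sorted_wrt (row_le (column_rel barred)) T"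
      using c GlSuper by (intro column_filling_iff[OF tie_column_rel]) auto
    finally show ?thesis using ne GlSuper by (simp add: column_line_tableau_iff[OF tie_column_rel])
  next
    case (Queer n)
    have "(\<forall>u. subseq u (v @ w) \<and> hook_word u \<longrightarrow> length u \<le> length w) \<longleftrightarrow> adjacent_ok hook_int w v" for v w
      unfolding adjacent_ok_def lines_le_def hook_word_iff by (metis le0 list.size(3))
    moreover have "(\<forall>w\<in>set T. hook_word w) \<longleftrightarrow> (\<forall>w\<in>set T. hook_int w)"
      using ne by (auto simp: hook_word_iff)
    ultimately show ?thesis using ne Queer by (simp add: line_tableau_def successively_conv_nth)
  qed
  then show ?thesis by (auto simp: tableaux_def letter_tableaux_def line_tableau_def)
qed

lemma down_closed_eq_lessThan:
  fixes S :: "nat set"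
  assumes "finite S" "\<And>j j'. j \<in> S \<Longrightarrow> j' < j \<Longrightarrow> j' \<in> S"
  shows "S = {..<card S}"
proof -
  obtain k where k: "k \<notin> S" "\<And>j. j < k \<Longrightarrow> j \<in> S"
    using exists_least_iff[of "\<lambda>k. k \<notin> S"] ex_new_if_finite[OF infinite_UNIV_nat assms(1)] by blast
  have "S = {..<k}" using k assms(2) by (metis lessThan_iff linorder_neqE_nat set_eqI)
  then show ?thesis by simp
qed

lemma column_shape:
  assumes line_tableau: "line_tableau (sorted_wrt G) T" and G: "tie G"
    and cells: "cells d T = {(i, j). j < length T \<and> i < length (T ! j)}"
  shows "cells d T = {(i, j). j < shape d T i}" "antimono (shape d T)" "finite {i. shape d T i \<noteq> 0}"
proof -
  let ?S = "\<lambda>i. {j. (i, j) \<in> cells d T}"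
  have row: "sorted_wrt (row_le G) T" using line_tableau column_line_tableau_iff[OF G] by blast
  have fin: "finite (?S i)" for i
    by (rule finite_subset[of _ "{..<length T}"]) (auto simp: cells)
  have S_eq: "?S i = {..<shape d T i}" for i
    unfolding shape_def
  proof (rule down_closed_eq_lessThan[OF fin])
    fix j j' assume "j \<in> ?S i" "j' < j"
    moreover from this have "length (T ! j) \<le> length (T ! j')"
      using row cells by (auto simp: sorted_wrt_iff_nth_less row_le_def)
    ultimately show "j' \<in> ?S i" using cells by auto
  qed
  then show eq: "cells d T = {(i, j). j < shape d T i}" by blast
  show "antimono (shape d T)"
  proof (rule antimonoI)
    fix i i' :: nat assume "i \<le> i'"
    then have "?S i' \<subseteq> ?S i" unfolding cells by auto
    then have "{..<shape d T i'} \<subseteq> {..<shape d T i}" unfolding S_eq .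
    then show "shape d T i' \<le> shape d T i" by simp
  qed
  have "finite (cells d T)"
    unfolding cells by (rule finite_subset[of _ "(\<Union>j<length T. {..<length (T ! j)}) \<times> {..<length T}"]) auto
  then have "finite (fst ` cells d T)" by simp
  moreover have "{i. shape d T i \<noteq> 0} \<subseteq> fst ` cells d T"
    unfolding eq by (force simp: image_iff)
  ultimately show "finite {i. shape d T i \<noteq> 0}" by (rule rev_finite_subset)
qed

lemma letter_in_alphabet:
  assumes "T \<in> letter_tableaux d" "j < length T" "i < length (T ! j)"
  shows "T ! j ! i \<in> alphabet d"
proof -
  have "T ! j ! i \<in> set (concat T)" using assms(2,3) by (auto intro!: nth_mem)
  then show ?thesis using assms(1) by (auto simp: letter_tableaux_def)
qed

lemma card_le_of_strict_mono:
  fixes f :: "nat \<Rightarrow> int"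
  assumes "\<And>i j. i < j \<Longrightarrow> j < k \<Longrightarrow> f i < f j" "\<And>i. i < k \<Longrightarrow> f i \<in> A" "finite A"
  shows "k \<le> card A"
proof -
  have "inj_on f {..<k}"
    using assms(1) by (intro linorder_inj_onI) (auto simp: less_le)
  then show ?thesis using card_inj_on_le[of f "{..<k}" A] assms by auto
qed

text \<open>
  Columns are bounded by the number of letters in the case \<open>gl(n)\<close>. In the case \<open>gl(m,n)\<close>, a column
  has at most \<open>m\<close> barred letters, so row \<open>m\<close> (counted from 0) has only unbarred ones, which do not repeat.
  In the case \<open>q(n)\<close> the first letters of the rows strictly decrease by \<open>hook_adjacent_length\<close>.
\<close>

lemma shape_partition:
  assumes T: "T \<in> letter_tableaux d"
  shows "shape d T \<in> partitions d" "diagram d (shape d T) = cells d T"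
proof -
  have "shape d T \<in> partitions d \<and> diagram d (shape d T) = cells d T"
  proof (cases d)
    case (Gl n)
    have line_tableau: "line_tableau (sorted_wrt (column_rel (\<lambda>_. True))) T" using T Gl by (simp add: letter_tableaux_def)
    have cells: "cells d T = {(i, j). j < length T \<and> i < length (T ! j)}" using Gl by simp
    note * = column_shape[OF line_tableau tie_column_rel cells]
    have "shape d T i = 0" if "n \<le> i" for i
    proof (rule ccontr)
      assume "shape d T i \<noteq> 0"
      then have "(i, 0) \<in> cells d T" using *(1) by simp
      then have i: "0 < length T" "i < length (T ! 0)" using cells by simp_all
      have "sorted_wrt (column_rel (\<lambda>_. True)) (T ! 0)"
        using line_tableau i by (auto simp: line_tableau_def)
      then have "Suc i \<le> card {1..int n}"
        using i letter_in_alphabet[OF T i(1)] Gl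
        by (intro card_le_of_strict_mono[of "Suc i" "\<lambda>k. T ! 0 ! k"])
          (auto simp: sorted_wrt_iff_nth_less column_rel_def)
      then show False using that by simp
    qed
    then show ?thesis using * Gl by simp
  next
    case (GlSuper m n)
    have line_tableau: "line_tableau (sorted_wrt (column_rel barred)) T" using T GlSuper by (simp add: letter_tableaux_def)
    have cells: "cells d T = {(i, j). j < length T \<and> i < length (T ! j)}" using GlSuper by simp
    note * = column_shape[OF line_tableau tie_column_rel cells]
    have row: "sorted_wrt (row_le (column_rel barred)) T"
      and col: "\<And>j. j < length T \<Longrightarrow> sorted_wrt (column_rel barred) (T ! j)"
      using line_tableau by (auto simp: column_line_tableau_iff[OF tie_column_rel])
    have "shape d T i \<le> n" if "m \<le> i" for i
    proof (rule ccontr)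
      assume "\<not> ?thesis"
      then have "n < shape d T m" using *(2) that GlSuper by (auto dest: antimonoD[of _ m i])
      then have "(m, j) \<in> cells d T" if "j \<le> n" for j using *(1) that by simp
      then have mj: "j < length T" "m < length (T ! j)" if "j \<le> n" for j
        using cells that by auto
      \<comment> \<open>A barred letter in row \<open>m\<close> would be the last of \<open>m + 1\<close> distinct barred letters of its column.\<close>
      have unbarred: "0 < T ! j ! m" if "j \<le> n" for j
      proof (rule ccontr)
        assume neg: "\<not> ?thesis"
        have "T ! j ! m \<in> alphabet d" by (rule letter_in_alphabet[OF T mj[OF that]])
        then have bar: "T ! j ! m < 0" using neg GlSuper by auto
        have le: "T ! j ! k \<le> T ! j ! m" if "k \<le> m" for k
          using sorted_wrt_nth_less[OF col[OF mj(1)[OF \<open>j \<le> n\<close>]], of k m] mj(2)[OF \<open>j \<le> n\<close>] that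
          by (cases "k = m") (auto simp: column_rel_def)
        have "Suc m \<le> card {- int m..-1}"
        proof (rule card_le_of_strict_mono[of "Suc m" "\<lambda>k. T ! j ! k"])
          fix k l assume kl: "k < l" "l < Suc m"
          then have "column_rel barred (T ! j ! k) (T ! j ! l)"
            using col[OF mj(1)[OF that]] mj(2)[OF that] by (auto simp: sorted_wrt_iff_nth_less)
          then show "T ! j ! k < T ! j ! l" using le[of k] kl bar by (auto simp: column_rel_def)
        next
          fix k assume "k < Suc m"
          then show "T ! j ! k \<in> {- int m..-1}"
            using letter_in_alphabet[OF T mj(1)[OF that], of k] mj(2)[OF that] le[of k] bar GlSuper by auto
        qed simp
        then show False by simp
      qed
      have "Suc n \<le> card {1..int n}"
      proof (rule card_le_of_strict_mono[of "Suc n" "\<lambda>j. T ! j ! m"])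
        fix j l assume "j < l" "l < Suc n"
        then have "\<not> column_rel barred (T ! l ! m) (T ! j ! m)"
          using row mj[of l] by (auto simp: sorted_wrt_iff_nth_less row_le_def)
        then show "T ! j ! m < T ! l ! m"
          using unbarred[of j] \<open>j < l\<close> \<open>l < Suc n\<close> by (auto simp: column_rel_def)
      next
        fix j assume "j < Suc n"
        then show "T ! j ! m \<in> {1..int n}"
          using letter_in_alphabet[OF T mj[of j]] unbarred[of j] GlSuper by auto
      qed simp
      then show False by simp
    qed
    then show ?thesis using * GlSuper by simp
  next
    case (Queer n)
    have line_tableau: "line_tableau hook_int T" using T Queer by (simp add: letter_tableaux_def)
    have "{j. (i, j) \<in> cells d T} = {i..<i + part_at (map length T) i}" for i
      using Queer by (auto simp: part_at_def)
    then have shape: "shape d T = part_at (map length T)" by (simp add: shape_def fun_eq_iff)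
    have step: "T ! i \<noteq> [] \<and> T ! Suc i \<noteq> [] \<and> length (T ! Suc i) < length (T ! i) \<and>
        hd (T ! Suc i) < hd (T ! i)" if "Suc i < length T" for i
    proof -
      have "adjacent_ok hook_int (T ! i) (T ! Suc i)" "hook_int (T ! i)" "hook_int (T ! Suc i)"
        and ne: "T ! i \<noteq> []" "T ! Suc i \<noteq> []"
        using line_tableau that by (auto simp: line_tableau_def successively_conv_nth) (metis nth_mem Suc_lessD)+
      then show ?thesis
        using tie.hook_adjacent_length[OF tie_ge, of "T ! i" "T ! Suc i"]
        by (auto simp: adjacent_ok_def not_le)
    qed
    have dec: "part_at (map length T) (Suc i) \<le> part_at (map length T) i" for i
      using step[of i] by (auto simp: part_at_def)
    then have "antimono (part_at (map length T))" by (simp add: antimono_iff_le_Suc)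
    moreover have "length T \<le> n"
    proof -
      have "sorted_wrt (>) (map hd T)"
        by (subst sorted_wrt_iff_nth_Suc_transp) (use step in \<open>auto simp: transp_def\<close>)
      then have dec: "hd (T ! j) < hd (T ! i)" if "i < j" "j < length T" for i j
        using that by (auto simp: sorted_wrt_iff_nth_less)
      have "hd (T ! i) \<in> alphabet d" if "i < length T" for i
      proof -
        have "T ! i \<noteq> []" using line_tableau that by (auto simp: line_tableau_def) (metis nth_mem)
        then show ?thesis using letter_in_alphabet[OF T that, of 0] by (simp add: hd_conv_nth)
      qed
      then have "length T \<le> card {1..int n}"
        using Queer
        by (intro card_le_of_strict_mono[of "length T" "\<lambda>i. int n + 1 - hd (T ! i)"])
          (auto simp: dec)
      then show ?thesis by simp
    qed
    moreover have "cells d T = diagram d (part_at (map length T))"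
      using Queer by (auto simp: part_at_def split: if_splits)
    moreover have "part_at (map length T) (Suc i) < part_at (map length T) i"
      if "0 < part_at (map length T) (Suc i)" for i
      using that step[of i] by (auto simp: part_at_def split: if_splits)
    ultimately show ?thesis using Queer shape by (auto simp: part_at_def)
  qed
  then show "shape d T \<in> partitions d" "diagram d (shape d T) = cells d T" by auto
qed

section \<open>Every partition is the shape of a tableau\<close>

definition column_height :: "partition \<Rightarrow> nat \<Rightarrow> nat" where
  "column_height la j = (LEAST i. la i \<le> j)"

lemma less_column_height:
  assumes "antimono la" "finite {i. la i \<noteq> 0}"
  shows "i < column_height la j \<longleftrightarrow> j < la i"
proof -
  obtain k where "la k = 0" using ex_new_if_finite[OF infinite_UNIV_nat assms(2)] by auto
  then have ex: "la (column_height la j) \<le> j"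
    unfolding column_height_def using LeastI[of "\<lambda>i. la i \<le> j" k] by simp
  show ?thesis
  proof
    assume "i < column_height la j"
    then show "j < la i" unfolding column_height_def using not_less_Least by fastforce
  next
    assume "j < la i"
    then show "i < column_height la j"
      using ex antimonoD[OF assms(1), of "column_height la j" i] by fastforce
  qed
qed

lemma column_filling_exists:
  assumes la: "antimono la" "finite {i. la i \<noteq> 0}"
  obtains T :: filling where "[] \<notin> set T" "{(i, j). j < length T \<and> i < length (T ! j)} = {(i, j). j < la i}"
    "\<And>i j. j < la i \<Longrightarrow> T ! j ! i = e i j"
    "\<And>x. x \<in> set (concat T) \<Longrightarrow> \<exists>i j. j < la i \<and> x = e i j"
proof
  let ?T = "map (\<lambda>j. map (\<lambda>i. e i j) [0..<column_height la j]) [0..<la 0]"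
  note h = less_column_height[OF la]
  have le0: "la i \<le> la 0" for i using antimonoD[OF la(1), of 0 i] by simp
  have lt0: "j < la 0" if "j < la i" for i j using that le0[of i] by simp
  have pos: "0 < column_height la j" if "j < la 0" for j using h that by blast
  show "[] \<notin> set ?T" using pos by fastforce
  show "{(i, j). j < length ?T \<and> i < length (?T ! j)} = {(i, j). j < la i}"
    using h lt0 by auto
  show "?T ! j ! i = e i j" if "j < la i" for i j
    using that h[of i j] lt0[OF that] by simp
  show "\<exists>i j. j < la i \<and> x = e i j" if "x \<in> set (concat ?T)" for x
    using that h by auto blast
qed

text \<open>
  Row \<open>i\<close> is filled with the letter \<open>n - i\<close>. A hook in two successive rows has at most one letter
  from the upper row if it uses the lower row, and strictness leaves room for this letter.
\<close>

lemma Queer_tableau_exists: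
  assumes "la \<in> partitions (Queer n)"
  shows "tableaux (Queer n) la \<noteq> {}"
proof -
  have la: "antimono la" "\<And>i. n \<le> i \<Longrightarrow> la i = 0" "\<And>i. 0 < la (Suc i) \<Longrightarrow> la (Suc i) < la i"
    using assms by auto
  have "i < n" if "la i \<noteq> 0" for i using la(2)[of i] that by (cases "i < n") auto
  then have "{i. la i \<noteq> 0} \<subseteq> {..<n}" by auto
  then have fin: "finite {i. la i \<noteq> 0}" by (rule finite_subset) simp
  define r where "r = column_height la 0"
  have r: "i < r \<longleftrightarrow> 0 < la i" for i unfolding r_def by (rule less_column_height[OF la(1) fin])
  have rn: "i < n" if "i < r" for i using that r la(2)[of i] by (cases "i < n") auto
  define T where "T = map (\<lambda>i. replicate (la i) (int n - int i)) [0..<r]"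
  have T: "length T = r" "\<And>i. i < r \<Longrightarrow> T ! i = replicate (la i) (int n - int i)"
    by (simp_all add: T_def)
  have nz: "replicate (la i) (int n - int i) \<noteq> []" if "i < r" for i using that r[of i] by simp
  have "[] \<notin> set T"
  proof
    assume "[] \<in> set T"
    then obtain i where "i < r" "[] = replicate (la i) (int n - int i)" unfolding T_def by fastforce
    then show False using nz by metis
  qed
  moreover have "i < r" if "i \<le> j" "j < i + la i" for i j using that by (simp add: r)
  then have "cells (Queer n) T = diagram (Queer n) la" by (auto simp: T)
  moreover have "set (concat T) \<subseteq> alphabet (Queer n)"
    using rn by (fastforce simp: T_def)
  moreover have "hook_word w" if "w \<in> set T" for w
  proof -
    have "w \<noteq> []" "sorted_wrt (\<ge>) w" using that nz unfolding T_def by (fastforce simp: sorted_wrt_iff_nth_less)+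
    then show ?thesis using hookI[of "(\<ge>)" w "[]"] by (simp add: hook_word_iff)
  qed
  moreover have "length u \<le> length (T ! i)"
    if i: "Suc i < length T" and u: "subseq u (T ! Suc i @ T ! i)" "hook_word u" for i u
  proof -
    have lens: "length (T ! Suc i) < length (T ! i)" using i T r[of "Suc i"] la(3)[of i] by simp
    obtain a b where ab: "u = a @ b" "subseq a (T ! Suc i)" "subseq b (T ! i)"
      using u(1) by (rule subseq_append2E)
    show ?thesis
    proof (cases "a = []")
      case True
      then show ?thesis using ab list_emb_length by force
    next
      case False
      have "length b \<le> 1"
      proof (rule ccontr)
        assume "\<not> ?thesis"
        then obtain b1 b2 b' where b: "b = b1 # b2 # b'" by (cases b; cases "tl b") auto
        obtain a1 a' where a: "a = a1 # a'" using False by (cases a) auto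
        have "a1 = int n - int (Suc i)" "b1 = int n - int i" "b2 = int n - int i"
          using subseq_set[OF ab(2)] subseq_set[OF ab(3)] a b T i by auto
        then have order: "\<not> a1 \<ge> b1" "b1 \<ge> b2" by auto
        have "subseq [a1, b1, b2] u"
          using ab(1) a b by (auto intro: subseq_drop_many)
        then have "hook_int [a1, b1, b2]" using u(2) hook_subseq hook_word_iff by blast
        then show False using tie.not_hook3[OF tie_ge order] by contradiction
      qed
      then show ?thesis using ab list_emb_length[OF ab(2)] lens by simp
    qed
  qed
  ultimately have "T \<in> tableaux (Queer n) la" by (auto simp: tableaux_def)
  then show ?thesis by blast
qed

text \<open>
  Filling row \<open>i\<close> with its number works for \<open>gl(n)\<close>. For \<open>gl(m,n)\<close> this is done with barred letters in the
  first \<open>m\<close> rows, and below them the columns are filled with their numbers.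
\<close>

lemma tableau_exists:
  assumes "la \<in> partitions d"
  shows "tableaux d la \<noteq> {}"
proof (cases d)
  case (Gl n)
  have la: "antimono la" "\<And>i. n \<le> i \<Longrightarrow> la i = 0" using assms Gl by auto
  have small: "i < n" if "j < la i" for i j using la(2)[of i] that by (cases "i < n") auto
  have fin: "finite {i. la i \<noteq> 0}"
    by (rule finite_subset[of _ "{..<n}"]) (use small in auto)
  obtain T where T: "[] \<notin> set T" "{(i, j). j < length T \<and> i < length (T ! j)} = {(i, j). j < la i}"
    "\<And>i j. j < la i \<Longrightarrow> T ! j ! i = int i + 1"
    "\<And>x. x \<in> set (concat T) \<Longrightarrow> \<exists>i j. j < la i \<and> x = int i + 1"
    by (rule column_filling_exists[OF la(1) fin, of "\<lambda>i j. int i + 1"]) auto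
  have "int i + 1 \<in> alphabet (Gl n)" if "j < la i" for i j using small[OF that] by simp
  then have "set (concat T) \<subseteq> alphabet (Gl n)" using T(4) by blast
  moreover have "tableau_cond (Gl n) T"
    unfolding cells.simps tableau_cond.simps T(2) by (auto simp: T(3))
  ultimately have "T \<in> tableaux d la" using T(1,2) Gl by (simp add: tableaux_def del: tableau_cond.simps)
  then show ?thesis by blast
next
  case (GlSuper m n)
  have la: "antimono la" "finite {i. la i \<noteq> 0}" "\<And>i. m \<le> i \<Longrightarrow> la i \<le> n" using assms GlSuper by auto
  define e where "e = (\<lambda>i j. if i < m then int i - int m else int j + 1)"
  obtain T where T: "[] \<notin> set T" "{(i, j). j < length T \<and> i < length (T ! j)} = {(i, j). j < la i}"
    "\<And>i j. j < la i \<Longrightarrow> T ! j ! i = e i j"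
    "\<And>x. x \<in> set (concat T) \<Longrightarrow> \<exists>i j. j < la i \<and> x = e i j"
    by (rule column_filling_exists[OF la(1,2), of e]) auto
  have "e i j \<in> alphabet (GlSuper m n)" if "j < la i" for i j
    using that la(3)[of i] by (auto simp: e_def)
  then have "set (concat T) \<subseteq> alphabet (GlSuper m n)" using T(4) by blast
  moreover have "tableau_cond (GlSuper m n) T"
    unfolding cells.simps tableau_cond.simps T(2)
    by (auto simp: T(3)) (auto simp: e_def split: if_splits)
  ultimately have "T \<in> tableaux d la" using T(1,2) GlSuper by (simp add: tableaux_def del: tableau_cond.simps)
  then show ?thesis by blast
next
  case (Queer n)
  then show ?thesis using Queer_tableau_exists assms by simp
qed

section \<open>Insertion as a bijection\<close>

lemma finite_tableaux: "finite (tableaux d la)"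
proof (cases "tableaux d la = {}")
  case False
  then obtain S where S: "S \<in> tableaux d la" by blast
  have alph: "finite (alphabet d)" by (cases d) auto
  let ?B = "{w. set w \<subseteq> alphabet d \<and> length w \<le> sum_list (map length S)}"
  have "tableaux d la \<subseteq> {T. set T \<subseteq> ?B \<and> length T \<le> length S}"
  proof
    fix T assume T: "T \<in> tableaux d la"
    then have lens: "map length T = map length S"
      using S by (intro cells_inj[of _ _ d]) (auto simp: tableaux_def)
    have "w \<in> ?B" if "w \<in> set T" for w
    proof -
      have "length w \<in> set (map length T)" using that by simp
      then have "length w \<le> sum_list (map length T)" by (intro member_le_sum_list) auto
      then show ?thesis using that T lens by (auto simp: tableaux_def)
    qed
    moreover have "length T = length S" using arg_cong[OF lens, of length] by simp
    ultimately show "T \<in> {T. set T \<subseteq> ?B \<and> length T \<le> length S}" by auto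
  qed
  moreover have "finite ?B" using alph finite_lists_length_le by blast
  then have "finite {T. set T \<subseteq> ?B \<and> length T \<le> length S}" by (rule finite_lists_length_le)
  ultimately show ?thesis by (rule finite_subset)
qed simp

lemma finite_alphabet: "finite (alphabet d)"
  by (cases d) auto

lemma tableaux_letter_tableaux: "la \<in> partitions d \<Longrightarrow> T \<in> tableaux d la \<Longrightarrow> T \<in> letter_tableaux d \<and> cells d T = diagram d la"
  by (simp add: tableaux_eq)

lemma letter_tableaux_tableaux: "T \<in> letter_tableaux d \<Longrightarrow> T \<in> tableaux d (shape d T)"
  using shape_partition[of T d] by (simp add: tableaux_eq)

lemma shape_tableaux: "T \<in> tableaux d la \<Longrightarrow> shape d T = la"
  by (rule shape_cells) (simp add: tableaux_def)

lemma insert_tableau: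
  assumes "mu \<in> partitions d" "T \<in> tableaux d mu" "x \<in> alphabet d"
  defines "la \<equiv> shape d (insert_letter d x T)"
  shows "la \<in> partitions d" "adds_box d mu la" "insert_letter d x T \<in> tableaux d la"
proof -
  have T: "T \<in> letter_tableaux d" "cells d T = diagram d mu" using tableaux_letter_tableaux assms by auto
  note * = insert_letter_tableaux[OF T(1) assms(3)]
  show "la \<in> partitions d" "insert_letter d x T \<in> tableaux d la"
    unfolding la_def using shape_partition *(1) letter_tableaux_tableaux by auto
  show "adds_box d mu la"
    unfolding la_def adds_box_def using *(2) T(2) shape_partition(2)[OF *(1)] by simp
qed

lemma insert_tableau_inj:
  assumes "mu \<in> partitions d" "T \<in> tableaux d mu" "U \<in> tableaux d mu"
    "insert_letter d x T = insert_letter d y U"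
  shows "T = U \<and> x = y"
  using insert_letter_tableaux_inj[OF _ _ _ assms(4)] tableaux_letter_tableaux[OF assms(1)] assms(2,3) by auto

lemma insert_tableau_surj:
  assumes "mu \<in> partitions d" "la \<in> partitions d" "adds_box d mu la" "T' \<in> tableaux d la"
  obtains T x where "T \<in> tableaux d mu" "x \<in> alphabet d" "insert_letter d x T = T'"
proof -
  obtain S where S: "S \<in> letter_tableaux d" "cells d S = diagram d mu"
    using tableau_exists[OF assms(1)] tableaux_letter_tableaux[OF assms(1)] by blast
  obtain b where "b \<notin> diagram d mu" "diagram d la = insert b (diagram d mu)"
    using assms(3) by (auto simp: adds_box_def)
  then obtain T x where "T \<in> letter_tableaux d" "x \<in> alphabet d" "cells d T = cells d S" "insert_letter d x T = T'"
    using insert_letter_tableaux_surj[OF _ S(1), of T' b] tableaux_letter_tableaux[OF assms(2,4)] S(2) by auto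
  then show thesis using that S(2) tableaux_eq[OF assms(1)] by simp
qed

section \<open>Schur functions\<close>

definition weight :: "(letter \<Rightarrow> real) \<Rightarrow> letter list \<Rightarrow> real" where
  "weight p w = prod_list (map p w)"

lemma weight_mset: "weight p w = prod_mset (image_mset p (mset w))"
  by (simp add: weight_def flip: prod_mset_prod_list mset_map)

text \<open>
  Turns the monomials of the Schur functions into products along words.
\<close>

lemma prod_count_list:
  assumes "finite A" "set w \<subseteq> A"
  shows "(\<Prod>i\<in>A. p i ^ count_list w i) = weight p w"
  using assms(2)
proof (induction w)
  case (Cons a w)
  have "(\<Prod>i\<in>A. p i ^ count_list (a # w) i) = (\<Prod>i\<in>A. (if i = a then p i else 1) * p i ^ count_list w i)"
    by (intro prod.cong) auto
  also have "\<dots> = p a * (\<Prod>i\<in>A. p i ^ count_list w i)"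
    using Cons.prems assms(1) by (simp add: prod.distrib prod.delta)
  finally show ?case using Cons by (simp add: weight_def)
qed (simp add: weight_def)

lemma schur_eq: "schur d la p = (\<Sum>T\<in>tableaux d la. weight p (concat T))"
  unfolding schur_def
  by (intro sum.cong refl prod_count_list finite_alphabet) (simp add: tableaux_def)

lemma weight_pos:
  assumes "\<forall>i\<in>alphabet d. 0 < p i" "set w \<subseteq> alphabet d"
  shows "0 < weight p w"
  using assms(2) by (induction w) (use assms(1) in \<open>auto simp: weight_def\<close>)

lemma schur_pos:
  assumes "\<forall>i\<in>alphabet d. 0 < p i" "la \<in> partitions d"
  shows "0 < schur d la p"
  unfolding schur_eq using tableau_exists[OF assms(2)] finite_tableaux
  by (intro sum_pos weight_pos[OF assms(1)]) (auto simp: tableaux_def)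

lemma weight_insert:
  assumes "mu \<in> partitions d" "T \<in> tableaux d mu" "x \<in> alphabet d"
  shows "weight p (concat (insert_letter d x T)) = weight p (concat T) * p x"
  using insert_letter_tableaux(3)[of T d x] tableaux_letter_tableaux[OF assms(1,2)] assms(3) by (simp add: weight_mset)

definition covers :: "diamond \<Rightarrow> partition \<Rightarrow> partition set" where
  "covers d mu = {la \<in> partitions d. adds_box d mu la}"

lemma covers_tableaux:
  assumes "mu \<in> partitions d"
  shows "(\<lambda>(T, x). insert_letter d x T) ` (tableaux d mu \<times> alphabet d) = (\<Union>la\<in>covers d mu. tableaux d la)"
proof (intro equalityI subsetI)
  fix T' assume "T' \<in> (\<lambda>(T, x). insert_letter d x T) ` (tableaux d mu \<times> alphabet d)"
  then obtain T x where "T \<in> tableaux d mu" "x \<in> alphabet d" "T' = insert_letter d x T" by auto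
  then have "shape d T' \<in> covers d mu" "T' \<in> tableaux d (shape d T')"
    using insert_tableau[OF assms, of T x] by (simp_all add: covers_def)
  then show "T' \<in> (\<Union>la\<in>covers d mu. tableaux d la)" by blast
next
  fix T' assume "T' \<in> (\<Union>la\<in>covers d mu. tableaux d la)"
  then obtain la where "la \<in> partitions d" "adds_box d mu la" "T' \<in> tableaux d la"
    by (auto simp: covers_def)
  then obtain T x where "T \<in> tableaux d mu" "x \<in> alphabet d" "insert_letter d x T = T'"
    using insert_tableau_surj[OF assms] by blast
  then show "T' \<in> (\<lambda>(T, x). insert_letter d x T) ` (tableaux d mu \<times> alphabet d)" by force
qed

lemma finite_covers:
  assumes "mu \<in> partitions d"
  shows "finite (covers d mu)"
proof -
  have "covers d mu \<subseteq> shape d ` (\<Union>la\<in>covers d mu. tableaux d la)"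
  proof
    fix la assume la: "la \<in> covers d mu"
    then obtain T where T: "T \<in> tableaux d la" using tableau_exists by (auto simp: covers_def)
    then show "la \<in> shape d ` (\<Union>la\<in>covers d mu. tableaux d la)"
      using la shape_tableaux[OF T] by blast
  qed
  moreover have "finite (\<Union>la\<in>covers d mu. tableaux d la)"
    unfolding covers_tableaux[OF assms, symmetric]
    using finite_tableaux finite_alphabet by blast
  ultimately show ?thesis using finite_subset by blast
qed

text \<open>
  Insertion is a bijection from the pairs of a tableau of shape \<open>mu\<close> and a letter to the tableaux of the
  shapes above \<open>mu\<close>, and it multiplies weights.
\<close>

lemma pieri:
  assumes mu: "mu \<in> partitions d"
  shows "(\<Sum>la\<in>covers d mu. schur d la p) = schur d mu p * (\<Sum>x\<in>alphabet d. p x)"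
proof -
  let ?f = "\<lambda>(T, x). insert_letter d x T"
  have inj: "inj_on ?f (tableaux d mu \<times> alphabet d)"
    using insert_tableau_inj[OF mu] by (auto simp: inj_on_def)
  have "(\<Sum>la\<in>covers d mu. schur d la p) = (\<Sum>T\<in>(\<Union>la\<in>covers d mu. tableaux d la). weight p (concat T))"
    unfolding schur_eq
    by (subst sum.UNION_disjoint) (use finite_covers[OF mu] finite_tableaux shape_tableaux in blast)+
  also have "\<dots> = (\<Sum>(T, x)\<in>tableaux d mu \<times> alphabet d. weight p (concat T) * p x)"
    unfolding covers_tableaux[OF mu, symmetric] sum.reindex[OF inj]
    by (rule sum.cong) (auto simp: weight_insert[OF mu])
  also have "\<dots> = schur d mu p * (\<Sum>x\<in>alphabet d. p x)"
    by (simp add: schur_eq sum_product sum.cartesian_product)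
  finally show ?thesis .
qed

section \<open>Words with a given sequence of shapes\<close>

definition path_words :: "diamond \<Rightarrow> nat \<Rightarrow> (nat \<Rightarrow> partition) \<Rightarrow> letter list set" where
  "path_words d l x = {w. length w = l \<and> set w \<subseteq> alphabet d \<and> (\<forall>k\<le>l. shape d (P_tableau d (take k w)) = x k)}"

lemma P_tableau_Nil [simp]: "P_tableau d [] = []"
  by (simp add: P_tableau_def)

lemma P_tableau_snoc [simp]: "P_tableau d (w @ [a]) = insert_letter d a (P_tableau d w)"
  by (simp add: P_tableau_def)

lemma P_tableau_letter_tableaux:
  "set w \<subseteq> alphabet d \<Longrightarrow> P_tableau d w \<in> letter_tableaux d \<and> mset (concat (P_tableau d w)) = mset w"
proof (induction w rule: rev_induct)
  case Nil
  then show ?case by (simp add: letter_tableaux_def)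
next
  case (snoc a w)
  then show ?case using insert_letter_tableaux[of "P_tableau d w" d a] by simp
qed

lemma path_words_Suc:
  "path_words d (Suc l) x = {w @ [a] |w a. w \<in> path_words d l x \<and> a \<in> alphabet d \<and>
     shape d (insert_letter d a (P_tableau d w)) = x (Suc l)}" (is "_ = ?R")
proof (intro equalityI subsetI)
  fix v assume v: "v \<in> path_words d (Suc l) x"
  then obtain w a where w: "v = w @ [a]" "length w = l" by (auto simp: path_words_def length_Suc_conv_rev)
  have "shape d (P_tableau d (take k w)) = x k" if "k \<le> l" for k
    using v that w by (auto simp: path_words_def dest: spec[of _ k])
  moreover have "shape d (P_tableau d (take (Suc l) v)) = x (Suc l)" using v by (auto simp: path_words_def)
  ultimately show "v \<in> ?R" using v w by (auto simp: path_words_def)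
next
  fix v assume "v \<in> ?R"
  then show "v \<in> path_words d (Suc l) x" by (auto simp: path_words_def le_Suc_eq)
qed

definition growth_path :: "diamond \<Rightarrow> nat \<Rightarrow> (nat \<Rightarrow> partition) \<Rightarrow> bool" where
  "growth_path d l x \<longleftrightarrow> x 0 = (\<lambda>_. 0) \<and> (\<forall>k<l. adds_box d (x k) (x (Suc k)))"

lemma shape_Nil: "shape d [] = (\<lambda>_. 0)"
  by (cases d) (auto simp: shape_def)

lemma path_words_growth:
  assumes "w \<in> path_words d l x"
  shows "growth_path d l x"
  using assms
proof (induction l arbitrary: w)
  case 0
  then show ?case by (auto simp: path_words_def growth_path_def shape_Nil)
next
  case (Suc l)
  then obtain v a where v: "v \<in> path_words d l x" "a \<in> alphabet d"
    "shape d (insert_letter d a (P_tableau d v)) = x (Suc l)"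
    unfolding path_words_Suc by blast
  have "P_tableau d v \<in> letter_tableaux d" "shape d (P_tableau d v) = x l"
    using v(1) P_tableau_letter_tableaux[of v d] by (auto simp: path_words_def dest: spec[of _ l])
  then have "x l \<in> partitions d" "P_tableau d v \<in> tableaux d (x l)"
    using letter_tableaux_tableaux shape_partition(1) by metis+
  then have "adds_box d (x l) (x (Suc l))" using insert_tableau(2) v by metis
  then show ?case using Suc.IH[OF v(1)] by (auto simp: growth_path_def less_Suc_eq)
qed

text \<open>
  The last step of the path and the tableau of the last shape determine the last letter and
  the previous tableau.
\<close>

lemma path_words_bij:
  assumes "growth_path d l x" "\<forall>k\<le>l. x k \<in> partitions d"
  shows "bij_betw (P_tableau d) (path_words d l x) (tableaux d (x l))"
  using assms
proof (induction l)
  case 0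
  have "tableaux d (\<lambda>_. 0) = {[]}"
  proof (intro equalityI subsetI)
    fix T assume T: "T \<in> tableaux d (\<lambda>_. 0)"
    have "cells d T = cells d []" using T by (cases d) (auto simp: tableaux_def)
    then have "map length T = map length ([] :: filling)"
      using T by (intro cells_inj[of _ _ d]) (auto simp: tableaux_def)
    then show "T \<in> {[]}" by simp
  next
    fix T assume "T \<in> {[] :: filling}"
    then show "T \<in> tableaux d (\<lambda>_. 0)" using letter_tableaux_tableaux[of "[]" d] by (simp add: letter_tableaux_def shape_Nil)
  qed
  moreover have "path_words d 0 x = {[]}" using 0 by (auto simp: path_words_def growth_path_def shape_Nil)
  ultimately show ?case using 0 by (simp add: growth_path_def bij_betw_def)
next
  case (Suc l)
  have bij: "bij_betw (P_tableau d) (path_words d l x) (tableaux d (x l))"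
    using Suc by (auto simp: growth_path_def)
  have mu: "x l \<in> partitions d" and la: "x (Suc l) \<in> partitions d" and add: "adds_box d (x l) (x (Suc l))"
    using Suc.prems by (auto simp: growth_path_def)
  have into: "P_tableau d w \<in> tableaux d (x l)" if "w \<in> path_words d l x" for w
    using bij that by (auto simp: bij_betw_def)
  show ?case
    unfolding bij_betw_def
  proof (intro conjI equalityI subsetI inj_onI)
    fix u v assume u: "u \<in> path_words d (Suc l) x" and v: "v \<in> path_words d (Suc l) x"
      and eq: "P_tableau d u = P_tableau d v"
    obtain u' a where u': "u = u' @ [a]" "u' \<in> path_words d l x" using u unfolding path_words_Suc by blast
    obtain v' b where v': "v = v' @ [b]" "v' \<in> path_words d l x" using v unfolding path_words_Suc by blast
    have "P_tableau d u' = P_tableau d v' \<and> a = b"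
      using insert_tableau_inj[OF mu into[OF u'(2)] into[OF v'(2)]] eq u' v' by simp
    then show "u = v" using bij u' v' by (auto simp: bij_betw_def dest: inj_onD)
  next
    fix T' assume "T' \<in> P_tableau d ` path_words d (Suc l) x"
    then obtain w a where w: "w \<in> path_words d l x" "a \<in> alphabet d"
      "shape d (insert_letter d a (P_tableau d w)) = x (Suc l)" "T' = insert_letter d a (P_tableau d w)"
      unfolding path_words_Suc by auto
    then show "T' \<in> tableaux d (x (Suc l))" using insert_tableau(3)[OF mu into[OF w(1)] w(2)] by simp
  next
    fix T' assume T': "T' \<in> tableaux d (x (Suc l))"
    then obtain T a where T: "T \<in> tableaux d (x l)" "a \<in> alphabet d" "insert_letter d a T = T'"
      using insert_tableau_surj[OF mu la add] by blast
    then obtain w where "w \<in> path_words d l x" "T = P_tableau d w"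
      using bij by (auto simp: bij_betw_def)
    then have "w @ [a] \<in> path_words d (Suc l) x" "P_tableau d (w @ [a]) = T'"
      unfolding path_words_Suc using T shape_tableaux[OF T'] by auto
    then show "T' \<in> P_tableau d ` path_words d (Suc l) x" by blast
  qed
qed

lemma sum_path_words:
  assumes "\<forall>k\<le>l. x k \<in> partitions d"
  shows "(\<Sum>w\<in>path_words d l x. weight p w) = (if growth_path d l x then schur d (x l) p else 0)"
proof (cases "growth_path d l x")
  case True
  have "schur d (x l) p = (\<Sum>w\<in>path_words d l x. weight p (concat (P_tableau d w)))"
    unfolding schur_eq by (rule sum.reindex_bij_betw[OF path_words_bij[OF True assms], symmetric])
  also have "\<dots> = (\<Sum>w\<in>path_words d l x. weight p w)"
    by (intro sum.cong refl) (use P_tableau_letter_tableaux in \<open>auto simp: path_words_def weight_mset\<close>)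
  finally show ?thesis using True by simp
next
  case False
  then have "path_words d l x = {}" using path_words_growth by blast
  then show ?thesis using False by simp
qed

section \<open>The Markov chain\<close>

locale letters =
  fixes d :: diamond and p :: "letter \<Rightarrow> real"
  assumes p_pos: "\<forall>i\<in>alphabet d. 0 < p i"
    and p_sum: "(\<Sum>i\<in>alphabet d. p i) = 1"
begin

abbreviation letter_measure :: "letter measure" where
  "letter_measure \<equiv> point_measure (alphabet d) (\<lambda>i. ennreal (p i))"

lemma prob_space_letter: "prob_space letter_measure"
proof (rule prob_space_point_measure[OF finite_alphabet])
  show "(\<Sum>i\<in>alphabet d. ennreal (p i)) = 1"
    using p_pos p_sum by (subst sum_ennreal) (auto simp: less_imp_le)
qed simp

sublocale P: product_prob_space "\<lambda>_. letter_measure" "UNIV :: nat set"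
  by (intro product_prob_spaceI prob_space_letter)

lemma letter_space_eq: "letter_space d p = PiM UNIV (\<lambda>_. letter_measure)"
  by (simp add: letter_space_def)

lemma space_letter_space: "space (letter_space d p) = {\<omega>. \<forall>i. \<omega> i \<in> alphabet d}"
  by (auto simp: letter_space_eq space_PiM space_point_measure PiE_def)

definition cylinder :: "letter list \<Rightarrow> (nat \<Rightarrow> letter) set" where
  "cylinder w = {\<omega> \<in> space (letter_space d p). map \<omega> [0..<length w] = w}"

lemma cylinder_eq:
  assumes "set w \<subseteq> alphabet d"
  shows "cylinder w = prod_emb UNIV (\<lambda>_. letter_measure) {..<length w} (\<Pi>\<^sub>E i\<in>{..<length w}. {w ! i})"
proof -
  have "\<omega> \<in> cylinder w \<longleftrightarrow> (\<forall>i. \<omega> i \<in> alphabet d) \<and> (\<forall>i<length w. \<omega> i = w ! i)" for \<omega>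
    unfolding cylinder_def space_letter_space mem_Collect_eq
    by (subst list_eq_iff_nth_eq) simp
  moreover have "\<omega> \<in> prod_emb UNIV (\<lambda>_. letter_measure) {..<length w} (\<Pi>\<^sub>E i\<in>{..<length w}. {w ! i}) \<longleftrightarrow>
      (\<forall>i. \<omega> i \<in> alphabet d) \<and> (\<forall>i<length w. \<omega> i = w ! i)" for \<omega>
    by (auto simp: prod_emb_def space_PiM space_point_measure PiE_iff)
  ultimately show ?thesis by blast
qed

lemma measure_cylinder:
  assumes "set w \<subseteq> alphabet d"
  shows "measure (letter_space d p) (cylinder w) = weight p w" "cylinder w \<in> sets (letter_space d p)"
proof -
  have sets: "{w ! i} \<in> sets letter_measure" if "i < length w" for i
    using assms that by (auto simp: sets_point_measure)
  have "measure letter_measure {w ! i} = p (w ! i)" if "i < length w" for i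
  proof -
    have "w ! i \<in> alphabet d" using assms that by auto
    then have "emeasure letter_measure {w ! i} = ennreal (p (w ! i))" "0 \<le> p (w ! i)"
      using p_pos finite_alphabet by (auto simp: emeasure_point_measure_finite less_imp_le)
    then show ?thesis by (simp add: measure_def)
  qed
  then have "measure (letter_space d p) (cylinder w) = (\<Prod>i<length w. p (w ! i))"
    unfolding cylinder_eq[OF assms] letter_space_eq
    by (subst P.measure_PiM_emb) (auto simp: sets)
  then show "measure (letter_space d p) (cylinder w) = weight p w"
    by (simp add: weight_def prod.list_conv_set_nth atLeast0LessThan)
  show "cylinder w \<in> sets (letter_space d p)"
    unfolding cylinder_eq[OF assms] letter_space_eq
    by (intro sets_PiM_I) (auto simp: sets)
qed

lemma measure_words:
  assumes "W \<subseteq> {w. length w = l \<and> set w \<subseteq> alphabet d}"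
  shows "{\<omega> \<in> space (letter_space d p). map \<omega> [0..<l] \<in> W} \<in> sets (letter_space d p)"
    "measure (letter_space d p) {\<omega> \<in> space (letter_space d p). map \<omega> [0..<l] \<in> W} = (\<Sum>w\<in>W. weight p w)"
proof -
  interpret prob_space "letter_space d p" unfolding letter_space_eq by (rule P.prob_space_axioms)
  have fin: "finite W"
    by (rule finite_subset[OF _ finite_lists_length_eq[OF finite_alphabet, of d l]]) (use assms in auto)
  have eq: "{\<omega> \<in> space (letter_space d p). map \<omega> [0..<l] \<in> W} = (\<Union>w\<in>W. cylinder w)"
    using assms by (auto simp: cylinder_def)
  have sets: "cylinder w \<in> sets (letter_space d p)" if "w \<in> W" for w
    using measure_cylinder(2) that assms by auto
  show "{\<omega> \<in> space (letter_space d p). map \<omega> [0..<l] \<in> W} \<in> sets (letter_space d p)"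
    unfolding eq using sets fin by auto
  have "v = w" if "v \<in> W" "w \<in> W" "\<omega> \<in> cylinder v" "\<omega> \<in> cylinder w" for v w \<omega>
  proof -
    have "length v = length w" using that assms by auto
    then show ?thesis using that(3,4) by (metis (mono_tags, lifting) cylinder_def mem_Collect_eq)
  qed
  then have "disjoint_family_on cylinder W" by (auto simp: disjoint_family_on_def)
  then have "measure (letter_space d p) (\<Union>w\<in>W. cylinder w) = (\<Sum>w\<in>W. measure (letter_space d p) (cylinder w))"
    using sets fin by (intro finite_measure_finite_Union) auto
  also have "\<dots> = (\<Sum>w\<in>W. weight p w)"
    using assms by (intro sum.cong refl measure_cylinder(1)) auto
  finally show "measure (letter_space d p) {\<omega> \<in> space (letter_space d p). map \<omega> [0..<l] \<in> W} = (\<Sum>w\<in>W. weight p w)"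
    unfolding eq .
qed

lemma word_of_sample: "\<omega> \<in> space (letter_space d p) \<Longrightarrow> set (map \<omega> [0..<l]) \<subseteq> alphabet d"
  by (auto simp: space_letter_space)

text \<open>
  This is the Markov property: the past enters only through the last shape.
\<close>

lemma prob_path:
  assumes "\<forall>k\<le>l. x k \<in> partitions d"
  shows "\<P>(\<omega> in letter_space d p. \<forall>k\<le>l. shape_process d k \<omega> = x k) =
    (if growth_path d l x then schur d (x l) p else 0)"
proof -
  have "take k (map \<omega> [0..<l]) = map \<omega> [0..<k]" if "k \<le> l" for k and \<omega> :: "nat \<Rightarrow> letter"
    using that by (simp add: take_map)
  then have "{\<omega> \<in> space (letter_space d p). \<forall>k\<le>l. shape_process d k \<omega> = x k} =
      {\<omega> \<in> space (letter_space d p). map \<omega> [0..<l] \<in> path_words d l x}"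
    by (auto simp: path_words_def shape_process_def space_letter_space)
  moreover have "path_words d l x \<subseteq> {w. length w = l \<and> set w \<subseteq> alphabet d}"
    by (auto simp: path_words_def)
  ultimately show ?thesis
    using measure_words(2)[of "path_words d l x" l] sum_path_words[OF assms, of p] by presburger
qed

lemma countable_partitions: "countable (partitions d)"
proof (rule countable_subset)
  show "countable (range part_at)" by simp
  show "partitions d \<subseteq> range part_at"
  proof
    fix la assume "la \<in> partitions d"
    then have "\<exists>k. \<forall>i\<ge>k. la i = 0"
    proof (cases d)
      case (GlSuper m n)
      then have "finite {i. la i \<noteq> 0}" using \<open>la \<in> partitions d\<close> by simp
      then obtain k where "\<forall>i\<in>{i. la i \<noteq> 0}. i < k" using finite_nat_set_iff_bounded by blast
      then show ?thesis by (intro exI[of _ k]) (auto simp: not_less[symmetric])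
    qed auto
    then obtain k where "\<forall>i\<ge>k. la i = 0" by blast
    then have "la = part_at (map la [0..<k])" by (auto simp: part_at_def fun_eq_iff)
    then show "la \<in> range part_at" by blast
  qed
qed

lemma shape_process_partition:
  "\<omega> \<in> space (letter_space d p) \<Longrightarrow> shape_process d l \<omega> \<in> partitions d"
  unfolding shape_process_def
  using shape_partition(1) P_tableau_letter_tableaux[OF word_of_sample] by blast

lemma measurable_shape_process:
  "shape_process d l \<in> measurable (letter_space d p) (count_space (partitions d))"
proof -
  have "shape_process d l -` {la} \<inter> space (letter_space d p) \<in> sets (letter_space d p)" for la
  proof -
    let ?W = "{w. length w = l \<and> set w \<subseteq> alphabet d \<and> shape d (P_tableau d w) = la}"
    have "shape_process d l -` {la} \<inter> space (letter_space d p) =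
        {\<omega> \<in> space (letter_space d p). map \<omega> [0..<l] \<in> ?W}"
      using word_of_sample by (auto simp: shape_process_def)
    then show ?thesis using measure_words(1)[of ?W l] by auto
  qed
  then show ?thesis
    using shape_process_partition by (auto simp: measurable_count_space_eq_countable[OF countable_partitions])
qed

lemma kernel_has_sum:
  assumes "mu \<in> partitions d"
  shows "(shape_kernel d p mu has_sum 1) (partitions d)"
proof -
  have "(\<Sum>la\<in>covers d mu. shape_kernel d p mu la) = (\<Sum>la\<in>covers d mu. schur d la p) / schur d mu p"
    unfolding sum_divide_distrib by (intro sum.cong refl) (auto simp: shape_kernel_def covers_def)
  also have "\<dots> = 1" using pieri[OF assms, of p] p_sum schur_pos[OF p_pos assms] by simp
  finally have "(shape_kernel d p mu has_sum 1) (covers d mu)"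
    using has_sum_finite[OF finite_covers[OF assms], of "shape_kernel d p mu"] by simp
  then show ?thesis
    by (rule has_sum_cong_neutral[THEN iffD1, rotated -1]) (auto simp: covers_def shape_kernel_def)
qed

lemma shape_process_transition:
  assumes x: "\<forall>k\<le>l. x k \<in> partitions d" and y: "y \<in> partitions d"
    and pos: "\<P>(\<omega> in letter_space d p. \<forall>k\<le>l. shape_process d k \<omega> = x k) \<noteq> 0"
  shows "\<P>(\<omega> in letter_space d p. shape_process d (Suc l) \<omega> = y \<bar> \<forall>k\<le>l. shape_process d k \<omega> = x k) =
    shape_kernel d p (x l) y"
proof -
  let ?x = "x(Suc l := y)"
  have growth: "growth_path d l x"
    using pos prob_path[OF x] by (auto split: if_splits)
  have "(shape_process d (Suc l) \<omega> = y \<and> (\<forall>k\<le>l. shape_process d k \<omega> = x k)) \<longleftrightarrow>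
      (\<forall>k\<le>Suc l. shape_process d k \<omega> = ?x k)" for \<omega>
    by (auto simp: le_Suc_eq)
  moreover have "growth_path d (Suc l) ?x \<longleftrightarrow> adds_box d (x l) y"
    using growth by (auto simp: growth_path_def less_Suc_eq)
  moreover have "\<forall>k\<le>Suc l. ?x k \<in> partitions d" using x y by auto
  ultimately show ?thesis
    using prob_path[of "Suc l" ?x] prob_path[OF x] growth
    by (simp add: cond_prob_def shape_kernel_def)
qed

lemma markov_chain_shape_process:
  "markov_chain (letter_space d p) (shape_process d) (partitions d) (shape_kernel d p)"
  unfolding markov_chain_def
proof (intro conjI allI ballI impI)
  show "prob_space (letter_space d p)" unfolding letter_space_eq by (rule P.prob_space_axioms)
  fix mu la assume "mu \<in> partitions d" "la \<in> partitions d"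
  then show "0 \<le> shape_kernel d p mu la"
    using schur_pos[OF p_pos] by (simp add: shape_kernel_def less_imp_le)
qed (use countable_partitions measurable_shape_process kernel_has_sum shape_process_transition in auto)

end

theorem theorem5p2p3:
  fixes d :: diamond and p :: "letter \<Rightarrow> real"
  assumes "positive_params d"
    and "\<forall>i\<in>alphabet d. 0 < p i \<and> p i < 1"
    and "(\<Sum>i\<in>alphabet d. p i) = 1"
  shows "markov_chain (letter_space d p) (shape_process d) (partitions d) (shape_kernel d p)"
proof -
  interpret letters d p using assms by unfold_locales auto
  show ?thesis by (rule markov_chain_shape_process)
qed

end
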